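(* Assume $\gamma_{div}\le1$. Let $J\in H_0(\mathrm{curl})'$, let $E\in H_0(\mathrm{curl})$ be the solution of $b(E,w)=\langle J,w\rangle$ for all $w\in H_0(\mathrm{curl})$, and let $E_h\in V_{h0}$ be any solution of $b(E_h,w_h)=\langle J,w_h\rangle$ for all $w_h\in V_{h0}$. Then $$(1-15\gamma_{div}-4\gamma_{ap}^2)\,|||E-E_h|||\le\min_{v_h\in V_{h0}}|||E-v_h|||.$$ Consequently, if $15\gamma_{div}+4\gamma_{ap}^2<1$, the discrete problem (find $E_h\in V_{h0}$ with $b(E_h,w_h)=\langle J,w_h\rangle$ for all $w_h\in V_{h0}$) has a unique solution for every $J\in H_0(\mathrm{curl})'$.
   Context: Let $D\subset\mathbb R^3$ be an open, bounded, Lipschitz polyhedron (no assumption on its topology). Let $\epsilon,\nu$ be measurable symmetric positive-definite matrix-valued functions on $D$ with eigenvalues uniformly bounded above and below away from zero; $(v,w)_\epsilon=\int_D\epsilon v\cdot w$, $\|\cdot\|_\epsilon$, and similarly $(\cdot,\cdot)_\nu$, $\|\cdot\|_\nu$. $H_0(\mathrm{curl})=\{v\in L^2(D)^3:\mathrm{curl}\,v\in L^2(D)^3,\ v\times n_D=0\text{ on }\partial D\}$, $H_0(\mathrm{curl}^0)=\{v\in H_0(\mathrm{curl}):\mathrm{curl}\,v=0\}$. For a subspace $S$, $S^\perp$ is its $(\cdot,\cdot)_\epsilon$-orthogonal complement in $L^2(D)^3$; $\Pi_0$ is the $(\cdot,\cdot)_\epsilon$-orthogonal projection of $L^2(D)^3$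 onto $H_0(\mathrm{curl}^0)$. Let $\omega>0$, $b(v,w)=-\omega^2(v,w)_\epsilon+(\mathrm{curl}\,v,\mathrm{curl}\,w)_\nu$, $|||w|||^2=\omega^2\|w\|_\epsilon^2+\|\mathrm{curl}\,w\|_\nu^2$, and assume $\omega^2$ is not an eigenvalue: for every $\ell\in H_0(\mathrm{curl})'$ there is a unique $v\in H_0(\mathrm{curl})$ with $b(v,w)=\langle\ell,w\rangle$ for all $w\in H_0(\mathrm{curl})$. Let $\mathcal T_h$ be an affine simplicial mesh covering $D$ exactly, $k\ge0$, $V_{h0}=\{v_h\in H_0(\mathrm{curl}):v_h|_K\in\mathcal N_k\ \forall K\in\mathcal T_h\}$ with $\mathcal N_k$ the first-kind Nédélec polynomials of order $k$; $V_{h0}(\mathrm{curl}^0)=\{v_h\in V_{h0}:\mathrm{curl}\,v_h=0\}$, $X_{h0}=V_{h0}\cap V_{h0}(\mathrm{curl}^0)^\perp$. For $\theta\in H_0(\mathrm{curl}^0)^\perp$ let $\zeta_\theta\in H_0(\mathrm{curl})$ solve $b(w,\zeta_\theta)=(w,\theta)_\epsilon$ for all $w\in H_0(\mathrm{curl})$. Approximation factor: $\gamma_{ap}=\sup\{\min_{v_h\in V_{h0}}\omega|||\zeta_\theta-v_h|||:\theta\in H_0(\mathrm{curl}^0)^\perp,\|\theta\|_\epsilon=1\}$. Divergence conformity factor: $\gamma_{div}=\sup\{\omega\|\Pi_0(v_h)\|_\epsilon:v_h\in X_{h0},\|\mathrm{curl}\,v_h\|_\nu=1\}$. *)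

theory Defs
  imports "HOL-Analysis.Analysis"
begin

type_synonym vec3 = "real^3"

definition L2 :: "vec3 set \<Rightarrow> (vec3 \<Rightarrow> vec3) \<Rightarrow> bool" where
  "L2 D v \<longleftrightarrow> v \<in> borel_measurable (lebesgue_on D) \<and>
     integrable (lebesgue_on D) (\<lambda>x. (norm (v x))^2)"

definition pd :: "(vec3 \<Rightarrow> vec3) \<Rightarrow> 3 \<Rightarrow> 3 \<Rightarrow> vec3 \<Rightarrow> real" where
  "pd \<phi> i j x = (frechet_derivative \<phi> (at x) (axis i 1)) $ j"

definition curl_cl :: "(vec3 \<Rightarrow> vec3) \<Rightarrow> vec3 \<Rightarrow> vec3" where
  "curl_cl \<phi> x = vector [pd \<phi> 2 3 x - pd \<phi> 3 2 x,
                          pd \<phi> 3 1 x - pd \<phi> 1 3 x,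
                          pd \<phi> 1 2 x - pd \<phi> 2 1 x]"

definition test_field :: "(vec3 \<Rightarrow> vec3) \<Rightarrow> bool" where
  "test_field \<phi> \<longleftrightarrow> (\<forall>x. \<phi> differentiable (at x)) \<and>
     (\<forall>i j. continuous_on UNIV (pd \<phi> i j)) \<and> compact (closure {x. \<phi> x \<noteq> 0})"

text \<open>w is the curl of v in H_0(curl): integration by parts against all test fields
  on R^3 holds without boundary term (this encodes v x n = 0 on the boundary).\<close>
definition weak_curl0 :: "vec3 set \<Rightarrow> (vec3 \<Rightarrow> vec3) \<Rightarrow> (vec3 \<Rightarrow> vec3) \<Rightarrow> bool" where
  "weak_curl0 D v w \<longleftrightarrow> L2 D v \<and> L2 D w \<and>
     (\<forall>\<phi>. test_field \<phi> \<longrightarrow>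
        integral\<^sup>L (lebesgue_on D) (\<lambda>x. v x \<bullet> curl_cl \<phi> x) =
        integral\<^sup>L (lebesgue_on D) (\<lambda>x. w x \<bullet> \<phi> x))"

definition H0curl :: "vec3 set \<Rightarrow> (vec3 \<Rightarrow> vec3) set" where
  "H0curl D = {v. \<exists>w. weak_curl0 D v w}"

definition curl :: "vec3 set \<Rightarrow> (vec3 \<Rightarrow> vec3) \<Rightarrow> (vec3 \<Rightarrow> vec3)" where
  "curl D v = (SOME w. weak_curl0 D v w)"

definition H0curl0 :: "vec3 set \<Rightarrow> (vec3 \<Rightarrow> vec3) set" where
  "H0curl0 D = {v \<in> H0curl D. weak_curl0 D v (\<lambda>x. 0)}"

definition admissible_coeff :: "vec3 set \<Rightarrow> (vec3 \<Rightarrow> real^3^3) \<Rightarrow> bool" where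
  "admissible_coeff D \<epsilon> \<longleftrightarrow>
     (\<forall>i j. (\<lambda>x. \<epsilon> x $ i $ j) \<in> borel_measurable (lebesgue_on D)) \<and>
     (\<forall>x\<in>D. transpose (\<epsilon> x) = \<epsilon> x) \<and>
     (\<exists>c C. 0 < c \<and> (\<forall>x\<in>D. \<forall>(lam::real) \<xi>. \<xi> \<noteq> 0 \<and> \<epsilon> x *v \<xi> = lam *\<^sub>R \<xi> \<longrightarrow>
                                  c \<le> lam \<and> lam \<le> C))"

definition ip :: "vec3 set \<Rightarrow> (vec3 \<Rightarrow> real^3^3) \<Rightarrow> (vec3 \<Rightarrow> vec3) \<Rightarrow> (vec3 \<Rightarrow> vec3) \<Rightarrow> real" where
  "ip D \<epsilon> v w = integral\<^sup>L (lebesgue_on D) (\<lambda>x. (\<epsilon> x *v v x) \<bullet> w x)"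

definition wnorm :: "vec3 set \<Rightarrow> (vec3 \<Rightarrow> real^3^3) \<Rightarrow> (vec3 \<Rightarrow> vec3) \<Rightarrow> real" where
  "wnorm D \<epsilon> v = sqrt (ip D \<epsilon> v v)"

definition orth :: "vec3 set \<Rightarrow> (vec3 \<Rightarrow> real^3^3) \<Rightarrow> (vec3 \<Rightarrow> vec3) set \<Rightarrow> (vec3 \<Rightarrow> vec3) set" where
  "orth D \<epsilon> S = {v. L2 D v \<and> (\<forall>s\<in>S. ip D \<epsilon> v s = 0)}"

definition bform :: "vec3 set \<Rightarrow> (vec3 \<Rightarrow> real^3^3) \<Rightarrow> (vec3 \<Rightarrow> real^3^3) \<Rightarrow> real
     \<Rightarrow> (vec3 \<Rightarrow> vec3) \<Rightarrow> (vec3 \<Rightarrow> vec3) \<Rightarrow> real" where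
  "bform D \<epsilon> \<nu> \<omega> v w = - (\<omega>^2) * ip D \<epsilon> v w + ip D \<nu> (curl D v) (curl D w)"

definition tnorm :: "vec3 set \<Rightarrow> (vec3 \<Rightarrow> real^3^3) \<Rightarrow> (vec3 \<Rightarrow> real^3^3) \<Rightarrow> real
     \<Rightarrow> (vec3 \<Rightarrow> vec3) \<Rightarrow> real" where
  "tnorm D \<epsilon> \<nu> \<omega> w = sqrt (\<omega>^2 * (wnorm D \<epsilon> w)^2 + (wnorm D \<nu> (curl D w))^2)"

definition dual :: "vec3 set \<Rightarrow> (vec3 \<Rightarrow> real^3^3) \<Rightarrow> (vec3 \<Rightarrow> real^3^3) \<Rightarrow> real
     \<Rightarrow> ((vec3 \<Rightarrow> vec3) \<Rightarrow> real) set" where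
  "dual D \<epsilon> \<nu> \<omega> = {L.
     (\<forall>v\<in>H0curl D. \<forall>w\<in>H0curl D. L (\<lambda>x. v x + w x) = L v + L w) \<and>
     (\<forall>a. \<forall>v\<in>H0curl D. L (\<lambda>x. a *\<^sub>R v x) = a * L v) \<and>
     (\<exists>C. \<forall>w\<in>H0curl D. \<bar>L w\<bar> \<le> C * tnorm D \<epsilon> \<nu> \<omega> w)}"

definition lipschitz_domain :: "vec3 set \<Rightarrow> bool" where
  "lipschitz_domain D \<longleftrightarrow> open D \<and> bounded D \<and>
     (\<forall>x\<in>frontier D. \<exists>(Q :: vec3 \<Rightarrow> vec3) r (g :: real \<times> real \<Rightarrow> real) (L::real).
        orthogonal_transformation Q \<and> 0 < r \<and> L-lipschitz_on UNIV g \<and>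
        D \<inter> ball x r = {y \<in> ball x r. Q (y - x) $ 3 < g (Q (y - x) $ 1, Q (y - x) $ 2)})"

definition simplicial_mesh :: "vec3 set \<Rightarrow> vec3 set set \<Rightarrow> bool" where
  "simplicial_mesh D T \<longleftrightarrow> finite T \<and>
     (\<forall>K\<in>T. card K = 4 \<and> \<not> affine_dependent K) \<and>
     \<Union> ((\<lambda>K. convex hull K) ` T) = closure D \<and>
     (\<forall>K\<in>T. \<forall>K'\<in>T. K \<noteq> K' \<longrightarrow>
        (convex hull K) \<inter> (convex hull K') = convex hull (K \<inter> K'))"

definition monom :: "nat * nat * nat \<Rightarrow> vec3 \<Rightarrow> real" where
  "monom m x = (case m of (a, b, c) \<Rightarrow> x$1 ^ a * x$2 ^ b * x$3 ^ c)"

definition mdeg :: "nat * nat * nat \<Rightarrow> nat" where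
  "mdeg m = (case m of (a, b, c) \<Rightarrow> a + b + c)"

definition poly_le :: "nat \<Rightarrow> (vec3 \<Rightarrow> real) \<Rightarrow> bool" where
  "poly_le k f \<longleftrightarrow> (\<exists>c. \<forall>x. f x = (\<Sum>m\<in>{m. mdeg m \<le> k}. c m * monom m x))"

definition poly_hom :: "nat \<Rightarrow> (vec3 \<Rightarrow> real) \<Rightarrow> bool" where
  "poly_hom k f \<longleftrightarrow> (\<exists>c. \<forall>x. f x = (\<Sum>m\<in>{m. mdeg m = k}. c m * monom m x))"

definition nedelec :: "nat \<Rightarrow> (vec3 \<Rightarrow> vec3) \<Rightarrow> bool" where
  "nedelec k f \<longleftrightarrow> (\<exists>p q. (\<forall>i. poly_le k (\<lambda>x. p x $ i)) \<and> (\<forall>i. poly_hom k (\<lambda>x. q x $ i)) \<and>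
       (\<forall>x. f x = p x + cross3 x (q x)))"

definition Vh0 :: "vec3 set \<Rightarrow> vec3 set set \<Rightarrow> nat \<Rightarrow> (vec3 \<Rightarrow> vec3) set" where
  "Vh0 D T k = {v \<in> H0curl D. \<forall>K\<in>T. \<exists>f. nedelec k f \<and>
       (AE x in lebesgue_on (interior (convex hull K)). v x = f x)}"

definition Vh0_curl0 :: "vec3 set \<Rightarrow> vec3 set set \<Rightarrow> nat \<Rightarrow> (vec3 \<Rightarrow> vec3) set" where
  "Vh0_curl0 D T k = {v \<in> Vh0 D T k. v \<in> H0curl0 D}"

definition Xh0 :: "vec3 set \<Rightarrow> (vec3 \<Rightarrow> real^3^3) \<Rightarrow> vec3 set set \<Rightarrow> nat \<Rightarrow> (vec3 \<Rightarrow> vec3) set" where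
  "Xh0 D \<epsilon> T k = Vh0 D T k \<inter> orth D \<epsilon> (Vh0_curl0 D T k)"

section \<open>The two factors (sup over empty set read as 0; all values are nonnegative)\<close>

definition gamma_ap :: "vec3 set \<Rightarrow> (vec3 \<Rightarrow> real^3^3) \<Rightarrow> (vec3 \<Rightarrow> real^3^3) \<Rightarrow> real
     \<Rightarrow> vec3 set set \<Rightarrow> nat \<Rightarrow> real" where
  "gamma_ap D \<epsilon> \<nu> \<omega> T k = Sup (insert 0
     {Inf {\<omega> * tnorm D \<epsilon> \<nu> \<omega> (\<lambda>x. \<zeta> x - vh x) | vh. vh \<in> Vh0 D T k} | \<theta> \<zeta>.
        \<theta> \<in> orth D \<epsilon> (H0curl0 D) \<and> wnorm D \<epsilon> \<theta> = 1 \<and> \<zeta> \<in> H0curl D \<and>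
        (\<forall>w\<in>H0curl D. bform D \<epsilon> \<nu> \<omega> w \<zeta> = ip D \<epsilon> w \<theta>)})"

text \<open>Pi_0 v is characterised as the p in H_0(curl^0) with v - p eps-orthogonal to H_0(curl^0)\<close>
definition gamma_div :: "vec3 set \<Rightarrow> (vec3 \<Rightarrow> real^3^3) \<Rightarrow> (vec3 \<Rightarrow> real^3^3) \<Rightarrow> real
     \<Rightarrow> vec3 set set \<Rightarrow> nat \<Rightarrow> real" where
  "gamma_div D \<epsilon> \<nu> \<omega> T k = Sup (insert 0
     {\<omega> * wnorm D \<epsilon> p | vh p. vh \<in> Xh0 D \<epsilon> T k \<and> wnorm D \<nu> (curl D vh) = 1 \<and>
        p \<in> H0curl0 D \<and> (\<lambda>x. vh x - p x) \<in> orth D \<epsilon> (H0curl0 D)})"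

end

theory Submission
  imports Defs "HOL-Library.Function_Algebras"
begin

text \<open>
  Write \<open>r = E - E\<^sub>h = r\<^sub>0 + \<theta>\<close> with \<open>r\<^sub>0 = \<Pi>\<^sub>0 r\<close>, and \<open>\<eta> = E - v\<^sub>h\<close> for an arbitrary discrete \<open>v\<^sub>h\<close>.
  Galerkin orthogonality and duality give \<open>\<omega> \<parallel>\<theta>\<parallel> \<le> \<gamma>\<^sub>a\<^sub>p |||r|||\<close>.
  Splitting \<open>v\<^sub>h - E\<^sub>h\<close> into a discrete curl-free field and \<open>x \<in> X\<^sub>h\<^sub>0\<close>, and using that \<open>r\<close> is orthogonal
  to discrete curl-free fields, one gets \<open>\<parallel>r\<^sub>0\<parallel>\<^sup>2 = (r\<^sub>0, \<eta>) + (r\<^sub>0, \<Pi>\<^sub>0 x)\<close>. Inserting this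
  into \<open>|||r|||\<^sup>2 = b(r, \<eta>) + 2 \<omega>\<^sup>2 \<parallel>r\<^sub>0\<parallel>\<^sup>2 + 2 \<omega>\<^sup>2 \<parallel>\<theta>\<parallel>\<^sup>2\<close> turns \<open>- \<omega>\<^sup>2 (r, \<eta>)\<close> into
  \<open>\<omega>\<^sup>2 (r\<^sub>0 - \<theta>, \<eta>)\<close>, and since \<open>\<parallel>r\<^sub>0 - \<theta>\<parallel> = \<parallel>r\<parallel>\<close> the leading term is at most \<open>|||r||| |||\<eta>|||\<close>.

  The suprema defining the two factors are finite: for \<open>\<gamma>\<^sub>d\<^sub>i\<^sub>v\<close> because the discrete space is finite
  dimensional modulo null functions, for \<open>\<gamma>\<^sub>a\<^sub>p\<close> because solvability for all data forces the
  solution operator to be bounded (a gliding hump argument, which needs only completeness of the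
  dual). The bounded inverse also makes \<open>H\<^sub>0(curl)\<close> complete, whence the existence of \<open>\<Pi>\<^sub>0\<close>.
\<close>

section \<open>Semi-inner products and finite-dimensional subspaces\<close>

text \<open>Fields are plain functions, determined only up to null sets; \<open>ip\<close> is
  meaningful only on square-integrable fields, and \<open>curl\<close> is a choice that is linear
  only almost everywhere. All forms are therefore treated as semi-definite, and as bilinear merely
  on a subspace; by Cauchy-Schwarz null vectors are orthogonal to everything, which takes the place
  of passing to quotients. The real \<open>Sup\<close> carries information only for sets that are
  bounded above, so both factors must be shown finite before either can serve as a bound.
  Completeness of \<open>H\<close> is not among the abstract assumptions. Where a limit is required,
  it is produced by solving the continuous problem for the limit of the functionals
  \<open>b (p n)\<close>. The estimate reached is \<open>1 - 4 * g_div - 2 * g_ap\<^sup>2\<close>.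
  Each contribution carries the factor 2 that arises when the energy norm is rewritten through
  \<open>b\<close>; the divergence contribution doubles once more because it is measured by the sum
  of the error and the approximation error.\<close>

locale semi_inner =
  fixes V :: "'a::real_vector set" and f :: "'a \<Rightarrow> 'a \<Rightarrow> real"
  assumes subspace_V: "subspace V"
    and sym: "x \<in> V \<Longrightarrow> y \<in> V \<Longrightarrow> f x y = f y x"
    and add_left: "x \<in> V \<Longrightarrow> y \<in> V \<Longrightarrow> z \<in> V \<Longrightarrow> f (x + y) z = f x z + f y z"
    and scale_left: "x \<in> V \<Longrightarrow> y \<in> V \<Longrightarrow> f (r *\<^sub>R x) y = r * f x y"
    and nonneg: "x \<in> V \<Longrightarrow> 0 \<le> f x x"
begin

lemmas mem [simp] = subspace_add[OF subspace_V] subspace_diff[OF subspace_V]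
  subspace_scale[OF subspace_V] subspace_0[OF subspace_V]

lemma add_right: "x \<in> V \<Longrightarrow> y \<in> V \<Longrightarrow> z \<in> V \<Longrightarrow> f z (x + y) = f z x + f z y"
  by (simp add: sym[of z] add_left)

lemma scale_right: "x \<in> V \<Longrightarrow> y \<in> V \<Longrightarrow> f y (r *\<^sub>R x) = r * f y x"
  by (simp add: sym[of y] scale_left)

lemma diff_left: "x \<in> V \<Longrightarrow> y \<in> V \<Longrightarrow> z \<in> V \<Longrightarrow> f (x - y) z = f x z - f y z"
  using add_left[of "x - y" y z] by simp

lemma diff_right: "x \<in> V \<Longrightarrow> y \<in> V \<Longrightarrow> z \<in> V \<Longrightarrow> f z (x - y) = f z x - f z y"
  by (simp add: sym[of z] diff_left)

lemma zero_left [simp]: "x \<in> V \<Longrightarrow> f 0 x = 0"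
  using scale_left[of x x 0] by simp

lemma zero_right [simp]: "x \<in> V \<Longrightarrow> f x 0 = 0"
  by (simp add: sym[of x])

lemmas lin = add_left add_right scale_left scale_right diff_left diff_right

lemma sum_left:
  assumes "finite S" "S \<subseteq> V" "y \<in> V"
  shows "f (\<Sum>x\<in>S. k x *\<^sub>R x) y = (\<Sum>x\<in>S. k x * f x y)"
  using assms
proof (induction S rule: finite_induct)
  case (insert x S)
  have "(\<Sum>x\<in>S. k x *\<^sub>R x) \<in> V"
    using insert by (intro subspace_sum[OF subspace_V]) auto
  with insert show ?case by (simp add: lin)
qed simp

lemma Cauchy_Schwarz_sq:
  assumes "x \<in> V" "y \<in> V"
  shows "(f x y)\<^sup>2 \<le> f x x * f y y"
proof -
  have *: "0 \<le> f x x - 2 * t * f x y + t\<^sup>2 * f y y" for t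
    using nonneg[of "x - t *\<^sub>R y"] assms
    by (simp add: lin sym[of y x] algebra_simps power2_eq_square)
  show ?thesis
  proof (cases "f y y = 0")
    case True
    \<comment> \<open>The quadratic in \<open>t\<close> degenerates to an affine function; were its
      slope nonzero, the chosen \<open>t\<close> would give it the value -1.\<close>
    have "f x y = 0"
    proof (rule ccontr)
      assume "f x y \<noteq> 0"
      then show False
        using *[of "(f x x + 1) / (2 * f x y)"] True by (simp add: field_simps)
    qed
    then show ?thesis using True by simp
  next
    case False
    then have "f y y > 0" using nonneg[of y] assms by simp
    then show ?thesis
      using *[of "f x y / f y y"] by (simp add: field_simps power2_eq_square)
  qed
qed

definition nrm :: "'a \<Rightarrow> real" where "nrm x = sqrt (f x x)"

lemma nrm_nonneg [simp]: "x \<in> V \<Longrightarrow> 0 \<le> nrm x"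
  by (simp add: nrm_def nonneg)

lemma nrm_sq: "x \<in> V \<Longrightarrow> (nrm x)\<^sup>2 = f x x"
  by (simp add: nrm_def nonneg)

lemma nrm_zero [simp]: "nrm 0 = 0"
  by (simp add: nrm_def)

lemma Cauchy_Schwarz:
  assumes "x \<in> V" "y \<in> V"
  shows "\<bar>f x y\<bar> \<le> nrm x * nrm y"
  using real_sqrt_le_mono[OF Cauchy_Schwarz_sq[OF assms]]
  by (simp add: nrm_def real_sqrt_mult)

lemma null_left: "x \<in> V \<Longrightarrow> y \<in> V \<Longrightarrow> f x x = 0 \<Longrightarrow> f x y = 0"
  using Cauchy_Schwarz_sq[of x y] by simp

lemma null_right: "x \<in> V \<Longrightarrow> y \<in> V \<Longrightarrow> f x x = 0 \<Longrightarrow> f y x = 0"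
  using null_left[of x y] sym[of x y] by simp

lemma null_add: "x \<in> V \<Longrightarrow> y \<in> V \<Longrightarrow> f x x = 0 \<Longrightarrow> f y y = 0 \<Longrightarrow> f (x + y) (x + y) = 0"
  by (simp add: lin null_left)

lemma nrm_scale: "x \<in> V \<Longrightarrow> nrm (r *\<^sub>R x) = \<bar>r\<bar> * nrm x"
  by (simp add: nrm_def lin real_sqrt_mult mult.assoc[symmetric])

lemma nrm_triangle:
  assumes "x \<in> V" "y \<in> V"
  shows "nrm (x + y) \<le> nrm x + nrm y"
proof -
  have "f (x + y) (x + y) \<le> (nrm x + nrm y)\<^sup>2"
    using Cauchy_Schwarz[OF assms] assms
    by (simp add: lin sym[of y x] power2_sum nrm_sq)
  then show ?thesis
    unfolding nrm_def[of "x + y"] using assms by (intro real_le_lsqrt) auto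
qed

lemma nrm_triangle_diff:
  assumes "x \<in> V" "y \<in> V"
  shows "nrm (x - y) \<le> nrm x + nrm y"
  using nrm_triangle[of x "(-1) *\<^sub>R y"] assms nrm_scale[of y "-1"] mem(3)[of y "-1"] by simp

text \<open>Gram-Schmidt modulo null vectors. \<open>B\<close> spans \<open>W\<close> only modulo
  \<open>N\<close> and need not lie in \<open>V\<close>, so generators of no regularity are allowed.
  The induction therefore removes generators from \<open>B\<close> and shrinks \<open>W\<close>
  accordingly, to a subspace \<open>W'\<close> of codimension at most one. Since \<open>f\<close>
  may degenerate on \<open>W\<close>, the span of \<open>S\<close> is reached only up to
  \<open>f\<close>-null vectors.\<close>

lemma orthonormal_basis_exists:
  assumes "finite B" and N: "subspace N" and W: "subspace W" "W \<subseteq> V"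
    and "\<And>v. v \<in> W \<Longrightarrow> v \<in> N \<Longrightarrow> f v v = 0"
    and "\<And>v. v \<in> W \<Longrightarrow> \<exists>s\<in>span B. v - s \<in> N"
  shows "\<exists>S. finite S \<and> S \<subseteq> W \<and> (\<forall>x\<in>S. \<forall>y\<in>S. f x y = (if x = y then 1 else 0)) \<and>
    (\<forall>v\<in>W. \<exists>s\<in>span S. f (v - s) (v - s) = 0)"
  using assms(1,3-)
proof (induction B arbitrary: W rule: finite_induct)
  case empty
  show ?case
    by (intro exI[of _ "{}"]) (use empty in fastforce)
next
  case (insert a B)
  define W' where "W' = {v \<in> W. \<exists>s\<in>span B. v - s \<in> N}"
  have sub': "subspace W'"
  proof (rule subspaceI)
    show "0 \<in> W'"
      using insert.prems(1) N
      by (auto simp: W'_def subspace_0 intro!: bexI[of _ 0] span_zero)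
  next
    fix x y assume "x \<in> W'" "y \<in> W'"
    then obtain s t where st: "x \<in> W" "y \<in> W" "s \<in> span B" "t \<in> span B" "x - s \<in> N" "y - t \<in> N"
      by (auto simp: W'_def)
    have "(x + y) - (s + t) \<in> N"
      using subspace_add[OF N st(5,6)] by (simp add: algebra_simps)
    with st show "x + y \<in> W'"
      using insert.prems(1) by (auto simp: W'_def subspace_add intro!: bexI[of _ "s + t"] span_add)
  next
    fix r x assume "x \<in> W'"
    then obtain s where st: "x \<in> W" "s \<in> span B" "x - s \<in> N"
      by (auto simp: W'_def)
    have "r *\<^sub>R x - r *\<^sub>R s \<in> N"
      using subspace_scale[OF N st(3), of r] by (simp add: algebra_simps)
    with st show "r *\<^sub>R x \<in> W'"
      using insert.prems(1)
      by (auto simp: W'_def subspace_scale intro!: bexI[of _ "r *\<^sub>R s"] span_scale)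
  qed
  have "\<exists>S. finite S \<and> S \<subseteq> W' \<and> (\<forall>x\<in>S. \<forall>y\<in>S. f x y = (if x = y then 1 else 0)) \<and>
    (\<forall>v\<in>W'. \<exists>s\<in>span S. f (v - s) (v - s) = 0)"
    by (rule insert.IH[OF sub']) (use insert.prems in \<open>auto simp: W'_def\<close>)
  then obtain S where S: "finite S" "S \<subseteq> W'" "\<forall>x\<in>S. \<forall>y\<in>S. f x y = (if x = y then 1 else 0)"
    "\<forall>v\<in>W'. \<exists>s\<in>span S. f (v - s) (v - s) = 0" by blast
  have SW: "S \<subseteq> W" and SV: "S \<subseteq> V" using S(2) insert.prems(2) by (auto simp: W'_def)
  show ?case
  proof (cases "W' = W")
    case True
    show ?thesis using S unfolding True by (intro exI[of _ S] conjI)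
  next
    case False
    then obtain v0 where v0: "v0 \<in> W" "v0 \<notin> W'" by (auto simp: W'_def)
    \<comment> \<open>The coefficient \<open>j0\<close> of \<open>a\<close> in \<open>v0\<close> is
      nonzero because \<open>v0 \<notin> W'\<close>, so a multiple of \<open>v0\<close> cancels the
      coefficient of \<open>a\<close> in \<open>v\<close>.\<close>
    have rep: "\<exists>t. v - t *\<^sub>R v0 \<in> W'" if v: "v \<in> W" for v
    proof -
      obtain s where s: "s \<in> span (insert a B)" "v - s \<in> N" using insert.prems(4)[OF v] by blast
      obtain s0 where s0: "s0 \<in> span (insert a B)" "v0 - s0 \<in> N"
        using insert.prems(4)[OF v0(1)] by blast
      obtain j where j: "s - j *\<^sub>R a \<in> span B" using s(1) span_breakdown_eq by blast
      obtain j0 where j0: "s0 - j0 *\<^sub>R a \<in> span B" using s0(1) span_breakdown_eq by blast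
      have "j0 \<noteq> 0" using j0 s0 v0 by (auto simp: W'_def)
      define t where "t = j / j0"
      have "(s - j *\<^sub>R a) - t *\<^sub>R (s0 - j0 *\<^sub>R a) \<in> span B"
        by (intro span_diff span_scale j j0)
      moreover have "(s - j *\<^sub>R a) - t *\<^sub>R (s0 - j0 *\<^sub>R a) = s - t *\<^sub>R s0"
        using \<open>j0 \<noteq> 0\<close> by (simp add: t_def algebra_simps)
      moreover have "(v - t *\<^sub>R v0) - (s - t *\<^sub>R s0) \<in> N"
        using subspace_diff[OF N s(2) subspace_scale[OF N s0(2), of t]] by (simp add: algebra_simps)
      ultimately show ?thesis
        using v v0(1) insert.prems(1)
        by (auto simp: W'_def subspace_diff subspace_scale intro!: exI[of _ t])
    qed
    define p where "p = (\<Sum>x\<in>S. f v0 x *\<^sub>R x)"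
    define u where "u = v0 - p"
    have pspan: "p \<in> span S" unfolding p_def by (intro span_sum span_scale span_base)
    have pW: "p \<in> W" unfolding p_def
      using SW insert.prems(1) by (intro subspace_sum subspace_scale) auto
    have uW: "u \<in> W" using pW v0 insert.prems(1) by (simp add: u_def subspace_diff)
    have V: "p \<in> V" "u \<in> V" "v0 \<in> V" using pW uW v0 insert.prems(2) by auto
    have u_orth: "f u s = 0" if "s \<in> S" for s
    proof -
      have sV: "s \<in> V" using that SV by auto
      have "f p s = (\<Sum>x\<in>S. f v0 x * f x s)"
        unfolding p_def by (rule sum_left[OF S(1) SV sV])
      also have "\<dots> = (\<Sum>x\<in>S. if x = s then f v0 x else 0)"
        using S(3) that by (intro sum.cong) auto
      also have "\<dots> = f v0 s" using S(1) that by simp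
      finally show ?thesis using V sV by (simp add: u_def lin)
    qed
    \<comment> \<open>It suffices to extend \<open>S\<close> until \<open>v0\<close> is spanned up
      to a null vector. If \<open>u\<close> is null, \<open>S\<close> itself with
      \<open>z = p\<close> does it; otherwise \<open>u\<close> is normalised to \<open>e\<close> and
      adjoined, with \<open>z = v0\<close>.\<close>
    have step: ?thesis
      if S': "finite S'" "S \<subseteq> S'" "S' \<subseteq> W" "\<forall>x\<in>S'. \<forall>y\<in>S'. f x y = (if x = y then 1 else 0)"
        and z: "z \<in> span S'" "f (v0 - z) (v0 - z) = 0" for S' z
    proof (intro exI[of _ S'] conjI ballI S')
      fix v assume v: "v \<in> W"
      obtain t where t: "v - t *\<^sub>R v0 \<in> W'" using rep[OF v] by blast
      then obtain s where s: "s \<in> span S" "f (v - t *\<^sub>R v0 - s) (v - t *\<^sub>R v0 - s) = 0"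
        using S(4) by blast
      have zW: "z \<in> W" using z(1) S'(3) insert.prems(1) span_minimal by blast
      have sW: "s \<in> W" using s(1) SW insert.prems(1) span_minimal by blast
      have in_V: "z \<in> V" "s \<in> V" "v \<in> V" using zW sW v insert.prems(2) by auto
      have "f ((v - t *\<^sub>R v0 - s) + t *\<^sub>R (v0 - z)) ((v - t *\<^sub>R v0 - s) + t *\<^sub>R (v0 - z)) = 0"
        using in_V V s(2) z(2) by (intro null_add) (simp_all add: scale_left scale_right)
      moreover have "(v - t *\<^sub>R v0 - s) + t *\<^sub>R (v0 - z) = v - (s + t *\<^sub>R z)"
        by (simp add: algebra_simps)
      moreover have "s + t *\<^sub>R z \<in> span S'"
        using s(1) z(1) span_mono[OF S'(2)] by (auto intro!: span_add span_scale)
      ultimately show "\<exists>s\<in>span S'. f (v - s) (v - s) = 0" by metis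
    qed (use S' in auto)
    show ?thesis
    proof (cases "f u u = 0")
      case True
      show ?thesis
        by (rule step[of S p]) (use S SW pspan True in \<open>auto simp: u_def\<close>)
    next
      case False
      then have fu: "f u u > 0" using nonneg[OF V(2)] by simp
      define e where "e = (1 / sqrt (f u u)) *\<^sub>R u"
      have eW: "e \<in> W" using uW insert.prems(1) by (simp add: e_def subspace_scale)
      have eV: "e \<in> V" using eW insert.prems(2) by auto
      have ee: "f e e = 1" using V fu by (simp add: e_def lin)
      have es: "f e s = 0" if "s \<in> S" for s
        using u_orth[OF that] that SV V by (auto simp: e_def lin)
      have se: "f s e = 0" if "s \<in> S" for s
        using es[OF that] sym[of s e] eV that SV by auto
      have "e \<notin> S" using ee es by force
      have "u = sqrt (f u u) *\<^sub>R e" using fu by (simp add: e_def)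
      then have "u \<in> span (insert e S)" by (metis span_base span_scale insertI1)
      moreover have "p \<in> span (insert e S)" using pspan span_mono[of S "insert e S"] by auto
      ultimately have "v0 \<in> span (insert e S)" using span_add[of u _ p] by (simp add: u_def)
      then show ?thesis
        by (intro step[of "insert e S" v0]) (use S SW eW ee es se \<open>e \<notin> S\<close> in auto)
    qed
  qed
qed

text \<open>Since \<open>v - s\<close> is null, it is orthogonal to \<open>S\<close>, so the
  coefficients of \<open>s\<close> can be read off from \<open>v\<close>.\<close>

lemma orthonormal_expansion:
  assumes S: "finite S" "S \<subseteq> V" "\<forall>x\<in>S. \<forall>y\<in>S. f x y = (if x = y then 1 else 0)"
    and v: "v \<in> V" and s: "s \<in> span S" "f (v - s) (v - s) = 0"
  shows "s = (\<Sum>x\<in>S. f v x *\<^sub>R x)"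
proof -
  obtain k where k: "s = (\<Sum>x\<in>S. k x *\<^sub>R x)"
    using s(1) span_finite[OF S(1)] by auto
  have sV: "s \<in> V" using s(1) S(2) span_minimal[OF _ subspace_V] by blast
  have "f v y = k y" if y: "y \<in> S" for y
  proof -
    have yV: "y \<in> V" using y S(2) by auto
    have "f v y = f s y"
      using null_left[of "v - s" y] v sV yV s(2) by (simp add: lin)
    also have "\<dots> = (\<Sum>x\<in>S. k x * f x y)"
      unfolding k by (rule sum_left[OF S(1,2) yV])
    also have "\<dots> = (\<Sum>x\<in>S. if x = y then k x else 0)"
      using S(3) y by (intro sum.cong) auto
    finally show ?thesis using S(1) y by simp
  qed
  then show ?thesis unfolding k by (intro sum.cong) auto
qed

lemma nrm_sum:
  assumes "finite S" "S \<subseteq> V"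
  shows "nrm (\<Sum>x\<in>S. k x *\<^sub>R x) \<le> (\<Sum>x\<in>S. \<bar>k x\<bar> * nrm x)"
  using assms
proof (induction S rule: finite_induct)
  case (insert x S)
  have "(\<Sum>x\<in>S. k x *\<^sub>R x) \<in> V"
    using insert by (intro subspace_sum[OF subspace_V]) auto
  then show ?case
    using insert nrm_triangle[of "k x *\<^sub>R x" "\<Sum>x\<in>S. k x *\<^sub>R x"] by (simp add: nrm_scale)
qed simp

text \<open>The Fourier sum over an orthonormal basis of \<open>W\<close> works, because the part of
  \<open>w\<close> outside the span is null and hence invisible to \<open>f\<close>.\<close>

lemma finite_projection_exists:
  assumes "finite B" "subspace N" and W: "subspace W" "W \<subseteq> V"
    and "\<And>v. v \<in> W \<Longrightarrow> v \<in> N \<Longrightarrow> f v v = 0"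
    and "\<And>v. v \<in> W \<Longrightarrow> \<exists>s\<in>span B. v - s \<in> N"
    and v: "v \<in> V"
  shows "\<exists>p\<in>W. \<forall>w\<in>W. f (v - p) w = 0"
proof -
  obtain S where S: "finite S" "S \<subseteq> W" "\<forall>x\<in>S. \<forall>y\<in>S. f x y = (if x = y then 1 else 0)"
    "\<forall>v\<in>W. \<exists>s\<in>span S. f (v - s) (v - s) = 0"
    using orthonormal_basis_exists[OF assms(1-6)] by blast
  have SV: "S \<subseteq> V" using S(2) W(2) by auto
  define p where "p = (\<Sum>x\<in>S. f v x *\<^sub>R x)"
  have pW: "p \<in> W" unfolding p_def using S(2) W(1) by (intro subspace_sum subspace_scale) auto
  then have pV: "p \<in> V" using W(2) by auto
  have orth: "f (v - p) y = 0" if "y \<in> S" for y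
  proof -
    have yV: "y \<in> V" using that SV by auto
    have "f p y = (\<Sum>x\<in>S. f v x * f x y)"
      unfolding p_def by (rule sum_left[OF S(1) SV yV])
    also have "\<dots> = (\<Sum>x\<in>S. if x = y then f v x else 0)"
      using S(3) that by (intro sum.cong) auto
    also have "\<dots> = f v y" using S(1) that by simp
    finally show ?thesis using pV v yV by (simp add: lin)
  qed
  have "f (v - p) w = 0" if w: "w \<in> W" for w
  proof -
    have wV: "w \<in> V" using w W(2) by auto
    obtain s where s: "s \<in> span S" "f (w - s) (w - s) = 0" using S(4) w by blast
    have eq: "s = (\<Sum>x\<in>S. f w x *\<^sub>R x)"
      by (rule orthonormal_expansion[OF S(1) SV S(3) wV s])
    have sV: "s \<in> V" using s(1) SV span_minimal[OF _ subspace_V] by blast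
    have "f s (v - p) = (\<Sum>x\<in>S. f w x * f x (v - p))"
      unfolding eq using v pV by (intro sum_left[OF S(1) SV]) auto
    also have "\<dots> = 0"
    proof (intro sum.neutral ballI)
      fix x assume x: "x \<in> S"
      then have "f x (v - p) = 0" using orth[OF x] sym[of x "v - p"] v pV SV by auto
      then show "f w x * f x (v - p) = 0" by simp
    qed
    finally have "f (v - p) s = 0" using sym[of s "v - p"] v pV sV by simp
    moreover have "f (v - p) (w - s) = 0"
      using null_right[of "w - s" "v - p"] s(2) v pV wV sV by simp
    ultimately show ?thesis using v pV wV sV by (simp add: diff_right)
  qed
  then show ?thesis using pW by blast
qed

end

text \<open>A rank alternative for finitely many functionals on a space of any dimension. It later
  plays the part of "injective implies surjective" for the discrete system, without counting
  dimensions modulo null functions.\<close>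

lemma functionals_surj_or_dependent:
  fixes F :: "'i \<Rightarrow> 'a::real_vector \<Rightarrow> real"
  assumes "finite S" and V: "subspace V"
    and "\<And>i x y. i \<in> S \<Longrightarrow> x \<in> V \<Longrightarrow> y \<in> V \<Longrightarrow> F i (x + y) = F i x + F i y"
    and "\<And>i x r. i \<in> S \<Longrightarrow> x \<in> V \<Longrightarrow> F i (r *\<^sub>R x) = r * F i x"
  shows "(\<forall>y. \<exists>v\<in>V. \<forall>i\<in>S. F i v = y i) \<or>
    (\<exists>a. (\<exists>i\<in>S. a i \<noteq> 0) \<and> (\<forall>v\<in>V. (\<Sum>i\<in>S. a i * F i v) = 0))"
  using assms(1,3-)
proof (induction S rule: finite_induct)
  case empty
  then show ?case using subspace_0[OF V] by auto
next
  case (insert j S)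
  note add = insert.prems(1) and scale = insert.prems(2)
  have sum_lin: "F i (\<Sum>m\<in>M. k m *\<^sub>R u m) = (\<Sum>m\<in>M. k m * F i (u m))"
    if "finite M" "\<forall>m\<in>M. u m \<in> V" "i \<in> insert j S" for i k u and M :: "'i set"
    using that(1,2)
  proof (induction M rule: finite_induct)
    case empty
    show ?case using scale[OF that(3) subspace_0[OF V], of 0] by simp
  next
    case (insert m M)
    have "(\<Sum>m\<in>M. k m *\<^sub>R u m) \<in> V"
      using insert by (intro subspace_sum[OF V] subspace_scale[OF V]) auto
    then show ?case using insert that(3) by (simp add: add scale subspace_scale[OF V])
  qed
  have IH: "(\<forall>y. \<exists>v\<in>V. \<forall>i\<in>S. F i v = y i) \<or>
    (\<exists>a. (\<exists>i\<in>S. a i \<noteq> 0) \<and> (\<forall>v\<in>V. (\<Sum>i\<in>S. a i * F i v) = 0))"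
    by (rule insert.IH) (use add scale in auto)
  then consider (surj) "\<forall>y. \<exists>v\<in>V. \<forall>i\<in>S. F i v = y i"
    | (dep) a where "\<exists>i\<in>S. a i \<noteq> 0" "\<forall>v\<in>V. (\<Sum>i\<in>S. a i * F i v) = 0" by blast
  then show ?case
  proof cases
    case dep
    have "(\<Sum>i\<in>insert j S. (a(j := 0)) i * F i v) = (\<Sum>i\<in>S. a i * F i v)" for v
      using insert.hyps by (auto intro!: sum.cong)
    moreover have "\<exists>i\<in>insert j S. (a(j := 0)) i \<noteq> 0" using dep(1) insert.hyps by auto
    ultimately show ?thesis using dep(2) by (intro disjI2 exI[of _ "a(j := 0)"]) simp
  next
    case surj
    show ?thesis
    proof (cases "\<exists>v0\<in>V. (\<forall>i\<in>S. F i v0 = 0) \<and> F j v0 \<noteq> 0")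
      case True
      then obtain v0 where v0: "v0 \<in> V" "\<forall>i\<in>S. F i v0 = 0" "F j v0 \<noteq> 0" by blast
      have "\<exists>v\<in>V. \<forall>i\<in>insert j S. F i v = y i" for y
      proof -
        obtain v where v: "v \<in> V" "\<forall>i\<in>S. F i v = y i" using surj by blast
        define w where "w = v + ((y j - F j v) / F j v0) *\<^sub>R v0"
        have "F i w = F i v + ((y j - F j v) / F j v0) * F i v0" if "i \<in> insert j S" for i
          using that v v0 by (simp add: w_def add scale subspace_scale[OF V])
        with v v0 have "\<forall>i\<in>insert j S. F i w = y i" by auto
        moreover have "w \<in> V" using v v0 by (simp add: w_def subspace_add[OF V] subspace_scale[OF V])
        ultimately show ?thesis by blast
      qed
      then show ?thesis by blast
    next
      case False
      have "\<exists>u. u \<in> V \<and> (\<forall>i\<in>S. F i u = (if i = m then 1 else 0))" for m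
        using surj[rule_format, of "\<lambda>i. if i = m then 1 else 0"] by blast
      then obtain u where u: "\<And>m. u m \<in> V" "\<And>m i. i \<in> S \<Longrightarrow> F i (u m) = (if i = m then 1 else 0)"
        by metis
      \<comment> \<open>Here \<open>F j\<close> vanishes on the common kernel of the other
        functionals, hence is the combination of the \<open>F m\<close> with coefficients
        \<open>F j (u m)\<close>, where \<open>u\<close> is a dual family. The relation is
        nontrivial because its entry at \<open>j\<close> is -1.\<close>
      define a where "a = (\<lambda>i. if i = j then -1 else F j (u i))"
      have "(\<Sum>i\<in>insert j S. a i * F i v) = 0" if v: "v \<in> V" for v
      proof -
        define s where "s = (\<Sum>m\<in>S. F m v *\<^sub>R u m)"
        have sV: "s \<in> V" unfolding s_def by (intro subspace_sum[OF V] subspace_scale[OF V] u)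
        have Fs: "F i s = (\<Sum>m\<in>S. F m v * F i (u m))" if "i \<in> insert j S" for i
          unfolding s_def by (rule sum_lin) (use that insert.hyps u in auto)
        have diff: "F i (v - s) = F i v - F i s" if "i \<in> insert j S" for i
          using add[OF that subspace_diff[OF V v sV] sV] by simp
        have "F i (v - s) = 0" if i: "i \<in> S" for i
        proof -
          have "F i s = (\<Sum>m\<in>S. if m = i then F m v else 0)"
            using Fs[of i] i u(2)[OF i] by (auto intro!: sum.cong)
          then show ?thesis using diff[of i] i insert.hyps by simp
        qed
        then have "F j (v - s) = 0" using False subspace_diff[OF V v sV] by blast
        then have "F j v = (\<Sum>m\<in>S. F m v * F j (u m))" using diff[of j] Fs[of j] by simp
        moreover have "(\<Sum>i\<in>S. a i * F i v) = (\<Sum>m\<in>S. F m v * F j (u m))"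
          using insert.hyps by (auto simp: a_def intro!: sum.cong)
        ultimately show ?thesis using insert.hyps by (simp add: a_def)
      qed
      then show ?thesis by (intro disjI2 exI[of _ a]) (auto simp: a_def)
    qed
  qed
qed

section \<open>Bounded inverse and the projection onto curl-free fields\<close>

lemma sum_products_le_sqrt:
  fixes x y u v :: real
  assumes "0 \<le> x" "0 \<le> y" "0 \<le> u" "0 \<le> v"
  shows "x * u + y * v \<le> sqrt (x\<^sup>2 + y\<^sup>2) * sqrt (u\<^sup>2 + v\<^sup>2)"
proof -
  have "(x * u + y * v)\<^sup>2 \<le> (x\<^sup>2 + y\<^sup>2) * (u\<^sup>2 + v\<^sup>2)"
    using zero_le_power2[of "x * v - y * u"] by (simp add: power2_eq_square algebra_simps)
  then show ?thesis
    unfolding real_sqrt_mult[symmetric] by (rule real_le_rsqrt)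
qed

text \<open>\<open>L\<close> stands for the square-integrable fields and \<open>H\<close> for
  \<open>H0curl\<close>; \<open>c\<close> is the curl energy as a form on \<open>H\<close> itself.
  The curl operator does not occur, so the choice made in \<open>curl\<close> is confined to the
  interpretation of this locale, and the curl-free fields are recovered as the \<open>c\<close>-null
  vectors.\<close>

locale curl_forms = E: semi_inner L e + C: semi_inner H c
  for L :: "'a::real_vector set" and e and H :: "'a set" and c +
  fixes \<omega> :: real
  assumes H_L: "H \<subseteq> L" and omega_pos: "0 < \<omega>"
begin

definition a :: "'a \<Rightarrow> 'a \<Rightarrow> real" where "a v w = \<omega>\<^sup>2 * e v w + c v w"
definition b :: "'a \<Rightarrow> 'a \<Rightarrow> real" where "b v w = - (\<omega>\<^sup>2) * e v w + c v w"
definition H0 :: "'a set" where "H0 = {v \<in> H. c v v = 0}"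

lemma H_in_L [simp]: "v \<in> H \<Longrightarrow> v \<in> L"
  using H_L by auto

lemma semi_inner_a: "semi_inner H a"
proof
  show "subspace H" by (rule C.subspace_V)
  show "a x y = a y x" if "x \<in> H" "y \<in> H" for x y
    unfolding a_def using that E.sym[of x y] C.sym[of x y] by simp
  show "a (x + y) z = a x z + a y z" if "x \<in> H" "y \<in> H" "z \<in> H" for x y z
    unfolding a_def using that by (simp add: E.add_left C.add_left algebra_simps)
  show "a (r *\<^sub>R x) y = r * a x y" if "x \<in> H" "y \<in> H" for r x y
    unfolding a_def using that by (simp add: E.scale_left C.scale_left algebra_simps)
  show "0 \<le> a x x" if "x \<in> H" for x
    unfolding a_def using that by (simp add: E.nonneg C.nonneg)
qed

sublocale T: semi_inner H a
  by (rule semi_inner_a)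

lemma H0D: "v \<in> H0 \<Longrightarrow> v \<in> H" "v \<in> H0 \<Longrightarrow> c v v = 0"
  by (auto simp: H0_def)

lemma subspace_H0: "subspace H0"
proof (rule subspaceI)
  show "x + y \<in> H0" if "x \<in> H0" "y \<in> H0" for x y
    using that C.null_add[of x y] by (simp add: H0_def)
qed (simp_all add: H0_def C.scale_left C.scale_right)

lemma c_H0: "v \<in> H0 \<Longrightarrow> w \<in> H \<Longrightarrow> c v w = 0" "v \<in> H0 \<Longrightarrow> w \<in> H \<Longrightarrow> c w v = 0"
  using C.null_left[of v w] C.null_right[of v w] by (simp_all add: H0_def)

lemma b_sym: "v \<in> H \<Longrightarrow> w \<in> H \<Longrightarrow> b v w = b w v"
  using C.sym[of v w] E.sym[of v w] by (simp add: b_def)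

lemma b_add_left: "u \<in> H \<Longrightarrow> v \<in> H \<Longrightarrow> w \<in> H \<Longrightarrow> b (u + v) w = b u w + b v w"
  by (simp add: b_def E.lin C.lin algebra_simps)

lemma b_add_right: "u \<in> H \<Longrightarrow> v \<in> H \<Longrightarrow> w \<in> H \<Longrightarrow> b w (u + v) = b w u + b w v"
  by (simp add: b_def E.lin C.lin algebra_simps)

lemma b_scale_left: "v \<in> H \<Longrightarrow> w \<in> H \<Longrightarrow> b (r *\<^sub>R v) w = r * b v w"
  by (simp add: b_def E.lin C.lin algebra_simps)

lemma b_scale_right: "v \<in> H \<Longrightarrow> w \<in> H \<Longrightarrow> b v (r *\<^sub>R w) = r * b v w"
  by (simp add: b_def E.lin C.lin algebra_simps)

lemma b_diff_left: "u \<in> H \<Longrightarrow> v \<in> H \<Longrightarrow> w \<in> H \<Longrightarrow> b (u - v) w = b u w - b v w"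
  by (simp add: b_def E.lin C.lin algebra_simps)

lemma b_diff_right: "u \<in> H \<Longrightarrow> v \<in> H \<Longrightarrow> w \<in> H \<Longrightarrow> b w (u - v) = b w u - b w v"
  by (simp add: b_def E.lin C.lin algebra_simps)

lemmas b_lin = b_add_left b_add_right b_scale_left b_scale_right b_diff_left b_diff_right

lemma T_nrm_sq: "v \<in> H \<Longrightarrow> (T.nrm v)\<^sup>2 = (\<omega> * E.nrm v)\<^sup>2 + (C.nrm v)\<^sup>2"
  by (simp add: T.nrm_sq a_def power_mult_distrib E.nrm_sq C.nrm_sq)

lemma T_nrm_eq: "v \<in> H \<Longrightarrow> T.nrm v = sqrt ((\<omega> * E.nrm v)\<^sup>2 + (C.nrm v)\<^sup>2)"
  by (simp add: T_nrm_sq[symmetric])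

lemma E_le_T: "v \<in> H \<Longrightarrow> \<omega> * E.nrm v \<le> T.nrm v"
  by (rule power2_le_imp_le) (simp_all add: T_nrm_sq)

lemma C_le_T: "v \<in> H \<Longrightarrow> C.nrm v \<le> T.nrm v"
  by (rule power2_le_imp_le) (simp_all add: T_nrm_sq)

text \<open>The first argument of \<open>e\<close> may differ from that of \<open>c\<close> as long
  as the norms agree. With \<open>u = v\<close> this bounds \<open>b\<close>; with
  \<open>u = r0 - \<theta>\<close> and \<open>v = r\<close> it later gives the leading term with
  constant exactly 1.\<close>

lemma forms_Cauchy_Schwarz:
  assumes "u \<in> L" "v \<in> H" "w \<in> H" "E.nrm u = E.nrm v"
  shows "\<omega>\<^sup>2 * \<bar>e u w\<bar> + \<bar>c v w\<bar> \<le> T.nrm v * T.nrm w"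
proof -
  have "\<omega>\<^sup>2 * \<bar>e u w\<bar> + \<bar>c v w\<bar> \<le> (\<omega> * E.nrm v) * (\<omega> * E.nrm w) + C.nrm v * C.nrm w"
    using mult_left_mono[OF E.Cauchy_Schwarz[of u w], of "\<omega>\<^sup>2"] C.Cauchy_Schwarz[of v w] assms
    by (simp add: power2_eq_square mult_ac)
  also have "\<dots> \<le> T.nrm v * T.nrm w"
    unfolding T_nrm_eq[OF assms(2)] T_nrm_eq[OF assms(3)]
    by (rule sum_products_le_sqrt) (use assms omega_pos in auto)
  finally show ?thesis .
qed

lemma b_bounded:
  assumes "v \<in> H" "w \<in> H"
  shows "\<bar>b v w\<bar> \<le> T.nrm v * T.nrm w"
proof -
  have "\<bar>b v w\<bar> \<le> \<bar>\<omega>\<^sup>2 * e v w\<bar> + \<bar>c v w\<bar>" unfolding b_def by linarith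
  also have "\<dots> = \<omega>\<^sup>2 * \<bar>e v w\<bar> + \<bar>c v w\<bar>" by (simp add: abs_mult)
  finally show ?thesis using forms_Cauchy_Schwarz[of v v w] assms by simp
qed

section \<open>Bounded functionals and the inverse of \<open>b\<close>\<close>

definition dual_H :: "('a \<Rightarrow> real) set" where
  "dual_H = {l. (\<forall>v\<in>H. \<forall>w\<in>H. l (v + w) = l v + l w) \<and>
     (\<forall>r. \<forall>v\<in>H. l (r *\<^sub>R v) = r * l v) \<and> (\<exists>K. \<forall>w\<in>H. \<bar>l w\<bar> \<le> K * T.nrm w)}"

lemma dual_HI:
  assumes "\<And>v w. v \<in> H \<Longrightarrow> w \<in> H \<Longrightarrow> l (v + w) = l v + l w"
    and "\<And>r v. v \<in> H \<Longrightarrow> l (r *\<^sub>R v) = r * l v"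
    and "\<And>w. w \<in> H \<Longrightarrow> \<bar>l w\<bar> \<le> K * T.nrm w"
  shows "l \<in> dual_H"
proof -
  have "\<exists>K. \<forall>w\<in>H. \<bar>l w\<bar> \<le> K * T.nrm w" using assms(3) by (intro exI ballI)
  then show ?thesis using assms(1,2) by (simp add: dual_H_def)
qed

text \<open>Gliding hump: the signs are chosen one at a time so that the \<open>n\<close>-th term reinforces the partial sum
  at \<open>t n\<close>; the remaining tail is at most half of that term.\<close>

lemma unbounded_functional:
  assumes t: "\<And>n. t n \<in> H" and tn: "\<And>n. T.nrm (t n) = 4 ^ n"
  shows "\<exists>l\<in>dual_H. \<forall>n::nat. (4/3) ^ n \<le> 2 * \<bar>l (t n)\<bar>"
proof -
  \<comment> \<open>Since \<open>T.nrm (t n) = 4 ^ n\<close>, the weight \<open>12 ^ n\<close> makes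
    \<open>g n\<close> a functional of norm at most \<open>(1/3) ^ n\<close>, so the series
    converges, while its value \<open>16 ^ n / 12 ^ n = (4/3) ^ n\<close> at \<open>t n\<close>
    still grows.\<close>
  define g where "g = (\<lambda>n w. a (t n) w / 12 ^ n)"
  define P where "P = rec_nat (\<lambda>w. 0) (\<lambda>n p w. p w + (if p (t n) \<ge> 0 then 1 else -1) * g n w)"
  define \<sigma> where "\<sigma> = (\<lambda>n. if P n (t n) \<ge> 0 then 1 else -1 :: real)"
  have P0: "P 0 w = 0" and PS: "P (Suc n) w = P n w + \<sigma> n * g n w" for n w
    by (simp_all add: P_def \<sigma>_def)
  have Psum: "P n w = (\<Sum>k<n. \<sigma> k * g k w)" for n w
    by (induction n) (simp_all add: P0 PS)
  have s_abs: "\<bar>\<sigma> n\<bar> = 1" for n by (simp add: \<sigma>_def)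
  have gbound: "\<bar>\<sigma> n * g n w\<bar> \<le> (1/3) ^ n * T.nrm w" if "w \<in> H" for n w
  proof -
    have "\<bar>a (t n) w\<bar> \<le> 4 ^ n * T.nrm w"
      using T.Cauchy_Schwarz[OF t that] by (simp add: tn)
    then have "\<bar>a (t n) w\<bar> / 12 ^ n \<le> 4 ^ n * T.nrm w / 12 ^ n" by (rule divide_right_mono) simp
    also have "\<dots> = (1/3) ^ n * T.nrm w"
    proof -
      have "(12::real) ^ n = 4 ^ n * 3 ^ n" by (simp flip: power_mult_distrib)
      then show ?thesis by (simp add: power_one_over field_simps)
    qed
    finally show ?thesis by (simp add: abs_mult s_abs g_def)
  qed
  have geo: "summable (\<lambda>n. (1/3::real) ^ n)" by (simp add: summable_geometric)
  have summ: "summable (\<lambda>n. \<sigma> n * g n w)" if "w \<in> H" for w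
    by (rule summable_comparison_test'[OF summable_mult2[OF geo, of "T.nrm w"], of 0])
       (use gbound[OF that] in auto)
  define l where "l = (\<lambda>w. \<Sum>n. \<sigma> n * g n w)"
  have "l \<in> dual_H"
  proof (rule dual_HI)
    fix v w assume vw: "v \<in> H" "w \<in> H"
    have "\<sigma> n * g n (v + w) = \<sigma> n * g n v + \<sigma> n * g n w" for n
      using vw t[of n] by (simp add: g_def T.lin add_divide_distrib algebra_simps)
    then show "l (v + w) = l v + l w"
      unfolding l_def using suminf_add[OF summ[OF vw(1)] summ[OF vw(2)]] by simp
  next
    fix r v assume v: "v \<in> H"
    have "\<sigma> n * g n (r *\<^sub>R v) = r * (\<sigma> n * g n v)" for n
      using v t[of n] by (simp add: g_def T.lin algebra_simps)
    then show "l (r *\<^sub>R v) = r * l v"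
      unfolding l_def using suminf_mult[OF summ[OF v], of r] by presburger
  next
    fix w assume w: "w \<in> H"
    have "norm (l w) \<le> (\<Sum>n. (1/3) ^ n * T.nrm w)"
      unfolding l_def
      by (rule norm_suminf_le) (use gbound[OF w] summable_mult2[OF geo] in auto)
    also have "\<dots> = 3/2 * T.nrm w"
      using suminf_mult2[OF geo, of "T.nrm w"] suminf_geometric[of "1/3::real"] by simp
    finally show "\<bar>l w\<bar> \<le> 3/2 * T.nrm w" by simp
  qed
  moreover have "(4/3) ^ n \<le> 2 * \<bar>l (t n)\<bar>" for n
  proof -
    have "g n (t n) = (4/3) ^ n"
    proof -
      have "a (t n) (t n) = 4 ^ n * 4 ^ n"
        using T.nrm_sq[OF t[of n]] by (simp add: tn power2_eq_square)
      moreover have "(12::real) ^ n = 4 ^ n * 3 ^ n" by (simp flip: power_mult_distrib)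
      ultimately show ?thesis by (simp add: g_def power_divide)
    qed
    then have "\<bar>P (Suc n) (t n)\<bar> \<ge> (4/3) ^ n"
      by (auto simp: PS \<sigma>_def)
    \<comment> \<open>The norms \<open>(1/3) ^ k\<close> with \<open>k > n\<close> add up to half of
      \<open>(1/3) ^ n\<close>; multiplied by \<open>T.nrm (t n)\<close> this is half of the
      \<open>n\<close>-th term.\<close>
    moreover have "\<bar>\<Sum>k. \<sigma> (k + Suc n) * g (k + Suc n) (t n)\<bar> \<le> (4/3) ^ n / 2"
    proof -
      have "norm (\<Sum>k. \<sigma> (k + Suc n) * g (k + Suc n) (t n))
          \<le> (\<Sum>k. (1/3) ^ k * ((1/3) ^ Suc n * 4 ^ n))"
      proof (rule norm_suminf_le)
        show "norm (\<sigma> (k + Suc n) * g (k + Suc n) (t n)) \<le> (1/3) ^ k * ((1/3) ^ Suc n * 4 ^ n)" for k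
          using gbound[OF t[of n], of "k + Suc n"] by (simp add: tn power_add mult_ac)
      qed (rule summable_mult2[OF geo])
      also have "\<dots> = 3/2 * ((1/3) ^ Suc n * 4 ^ n)"
        using suminf_mult2[OF geo, of "(1/3) ^ Suc n * 4 ^ n"] suminf_geometric[of "1/3::real"] by simp
      also have "\<dots> = (4/3) ^ n / 2" by (simp add: power_divide)
      finally show ?thesis by simp
    qed
    moreover have "l (t n) = (\<Sum>k. \<sigma> (k + Suc n) * g (k + Suc n) (t n)) + P (Suc n) (t n)"
      unfolding l_def Psum by (rule suminf_split_initial_segment[OF summ[OF t]])
    ultimately show ?thesis by linarith
  qed
  ultimately show ?thesis by blast
qed

end

locale wellposed_forms = curl_forms +
  assumes solvable: "\<And>l. l \<in> dual_H \<Longrightarrow> \<exists>v\<in>H. \<forall>w\<in>H. b v w = l w"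
begin

text \<open>Uniform boundedness: a sequence \<open>t n\<close> with bounded residuals and norms
  \<open>4 ^ n\<close> would admit a functional \<open>l\<close> unbounded along it, yet the
  solution \<open>v\<close> for the datum \<open>l\<close> gives \<open>l (t n) = b (t n) v\<close>,
  which is bounded by \<open>T.nrm v\<close>. The number \<open>M\<close> stands for any bound on
  the dual norm of \<open>b v\<close>, so that norm need not be introduced as a supremum.\<close>

lemma bounded_inverse:
  "\<exists>K\<ge>0. \<forall>v\<in>H. \<forall>M\<ge>0. (\<forall>w\<in>H. \<bar>b v w\<bar> \<le> M * T.nrm w) \<longrightarrow> T.nrm v \<le> K * M"
proof (rule ccontr)
  assume contra: "\<not> ?thesis"
  \<comment> \<open>A violator for the constant \<open>4 ^ n\<close> is rescaled to norm
    \<open>4 ^ n\<close>; its residual bound \<open>4 ^ n * M / T.nrm v\<close> is then below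
    1.\<close>
  have "\<exists>s. s \<in> H \<and> T.nrm s = 4 ^ n \<and> (\<forall>w\<in>H. \<bar>b s w\<bar> \<le> T.nrm w)" for n :: nat
  proof -
    have "(0::real) \<le> 4 ^ n" by simp
    with contra obtain v M where v: "v \<in> H" "M \<ge> 0" "\<forall>w\<in>H. \<bar>b v w\<bar> \<le> M * T.nrm w"
      and big: "T.nrm v > 4 ^ n * M"
      by (metis not_le)
    have "0 \<le> 4 ^ n * M" using v(2) by simp
    then have pos: "T.nrm v > 0" using big by linarith
    define s where "s = (4 ^ n / T.nrm v) *\<^sub>R v"
    have "\<bar>b s w\<bar> \<le> T.nrm w" if w: "w \<in> H" for w
    proof -
      have "\<bar>b s w\<bar> = 4 ^ n / T.nrm v * \<bar>b v w\<bar>"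
        using v(1) w pos by (simp add: s_def b_lin abs_mult)
      also have "\<dots> \<le> 4 ^ n / T.nrm v * (M * T.nrm w)"
        using v(3) w pos by (intro mult_left_mono) auto
      also have "\<dots> = (4 ^ n * M / T.nrm v) * T.nrm w" by simp
      also have "\<dots> \<le> 1 * T.nrm w"
        using big pos w by (intro mult_right_mono) auto
      finally show ?thesis by simp
    qed
    moreover have "T.nrm s = 4 ^ n" using pos v(1) by (simp add: s_def T.nrm_scale)
    moreover have "s \<in> H" using v(1) by (simp add: s_def)
    ultimately show ?thesis by blast
  qed
  then obtain t where t: "\<And>n. t n \<in> H" "\<And>n. T.nrm (t n) = 4 ^ n"
    "\<And>n w. w \<in> H \<Longrightarrow> \<bar>b (t n) w\<bar> \<le> T.nrm w"
    by metis
  obtain l where l: "l \<in> dual_H" "\<And>n::nat. (4/3) ^ n \<le> 2 * \<bar>l (t n)\<bar>"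
    using unbounded_functional[of t] t by blast
  obtain v where v: "v \<in> H" "\<forall>w\<in>H. b v w = l w" using solvable[OF l(1)] by blast
  have "(4/3) ^ n \<le> 2 * T.nrm v" for n :: nat
  proof -
    have "l (t n) = b (t n) v" using v(2) t(1) b_sym[OF v(1) t(1)] by simp
    then show ?thesis using l(2)[of n] t(3)[OF v(1), of n] by linarith
  qed
  moreover obtain n where "2 * T.nrm v < (4/3) ^ n"
    using real_arch_pow[of "4/3" "2 * T.nrm v"] by auto
  ultimately show False by (meson not_le)
qed

text \<open>A sequence \<open>p n\<close> minimising the distance from \<open>u\<close> to
  \<open>H0\<close> is Cauchy by the parallelogram law. To find its limit without completeness of
  \<open>H\<close>, pass to the functionals \<open>b (p n)\<close>: they converge in the dual,
  \<open>solvable\<close> represents the limit by some \<open>p'\<close>, and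
  \<open>bounded_inverse\<close> turns convergence of residuals into convergence of
  \<open>p n\<close> to \<open>p'\<close> in the energy norm.\<close>

lemma projection_exists:
  assumes u: "u \<in> L"
  shows "\<exists>p\<in>H0. \<forall>s\<in>H0. e (u - p) s = 0"
proof -
  obtain K where K: "K \<ge> 0"
    "\<And>v M. v \<in> H \<Longrightarrow> M \<ge> 0 \<Longrightarrow> \<forall>w\<in>H. \<bar>b v w\<bar> \<le> M * T.nrm w \<Longrightarrow> T.nrm v \<le> K * M"
    using bounded_inverse by blast
  have H0L: "s \<in> L" if "s \<in> H0" for s using that by (auto simp: H0_def)
  define q where "q = (\<lambda>s. e (u - s) (u - s))"
  define d where "d = Inf (q ` H0)"
  have q_nonneg: "0 \<le> q s" if "s \<in> H0" for s
    using u H0L[OF that] by (simp add: q_def E.nonneg)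
  have bdd: "bdd_below (q ` H0)" using q_nonneg by (auto intro!: bdd_belowI[of _ 0])
  have ne: "q ` H0 \<noteq> {}" using subspace_0[OF subspace_H0] by auto
  have d_le: "d \<le> q s" if "s \<in> H0" for s
    unfolding d_def using bdd that by (intro cInf_lower) auto
  have "\<exists>s\<in>H0. q s < d + 1 / real (Suc n)" for n
    using cInf_lessD[OF ne, of "d + 1 / real (Suc n)"] by (auto simp: d_def)
  then obtain p where p: "\<And>n. p n \<in> H0" "\<And>n. q (p n) < d + 1 / real (Suc n)"
    by metis
  have pH: "p n \<in> H" and pL: "p n \<in> L" for n using H0D(1)[OF p(1)] by auto
  define r where "r = (\<lambda>m n. 2 / real (Suc m) + 2 / real (Suc n))"
  \<comment> \<open>Parallelogram identity with the midpoint \<open>s\<close>: as \<open>q s\<close>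
    is at least \<open>d\<close>, all multiples of \<open>d\<close> cancel and only the two excesses
    over \<open>d\<close> remain, which is \<open>r m n\<close>.\<close>
  have par: "e (p m - p n) (p m - p n) \<le> r m n" for m n
  proof -
    define s where "s = (1/2) *\<^sub>R (p m + p n)"
    have s: "s \<in> H0"
      unfolding s_def by (intro subspace_scale subspace_add subspace_H0 p)
    have "e (p m - p n) (p m - p n) = 2 * q (p m) + 2 * q (p n) - 4 * q s"
      using u pL[of m] pL[of n] E.sym[of "p m" u] E.sym[of "p n" u] E.sym[of "p m" "p n"]
      by (simp add: q_def s_def E.lin algebra_simps)
    then show ?thesis using p(2)[of m] p(2)[of n] d_le[OF s] by (simp add: r_def)
  qed
  \<comment> \<open>On \<open>H0\<close> the curl part vanishes, so the energy norm is
    \<open>\<omega>\<close> times \<open>E.nrm\<close> and the Cauchy estimate carries over to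
    it.\<close>
  have bpp: "\<bar>b (p m) w - b (p n) w\<bar> \<le> \<omega> * sqrt (r m n) * T.nrm w" if w: "w \<in> H" for m n w
  proof -
    have z: "p m - p n \<in> H0" by (intro subspace_diff subspace_H0 p)
    have "T.nrm (p m - p n) = \<omega> * E.nrm (p m - p n)"
      using T_nrm_eq[of "p m - p n"] H0D[OF z] omega_pos by (simp add: C.nrm_def E.nonneg)
    also have "\<dots> \<le> \<omega> * sqrt (r m n)"
      using par[of m n] omega_pos by (simp add: E.nrm_def)
    finally have "T.nrm (p m - p n) * T.nrm w \<le> \<omega> * sqrt (r m n) * T.nrm w"
      using w by (intro mult_right_mono) auto
    then show ?thesis
      using b_bounded[of "p m - p n" w] w pH[of m] pH[of n] by (simp add: b_lin)
  qed
  have r_lim: "(\<lambda>n. r m n) \<longlonglongrightarrow> 2 / real (Suc m)" for m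
  proof -
    have "(\<lambda>n. 2 / real (Suc m) + 2 * inverse (real (Suc n))) \<longlonglongrightarrow> 2 / real (Suc m) + 2 * 0"
      by (intro tendsto_intros LIMSEQ_inverse_real_of_nat)
    then show ?thesis by (simp add: r_def divide_inverse)
  qed
  have small: "(\<lambda>n. 2 / real (Suc n)) \<longlonglongrightarrow> 0"
    using tendsto_mult[OF tendsto_const[of 2] LIMSEQ_inverse_real_of_nat] by (simp add: divide_inverse)
  have conv: "convergent (\<lambda>n. b (p n) w)" if w: "w \<in> H" for w
  proof -
    have "Cauchy (\<lambda>n. b (p n) w)"
    proof (rule metric_CauchyI)
      fix \<epsilon> :: real assume eps: "0 < \<epsilon>"
      \<comment> \<open>Chosen so that
        \<open>\<omega> * \<delta> * (T.nrm w + 1) = \<epsilon>\<close>; the summand 1 keeps the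
        denominator positive when \<open>T.nrm w = 0\<close>.\<close>
      define \<delta> where "\<delta> = \<epsilon> / (\<omega> * (T.nrm w + 1))"
      have pos: "\<omega> * (T.nrm w + 1) > 0"
        using omega_pos w by (intro mult_pos_pos) (auto simp: add_nonneg_pos)
      then have dpos: "\<delta> > 0" using eps by (simp add: \<delta>_def)
      then have "eventually (\<lambda>n. 2 / real (Suc n) < \<delta>\<^sup>2 / 2) sequentially"
        using order_tendstoD(2)[OF small, of "\<delta>\<^sup>2 / 2"] by simp
      then obtain M where M: "\<And>n. n \<ge> M \<Longrightarrow> 2 / real (Suc n) < \<delta>\<^sup>2 / 2"
        by (auto simp: eventually_sequentially)
      show "\<exists>M. \<forall>m\<ge>M. \<forall>n\<ge>M. dist (b (p m) w) (b (p n) w) < \<epsilon>"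
      proof (intro exI allI impI)
        fix m n assume mn: "m \<ge> M" "n \<ge> M"
        have "r m n < \<delta>\<^sup>2" using M[OF mn(1)] M[OF mn(2)] by (simp add: r_def)
        then have "sqrt (r m n) \<le> \<delta>" using dpos
          by (metis less_imp_le real_sqrt_abs abs_of_pos real_sqrt_le_mono)
        then have "\<omega> * sqrt (r m n) * T.nrm w \<le> \<omega> * \<delta> * T.nrm w"
          using w omega_pos by (intro mult_right_mono mult_left_mono) auto
        also have "\<dots> < \<omega> * \<delta> * (T.nrm w + 1)" using omega_pos dpos by simp
        also have "\<dots> = \<epsilon>" using pos unfolding \<delta>_def
          by (metis less_irrefl mult.assoc mult.commute nonzero_mult_div_cancel_left times_divide_eq_right)
        finally show "dist (b (p m) w) (b (p n) w) < \<epsilon>"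
          using bpp[OF w, of m n] by (simp add: dist_real_def)
      qed
    qed
    then show ?thesis by (rule real_Cauchy_convergent)
  qed
  define l where "l = (\<lambda>w. lim (\<lambda>n. b (p n) w))"
  have l_lim: "(\<lambda>n. b (p n) w) \<longlonglongrightarrow> l w" if "w \<in> H" for w
    using conv[OF that] by (simp add: l_def convergent_LIMSEQ_iff)
  \<comment> \<open>Letting \<open>n\<close> tend to infinity in \<open>bpp\<close> keeps the bound
    proportional to \<open>T.nrm w\<close>: this is convergence in the dual norm, the form in which
    \<open>bounded_inverse\<close> can be applied.\<close>
  have l_diff: "\<bar>b (p m) w - l w\<bar> \<le> \<omega> * sqrt (2 / real (Suc m)) * T.nrm w" if w: "w \<in> H" for m w
  proof (rule LIMSEQ_le)
    show "(\<lambda>n. \<bar>b (p m) w - b (p n) w\<bar>) \<longlonglongrightarrow> \<bar>b (p m) w - l w\<bar>"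
      by (intro tendsto_intros l_lim w)
    show "(\<lambda>n. \<omega> * sqrt (r m n) * T.nrm w) \<longlonglongrightarrow> \<omega> * sqrt (2 / real (Suc m)) * T.nrm w"
      by (intro tendsto_intros r_lim)
  qed (use bpp[OF w] in auto)
  have "l \<in> dual_H"
  proof (rule dual_HI)
    fix v w assume vw: "v \<in> H" "w \<in> H"
    have "(\<lambda>n. b (p n) (v + w)) \<longlonglongrightarrow> l v + l w"
      using tendsto_add[OF l_lim[OF vw(1)] l_lim[OF vw(2)]] vw pH by (simp add: b_lin)
    then show "l (v + w) = l v + l w" using LIMSEQ_unique l_lim[of "v + w"] vw by simp
  next
    fix k v assume v: "v \<in> H"
    have "(\<lambda>n. b (p n) (k *\<^sub>R v)) \<longlonglongrightarrow> k * l v"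
      using tendsto_mult[OF tendsto_const l_lim[OF v]] v pH by (simp add: b_lin)
    then show "l (k *\<^sub>R v) = k * l v" using LIMSEQ_unique l_lim[of "k *\<^sub>R v"] v by simp
  next
    fix w assume w: "w \<in> H"
    show "\<bar>l w\<bar> \<le> (T.nrm (p 0) + \<omega> * sqrt (2 / real (Suc 0))) * T.nrm w"
      using l_diff[OF w, of 0] b_bounded[OF pH w, of 0] by (simp add: algebra_simps)
  qed
  then obtain p' where p': "p' \<in> H" "\<And>w. w \<in> H \<Longrightarrow> b p' w = l w" using solvable by blast
  have dist: "T.nrm (p' - p n) \<le> K * (\<omega> * sqrt (2 / real (Suc n)))" for n
    by (rule K(2)) (use l_diff p' pH omega_pos in \<open>auto simp: b_lin abs_minus_commute\<close>)
  have "(\<lambda>n. K * (\<omega> * sqrt (2 / real (Suc n)))) \<longlonglongrightarrow> K * (\<omega> * sqrt 0)"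
    by (intro tendsto_intros small)
  then have lim0: "(\<lambda>n. K * (\<omega> * sqrt (2 / real (Suc n)))) \<longlonglongrightarrow> 0" by simp
  \<comment> \<open>Curl-freeness survives the limit because \<open>C.nrm\<close> is dominated by
    the energy norm and vanishes at each \<open>p n\<close>.\<close>
  have "C.nrm p' \<le> K * (\<omega> * sqrt (2 / real (Suc n)))" for n
  proof -
    have "C.nrm p' \<le> C.nrm (p' - p n) + C.nrm (p n)"
      using C.nrm_triangle[of "p' - p n" "p n"] p' pH[of n] by simp
    also have "C.nrm (p n) = 0" using H0D[OF p(1)] by (simp add: C.nrm_def)
    finally show ?thesis using C_le_T[of "p' - p n"] dist[of n] p' pH[of n] by simp
  qed
  then have "C.nrm p' \<le> 0" by (intro LIMSEQ_le_const[OF lim0]) auto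
  then have "c p' p' = 0" using C.nonneg[OF p'(1)] by (simp add: C.nrm_def)
  then have p'0: "p' \<in> H0" using p' by (simp add: H0_def)
  have q_min: "q p' \<le> d"
  proof -
    have "E.nrm (u - p') \<le> sqrt (d + 1 / real (Suc n)) + K * (\<omega> * sqrt (2 / real (Suc n))) / \<omega>" for n
    proof -
      have "E.nrm (u - p') \<le> E.nrm (u - p n) + E.nrm (p' - p n)"
        using E.nrm_triangle_diff[of "u - p n" "p' - p n"] u p' pL[of n] by simp
      moreover have "E.nrm (u - p n) \<le> sqrt (d + 1 / real (Suc n))"
        unfolding E.nrm_def using p(2)[of n] by (simp add: q_def)
      moreover have "E.nrm (p' - p n) \<le> K * (\<omega> * sqrt (2 / real (Suc n))) / \<omega>"
      proof -
        have "E.nrm (p' - p n) * \<omega> \<le> K * (\<omega> * sqrt (2 / real (Suc n)))"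
          using E_le_T[of "p' - p n"] dist[of n] p'(1) pH[of n] mult.commute[of \<omega> "E.nrm (p' - p n)"]
          by (metis C.mem(2) order_trans)
        then show ?thesis using omega_pos pos_le_divide_eq by blast
      qed
      ultimately show ?thesis by linarith
    qed
    moreover have "(\<lambda>n. sqrt (d + inverse (real (Suc n))) + K * (\<omega> * sqrt (2 / real (Suc n))) / \<omega>)
        \<longlonglongrightarrow> sqrt (d + 0) + 0 / \<omega>"
      using omega_pos by (intro tendsto_intros LIMSEQ_inverse_real_of_nat lim0) auto
    ultimately have "E.nrm (u - p') \<le> sqrt d"
      using LIMSEQ_le_const[of _ "sqrt d" "E.nrm (u - p')"] by (auto simp: divide_inverse)
    then show ?thesis by (simp add: E.nrm_def q_def)
  qed
  show ?thesis
  proof (intro bexI[of _ p'] ballI p'0)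
    fix s assume s: "s \<in> H0"
    note in_L = u H0L[OF p'0] H0L[OF s]
    \<comment> \<open>Minimality of \<open>p'\<close> along the line through \<open>p'\<close> in
      direction \<open>s\<close>. Evaluating at the vertex of this quadratic in \<open>t\<close>
      forces its linear coefficient to vanish.\<close>
    have *: "0 \<le> t\<^sup>2 * e s s - 2 * t * e (u - p') s" for t
    proof -
      have "p' + t *\<^sub>R s \<in> H0" by (intro subspace_add subspace_scale subspace_H0 p'0 s)
      from d_le[OF this] q_min have "q p' \<le> q (p' + t *\<^sub>R s)" by simp
      then show ?thesis
        using in_L E.sym[of s u] E.sym[of s p'] E.sym[of u p']
        by (simp add: q_def E.lin algebra_simps power2_eq_square)
    qed
    show "e (u - p') s = 0"
    proof (cases "e s s = 0")
      case True
      then show ?thesis using E.null_right[of s "u - p'"] in_L by simp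
    next
      case False
      then have "e s s > 0" using E.nonneg[of s] in_L by simp
      then have "(e (u - p') s)\<^sup>2 \<le> 0"
        using *[of "e (u - p') s / e s s"] by (simp add: field_simps power2_eq_square)
      then show ?thesis by simp
    qed
  qed
qed

end

section \<open>Abstract Galerkin estimate\<close>

text \<open>\<open>N\<close> will be the fields that vanish almost everywhere. As a set of functions
  \<open>Vh\<close> contains every representative of a discrete field, so it is finite-dimensional
  only modulo \<open>N\<close>; \<open>B\<close> generates it in this sense and need not consist of
  elements of \<open>Vh\<close>, or even of \<open>L\<close>.\<close>

locale galerkin = wellposed_forms +
  fixes Vh N :: "'a set" and B :: "'a set"
  assumes Vh: "subspace Vh" "Vh \<subseteq> H" and N: "subspace N" and B: "finite B"
    and null_N: "\<And>v. v \<in> H \<Longrightarrow> v \<in> N \<Longrightarrow> a v v = 0"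
    and span_B: "\<And>v. v \<in> Vh \<Longrightarrow> \<exists>s\<in>span B. v - s \<in> N"
begin

definition Xh :: "'a set" where "Xh = {v \<in> Vh. \<forall>s\<in>Vh \<inter> H0. e v s = 0}"

definition div_set :: "real set" where
  "div_set = {\<omega> * E.nrm p | vh p. vh \<in> Xh \<and> C.nrm vh = 1 \<and> p \<in> H0 \<and> (\<forall>s\<in>H0. e (vh - p) s = 0)}"

definition ap_set :: "real set" where
  "ap_set = {Inf {\<omega> * T.nrm (\<zeta> - vh) | vh. vh \<in> Vh} | \<theta> \<zeta>.
     \<theta> \<in> L \<and> (\<forall>s\<in>H0. e \<theta> s = 0) \<and> E.nrm \<theta> = 1 \<and> \<zeta> \<in> H \<and> (\<forall>w\<in>H. b w \<zeta> = e w \<theta>)}"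

definition g_div :: real where "g_div = Sup (insert 0 div_set)"
definition g_ap :: real where "g_ap = Sup (insert 0 ap_set)"

section \<open>Finiteness of the two factors\<close>

lemma Vh_in_H [simp]: "v \<in> Vh \<Longrightarrow> v \<in> H"
  using Vh by auto

lemma a_null:
  assumes "v \<in> H" "a v v = 0"
  shows "e v v = 0" "c v v = 0"
proof -
  have "0 \<le> \<omega>\<^sup>2 * e v v" "0 \<le> c v v" using E.nonneg[of v] C.nonneg[of v] assms(1) by auto
  then have "\<omega>\<^sup>2 * e v v = 0" "c v v = 0" using assms(2) unfolding a_def by linarith+
  then show "e v v = 0" "c v v = 0" using omega_pos by auto
qed

lemma projection_nrm_le:
  assumes "v \<in> L" "p \<in> H0" "\<forall>s\<in>H0. e (v - p) s = 0"
  shows "E.nrm p \<le> E.nrm v"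
proof -
  have pL: "p \<in> L" using assms(2) by (auto simp: H0_def)
  have "e (v - p) p = 0" using assms(2,3) by blast
  then have "e p p = e v p" using E.diff_left[OF assms(1) pL pL] by simp
  then have "(E.nrm p)\<^sup>2 \<le> E.nrm v * E.nrm p"
    using E.Cauchy_Schwarz[OF assms(1) pL] E.nrm_sq[OF pL] by simp
  moreover have "0 \<le> E.nrm p" "0 \<le> E.nrm v" using pL assms(1) by auto
  ultimately show ?thesis by (cases "E.nrm p = 0") (auto simp: power2_eq_square)
qed

lemma subspace_Xh: "subspace Xh"
proof (rule subspaceI)
  show "0 \<in> Xh" using subspace_0[OF Vh(1)] by (simp add: Xh_def)
next
  fix x y assume "x \<in> Xh" "y \<in> Xh"
  then show "x + y \<in> Xh" using subspace_add[OF Vh(1)] by (simp add: Xh_def E.add_left)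
next
  fix r x assume "x \<in> Xh"
  then show "r *\<^sub>R x \<in> Xh" using subspace_scale[OF Vh(1)] by (simp add: Xh_def E.scale_left)
qed

lemma XhD: "v \<in> Xh \<Longrightarrow> v \<in> Vh"
  by (simp add: Xh_def)

text \<open>Such a \<open>v\<close> lies in \<open>Vh \<inter> H0\<close>, to which
  \<open>Xh\<close> is orthogonal, so it is orthogonal to itself.\<close>

lemma Xh_curl_free: "v \<in> Xh \<Longrightarrow> c v v = 0 \<Longrightarrow> e v v = 0"
  by (simp add: Xh_def H0_def)

text \<open>By \<open>Xh_curl_free\<close>, \<open>c\<close>-null vectors of \<open>Xh\<close> are
  also \<open>e\<close>-null, and \<open>Xh\<close> is finite-dimensional modulo \<open>N\<close>;
  so the expansion in a \<open>c\<close>-orthonormal basis controls \<open>E.nrm\<close>. The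
  constant depends on the discrete space and serves only to show that \<open>div_set\<close> is
  bounded.\<close>

lemma Xh_Poincare: "\<exists>K\<ge>0. \<forall>v\<in>Xh. E.nrm v \<le> K * C.nrm v"
proof -
  have "\<exists>S. finite S \<and> S \<subseteq> Xh \<and> (\<forall>x\<in>S. \<forall>y\<in>S. c x y = (if x = y then 1 else 0)) \<and>
    (\<forall>v\<in>Xh. \<exists>s\<in>span S. c (v - s) (v - s) = 0)"
  proof (rule C.orthonormal_basis_exists[OF B N subspace_Xh])
    show "c v v = 0" if "v \<in> Xh" "v \<in> N" for v
      using a_null(2)[OF _ null_N] that XhD by simp
  qed (use XhD span_B in auto)
  then obtain S where S: "finite S" "S \<subseteq> Xh" "\<forall>x\<in>S. \<forall>y\<in>S. c x y = (if x = y then 1 else 0)"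
    "\<forall>v\<in>Xh. \<exists>s\<in>span S. c (v - s) (v - s) = 0" by blast
  have SH: "S \<subseteq> H" using S(2) XhD by auto
  define K where "K = (\<Sum>x\<in>S. E.nrm x)"
  have "K \<ge> 0" unfolding K_def using SH by (intro sum_nonneg) auto
  moreover have "E.nrm v \<le> K * C.nrm v" if v: "v \<in> Xh" for v
  proof -
    have vH: "v \<in> H" using v XhD by simp
    obtain s where s: "s \<in> span S" "c (v - s) (v - s) = 0" using S(4) v by blast
    have eq: "s = (\<Sum>x\<in>S. c v x *\<^sub>R x)"
      by (rule C.orthonormal_expansion[OF S(1) SH S(3) vH s])
    have sX: "s \<in> Xh" using s(1) S(2) span_minimal[OF _ subspace_Xh] by blast
    have "v - s \<in> Xh" by (rule subspace_diff[OF subspace_Xh v sX])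
    then have "e (v - s) (v - s) = 0" using s(2) Xh_curl_free by blast
    then have z: "E.nrm (v - s) = 0" by (simp add: E.nrm_def)
    have "E.nrm v \<le> E.nrm (v - s) + E.nrm s"
      using E.nrm_triangle[of "v - s" s] vH sX XhD by simp
    also have "E.nrm s \<le> (\<Sum>x\<in>S. \<bar>c v x\<bar> * E.nrm x)"
      unfolding eq using SH by (intro E.nrm_sum[OF S(1)]) auto
    also have "\<dots> \<le> (\<Sum>x\<in>S. C.nrm v * E.nrm x)"
    proof (intro sum_mono mult_right_mono)
      fix x assume x: "x \<in> S"
      then have xH: "x \<in> H" using SH by auto
      have "C.nrm x = 1" using S(3) x by (simp add: C.nrm_def)
      then show "\<bar>c v x\<bar> \<le> C.nrm v" using C.Cauchy_Schwarz[OF vH xH] by simp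
      show "0 \<le> E.nrm x" using xH by simp
    qed
    also have "\<dots> = K * C.nrm v" by (simp add: K_def sum_distrib_left mult.commute)
    finally show ?thesis using z by simp
  qed
  ultimately show ?thesis by blast
qed

lemma bdd_div_set: "bdd_above (insert 0 div_set)"
proof -
  obtain K where K: "\<forall>v\<in>Xh. E.nrm v \<le> K * C.nrm v" using Xh_Poincare by blast
  have "x \<le> \<omega> * K" if "x \<in> div_set" for x
  proof -
    obtain vh p where vp: "x = \<omega> * E.nrm p" "vh \<in> Xh" "C.nrm vh = 1" "p \<in> H0"
      "\<forall>s\<in>H0. e (vh - p) s = 0" using \<open>x \<in> div_set\<close> unfolding div_set_def by blast
    have "E.nrm p \<le> E.nrm vh"
      using projection_nrm_le[of vh p] vp XhD[OF vp(2)] by simp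
    also have "\<dots> \<le> K" using K vp by force
    finally show ?thesis using omega_pos vp(1) by simp
  qed
  then have "bdd_above div_set" by (rule bdd_aboveI)
  then show ?thesis by simp
qed

lemma e_functional_dual:
  assumes \<theta>: "\<theta> \<in> L"
  shows "(\<lambda>w. e w \<theta>) \<in> dual_H" and "w \<in> H \<Longrightarrow> \<bar>e w \<theta>\<bar> \<le> (E.nrm \<theta> / \<omega>) * T.nrm w"
proof -
  have bd: "\<bar>e w \<theta>\<bar> \<le> (E.nrm \<theta> / \<omega>) * T.nrm w" if w: "w \<in> H" for w
  proof -
    have "\<bar>e w \<theta>\<bar> \<le> E.nrm w * E.nrm \<theta>" using E.Cauchy_Schwarz[of w \<theta>] w \<theta> by simp
    also have "\<dots> \<le> (T.nrm w / \<omega>) * E.nrm \<theta>"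
      using E_le_T[OF w] omega_pos \<theta>
      by (intro mult_right_mono) (auto simp: pos_le_divide_eq mult.commute)
    finally show ?thesis by (simp add: mult.commute)
  qed
  then show "w \<in> H \<Longrightarrow> \<bar>e w \<theta>\<bar> \<le> (E.nrm \<theta> / \<omega>) * T.nrm w" .
  show "(\<lambda>w. e w \<theta>) \<in> dual_H"
    by (rule dual_HI[OF _ _ bd]) (use \<theta> in \<open>auto simp: E.lin\<close>)
qed

lemma dist_set_bdd_below: "\<zeta> \<in> H \<Longrightarrow> bdd_below {\<omega> * T.nrm (\<zeta> - vh) | vh. vh \<in> Vh}"
  using omega_pos by (intro bdd_belowI[of _ 0]) auto

text \<open>The competitor \<open>vh = 0\<close> bounds the infimum by the norm of
  \<open>\<zeta>\<close>, and the bounded inverse controls \<open>\<zeta>\<close> through its datum,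
  whose dual norm is at most \<open>1 / \<omega>\<close>.\<close>

lemma bdd_ap_set: "bdd_above (insert 0 ap_set)"
proof -
  obtain K where K: "K \<ge> 0"
    "\<And>v M. v \<in> H \<Longrightarrow> M \<ge> 0 \<Longrightarrow> \<forall>w\<in>H. \<bar>b v w\<bar> \<le> M * T.nrm w \<Longrightarrow> T.nrm v \<le> K * M"
    using bounded_inverse by blast
  have "x \<le> \<omega> * (K * (1 / \<omega>))" if "x \<in> ap_set" for x
  proof -
    obtain \<theta> \<zeta> where *: "x = Inf {\<omega> * T.nrm (\<zeta> - vh) | vh. vh \<in> Vh}" "\<theta> \<in> L" "E.nrm \<theta> = 1" "\<zeta> \<in> H"
      "\<forall>w\<in>H. b w \<zeta> = e w \<theta>" using \<open>x \<in> ap_set\<close> unfolding ap_set_def by blast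
    have "T.nrm \<zeta> \<le> K * (1 / \<omega>)"
    proof (rule K(2)[OF *(4)])
      show "\<forall>w\<in>H. \<bar>b \<zeta> w\<bar> \<le> 1 / \<omega> * T.nrm w"
        using *(3,5) e_functional_dual(2)[OF *(2)] b_sym[OF *(4)] by fastforce
    qed (use omega_pos in simp)
    moreover have "x \<le> \<omega> * T.nrm (\<zeta> - 0)"
      unfolding *(1) using dist_set_bdd_below[OF *(4)] subspace_0[OF Vh(1)]
      by (intro cInf_lower) blast+
    ultimately show ?thesis using omega_pos
      by (metis diff_zero less_imp_le mult_left_mono order_trans)
  qed
  then have "bdd_above ap_set" by (rule bdd_aboveI)
  then show ?thesis by simp
qed

lemma g_div_nonneg: "0 \<le> g_div"
  unfolding g_div_def using bdd_div_set by (intro cSup_upper) auto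

lemma g_ap_nonneg: "0 \<le> g_ap"
  unfolding g_ap_def using bdd_ap_set by (intro cSup_upper) auto

text \<open>Scaling to \<open>C.nrm x = 1\<close> lands in the set defining \<open>g_div\<close>. If
  \<open>C.nrm x = 0\<close> no scaling is possible, but then \<open>x\<close> is null by
  \<open>Xh_curl_free\<close>, and so is its projection.\<close>

lemma projection_Xh_le:
  assumes x: "x \<in> Xh" and p: "p \<in> H0" "\<forall>s\<in>H0. e (x - p) s = 0"
  shows "\<omega> * E.nrm p \<le> g_div * C.nrm x"
proof (cases "C.nrm x = 0")
  case True
  have xH: "x \<in> H" using x XhD by simp
  then have "e x x = 0" using Xh_curl_free[OF x] True by (simp add: C.nrm_def)
  then have "E.nrm x = 0" by (simp add: E.nrm_def)
  then have "E.nrm p \<le> 0" using projection_nrm_le[of x p] p xH by simp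
  then show ?thesis using True omega_pos by (simp add: mult_le_0_iff)
next
  case False
  have xH: "x \<in> H" and pH: "p \<in> H" using x XhD H0D p by auto
  then have pos: "C.nrm x > 0" using False C.nrm_nonneg[of x] by linarith
  define k where "k = 1 / C.nrm x"
  have "\<omega> * E.nrm (k *\<^sub>R p) \<in> div_set"
    unfolding div_set_def
  proof (intro CollectI exI conjI)
    show "\<omega> * E.nrm (k *\<^sub>R p) = \<omega> * E.nrm (k *\<^sub>R p)" ..
    show "k *\<^sub>R x \<in> Xh" by (rule subspace_scale[OF subspace_Xh x])
    show "C.nrm (k *\<^sub>R x) = 1" using xH pos by (simp add: C.nrm_scale k_def)
    show "k *\<^sub>R p \<in> H0" by (rule subspace_scale[OF subspace_H0 p(1)])
    show "\<forall>s\<in>H0. e (k *\<^sub>R x - k *\<^sub>R p) s = 0"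
    proof
      fix s assume s: "s \<in> H0"
      have "e (k *\<^sub>R (x - p)) s = k * e (x - p) s" using xH pH H0D[OF s] by (intro E.scale_left) auto
      then show "e (k *\<^sub>R x - k *\<^sub>R p) s = 0" using p(2) s by (simp add: algebra_simps)
    qed
  qed
  then have "\<omega> * E.nrm (k *\<^sub>R p) \<le> g_div"
    unfolding g_div_def using bdd_div_set by (intro cSup_upper) auto
  then have "\<omega> * E.nrm p / C.nrm x \<le> g_div"
    using pH pos by (simp add: E.nrm_scale k_def)
  then show ?thesis using pos by (simp add: pos_divide_le_eq)
qed

text \<open>Let \<open>\<zeta>\<close> solve the dual problem for the normalised
  \<open>\<theta>\<close>; symmetry of \<open>b\<close> makes this an instance of the given problem.
  Orthogonality allows any discrete \<open>vh\<close> to be subtracted from \<open>\<zeta>\<close>,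
  and passing to the infimum brings in \<open>g_ap\<close>. Dividing by \<open>T.nrm v\<close> is
  what turns the estimate into a lower bound for the set under that infimum, hence the separate case
  of vanishing norms.\<close>

lemma Aubin_Nitsche:
  assumes v: "v \<in> H" and orth: "\<And>wh. wh \<in> Vh \<Longrightarrow> b v wh = 0"
    and \<theta>: "\<theta> \<in> L" "\<forall>s\<in>H0. e \<theta> s = 0"
  shows "\<omega> * \<bar>e v \<theta>\<bar> \<le> g_ap * T.nrm v * E.nrm \<theta>"
proof (cases "E.nrm \<theta> = 0 \<or> T.nrm v = 0")
  case True
  have "\<omega> * \<bar>e v \<theta>\<bar> \<le> T.nrm v * E.nrm \<theta>"
    using e_functional_dual(2)[OF \<theta>(1) v] omega_pos by (simp add: field_simps)
  with True have "\<omega> * \<bar>e v \<theta>\<bar> \<le> 0" by auto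
  then show ?thesis using True by auto
next
  case False
  then have pos: "E.nrm \<theta> > 0" "T.nrm v > 0"
    using E.nrm_nonneg[OF \<theta>(1)] T.nrm_nonneg[OF v] by linarith+
  define \<theta>' where "\<theta>' = (1 / E.nrm \<theta>) *\<^sub>R \<theta>"
  have \<theta>'L: "\<theta>' \<in> L" using \<theta> by (simp add: \<theta>'_def)
  have \<theta>'1: "E.nrm \<theta>' = 1" using \<theta> pos by (simp add: \<theta>'_def E.nrm_scale)
  have \<theta>'o: "\<forall>s\<in>H0. e \<theta>' s = 0" using \<theta> H0D by (simp add: \<theta>'_def E.scale_left)
  obtain \<zeta> where \<zeta>: "\<zeta> \<in> H" "\<forall>w\<in>H. b \<zeta> w = e w \<theta>'"
    using solvable[OF e_functional_dual(1)[OF \<theta>'L]] by blast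
  then have \<zeta>': "\<forall>w\<in>H. b w \<zeta> = e w \<theta>'" using b_sym by simp
  have le: "\<omega> * \<bar>e v \<theta>'\<bar> / T.nrm v \<le> \<omega> * T.nrm (\<zeta> - vh)" if vh: "vh \<in> Vh" for vh
  proof -
    have "e v \<theta>' = b v (\<zeta> - vh)" using \<zeta>' v orth[OF vh] vh \<zeta>(1) by (simp add: b_lin)
    then have "\<bar>e v \<theta>'\<bar> \<le> T.nrm v * T.nrm (\<zeta> - vh)"
      using b_bounded[OF v, of "\<zeta> - vh"] \<zeta>(1) vh by simp
    then have "\<omega> * \<bar>e v \<theta>'\<bar> \<le> \<omega> * (T.nrm v * T.nrm (\<zeta> - vh))"
      using omega_pos by simp
    then show ?thesis using pos by (simp add: pos_divide_le_eq mult_ac)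
  qed
  have "\<omega> * \<bar>e v \<theta>'\<bar> / T.nrm v \<le> Inf {\<omega> * T.nrm (\<zeta> - vh) | vh. vh \<in> Vh}"
    using le subspace_0[OF Vh(1)] by (intro cInf_greatest) auto
  also have "\<dots> \<le> g_ap"
  proof -
    have "Inf {\<omega> * T.nrm (\<zeta> - vh) | vh. vh \<in> Vh} \<in> ap_set"
      unfolding ap_set_def using \<theta>'L \<theta>'1 \<theta>'o \<zeta>(1) \<zeta>' by blast
    then show ?thesis unfolding g_ap_def using bdd_ap_set by (intro cSup_upper) auto
  qed
  finally have "\<omega> * \<bar>e v \<theta>'\<bar> \<le> g_ap * T.nrm v" using pos by (simp add: pos_divide_le_eq)
  moreover have "\<bar>e v \<theta>'\<bar> = \<bar>e v \<theta>\<bar> / E.nrm \<theta>"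
    using v \<theta> pos by (simp add: \<theta>'_def E.scale_right abs_mult)
  ultimately show ?thesis using pos by (simp add: pos_divide_le_eq)
qed

text \<open>With \<open>t\<close> and \<open>h\<close> the energy norms of \<open>r\<close> and
  \<open>\<eta>\<close>, the factors 2 stem from
  \<open>t\<^sup>2 = b r r + 2 * \<omega>\<^sup>2 * e r r\<close>. The divergence term is at most
  \<open>2 * t * g_div * (h + t)\<close>, because \<open>x\<close> and \<open>r - \<eta>\<close>
  differ by a curl-free field. If \<open>h \<le> t\<close>, this is at most
  \<open>4 * g_div * t\<^sup>2\<close>; if \<open>h > t\<close>, the claim is immediate since the
  coefficient on the left does not exceed 1.\<close>

lemma quasi_optimality:
  assumes u: "u \<in> H" and uh: "uh \<in> Vh" and orth: "\<And>wh. wh \<in> Vh \<Longrightarrow> b (u - uh) wh = 0"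
    and vh: "vh \<in> Vh"
  shows "(1 - 4 * g_div - 2 * g_ap\<^sup>2) * T.nrm (u - uh) \<le> T.nrm (u - vh)"
proof -
  define r where "r = u - uh"
  define \<eta> where "\<eta> = u - vh"
  define \<xi> where "\<xi> = vh - uh"
  have rH: "r \<in> H" and \<eta>H: "\<eta> \<in> H" and \<xi>V: "\<xi> \<in> Vh"
    using u uh vh subspace_diff[OF Vh(1)] by (auto simp: r_def \<eta>_def \<xi>_def)
  have dec: "r = \<eta> + \<xi>" by (simp add: r_def \<eta>_def \<xi>_def)
  have orth': "b r wh = 0" if "wh \<in> Vh" for wh using orth[OF that] by (simp add: r_def)
  \<comment> \<open>Only finite dimensionality modulo \<open>N\<close> is used for this projection,
    in contrast to those onto \<open>H0\<close> below.\<close>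
  have "\<exists>p\<in>Vh \<inter> H0. \<forall>w\<in>Vh \<inter> H0. e (\<xi> - p) w = 0"
  proof (rule E.finite_projection_exists[OF B N])
    show "subspace (Vh \<inter> H0)" by (rule subspace_inter[OF Vh(1) subspace_H0])
    show "e v v = 0" if "v \<in> Vh \<inter> H0" "v \<in> N" for v
      using a_null(1)[OF _ null_N] that by simp
  qed (use \<xi>V span_B in auto)
  then obtain \<xi>0 where \<xi>0: "\<xi>0 \<in> Vh" "\<xi>0 \<in> H0" "\<forall>w\<in>Vh \<inter> H0. e (\<xi> - \<xi>0) w = 0" by blast
  define x where "x = \<xi> - \<xi>0"
  have xX: "x \<in> Xh" using \<xi>0 \<xi>V subspace_diff[OF Vh(1)] by (simp add: Xh_def x_def)
  have xH: "x \<in> H" using xX XhD by simp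
  obtain r0 where r0: "r0 \<in> H0" "\<forall>s\<in>H0. e (r - r0) s = 0" using projection_exists[of r] rH by auto
  obtain x0 where x0: "x0 \<in> H0" "\<forall>s\<in>H0. e (x - x0) s = 0" using projection_exists[of x] xH by auto
  define \<theta> where "\<theta> = r - r0"
  note in_H0 = H0D(1)[OF r0(1)] H0D(1)[OF x0(1)] H0D(1)[OF \<xi>0(2)]
  have \<theta>L: "\<theta> \<in> H" using rH in_H0 by (simp add: \<theta>_def)
  have \<theta>o: "e \<theta> s = 0" if "s \<in> H0" for s using r0(2) that by (simp add: \<theta>_def)
  have \<theta>o': "e s \<theta> = 0" if "s \<in> H0" for s
    using \<theta>o[OF that] E.sym[of s \<theta>] \<theta>L H0D(1)[OF that] by simp
  have rsplit: "r = r0 + \<theta>" by (simp add: \<theta>_def)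
  \<comment> \<open>Testing with a curl-free discrete field removes the curl part of
    \<open>b\<close>, leaving \<open>- (\<omega>\<^sup>2) * e r \<xi>0 = 0\<close>.\<close>
  have e_r_\<xi>0: "e r \<xi>0 = 0"
    using orth'[OF \<xi>0(1)] c_H0(2)[OF \<xi>0(2) rH] omega_pos by (simp add: b_def)
  have e_r0_\<xi>0: "e r0 \<xi>0 = 0"
    using e_r_\<xi>0 \<theta>o[OF \<xi>0(2)] \<theta>L in_H0 by (simp add: rsplit E.add_left)
  have "e r0 r0 = e r0 r" using \<theta>o'[OF r0(1)] \<theta>L in_H0 by (simp add: rsplit E.add_right)
  also have "\<dots> = e r0 \<eta> + e r0 x"
  proof -
    have "r = \<eta> + \<xi>0 + x" by (simp add: dec x_def)
    then show ?thesis using e_r0_\<xi>0 in_H0 \<eta>H xH by (simp add: E.add_right)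
  qed
  \<comment> \<open>Only the curl-free part of \<open>x\<close> is seen by \<open>r0\<close>; this
    is the quantity that \<open>g_div\<close> controls.\<close>
  also have "e r0 x = e r0 x0"
  proof -
    have "e (x - x0) r0 = 0" using x0(2) r0(1) by blast
    then have "e x r0 = e x0 r0" using xH in_H0 by (simp add: E.diff_left)
    then show ?thesis using E.sym[of x r0] E.sym[of x0 r0] xH in_H0 by simp
  qed
  finally have r0r0: "e r0 r0 = e r0 \<eta> + e r0 x0" .
  define t where "t = T.nrm r"
  define h where "h = T.nrm \<eta>"
  have nn: "0 \<le> t" "0 \<le> h" using rH \<eta>H by (auto simp: t_def h_def)
  have rr: "e r r = e r0 r0 + e \<theta> \<theta>"
    using \<theta>o[OF r0(1)] \<theta>o'[OF r0(1)] \<theta>L in_H0 by (simp add: rsplit E.add_left E.add_right)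
  \<comment> \<open>Galerkin orthogonality removes the discrete summand \<open>\<xi>\<close> of the
    second argument.\<close>
  have brr: "b r r = b r \<eta>"
    using orth'[OF \<xi>V] rH \<eta>H \<xi>V b_add_right[of \<eta> \<xi> r] by (simp flip: dec)
  have key: "t\<^sup>2 = (\<omega>\<^sup>2 * e (r0 - \<theta>) \<eta> + c r \<eta>) + 2 * \<omega>\<^sup>2 * e \<theta> \<theta> + 2 * \<omega>\<^sup>2 * e r0 x0"
  proof -
    have "t\<^sup>2 = b r r + 2 * \<omega>\<^sup>2 * e r r"
      unfolding t_def using T.nrm_sq[OF rH] by (simp add: a_def b_def)
    also have "\<dots> = - (\<omega>\<^sup>2) * e r \<eta> + c r \<eta> + 2 * \<omega>\<^sup>2 * (e r0 \<eta> + e r0 x0 + e \<theta> \<theta>)"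
      unfolding brr rr r0r0 by (simp add: b_def)
    also have "e r \<eta> = e r0 \<eta> + e \<theta> \<eta>" using \<theta>L in_H0 \<eta>H by (simp add: rsplit E.add_left)
    finally show ?thesis using \<theta>L in_H0 \<eta>H by (simp add: E.diff_left algebra_simps)
  qed
  have t1: "\<omega>\<^sup>2 * e (r0 - \<theta>) \<eta> + c r \<eta> \<le> t * h"
  proof -
    \<comment> \<open>\<open>r0\<close> and \<open>\<theta>\<close> are orthogonal, so reversing the
      sign of \<open>\<theta>\<close> preserves the norm.\<close>
    have "E.nrm (r0 - \<theta>) = E.nrm r"
      using rr \<theta>o[OF r0(1)] \<theta>o'[OF r0(1)] \<theta>L in_H0 by (simp add: E.nrm_def E.diff_left E.diff_right)
    then have "\<omega>\<^sup>2 * \<bar>e (r0 - \<theta>) \<eta>\<bar> + \<bar>c r \<eta>\<bar> \<le> t * h"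
      unfolding t_def h_def using forms_Cauchy_Schwarz[of "r0 - \<theta>" r \<eta>] \<theta>L in_H0 rH \<eta>H by simp
    moreover have "\<omega>\<^sup>2 * e (r0 - \<theta>) \<eta> \<le> \<omega>\<^sup>2 * \<bar>e (r0 - \<theta>) \<eta>\<bar>" by (intro mult_left_mono) auto
    ultimately show ?thesis by linarith
  qed
  have t2: "\<omega>\<^sup>2 * e \<theta> \<theta> \<le> g_ap\<^sup>2 * t\<^sup>2"
  proof -
    \<comment> \<open>The duality estimate is applied with \<open>\<theta>\<close> itself as datum,
      after which one factor \<open>E.nrm \<theta>\<close> cancels.\<close>
    have "e r \<theta> = e \<theta> \<theta>" using \<theta>o'[OF r0(1)] \<theta>L in_H0 by (simp add: rsplit E.add_left)
    then have "\<omega> * (E.nrm \<theta>)\<^sup>2 \<le> g_ap * t * E.nrm \<theta>"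
      using Aubin_Nitsche[OF rH orth', of \<theta>] \<theta>L \<theta>o E.nrm_sq[of \<theta>] E.nonneg[of \<theta>] by (simp add: t_def)
    moreover have "0 \<le> E.nrm \<theta>" using \<theta>L by simp
    moreover have "0 \<le> g_ap * t" using g_ap_nonneg nn by simp
    ultimately have "\<omega> * E.nrm \<theta> \<le> g_ap * t"
      by (cases "E.nrm \<theta> = 0") (auto simp: power2_eq_square)
    then have "(\<omega> * E.nrm \<theta>)\<^sup>2 \<le> (g_ap * t)\<^sup>2"
      using omega_pos \<theta>L by (intro power_mono) auto
    then show ?thesis using E.nrm_sq[of \<theta>] \<theta>L by (simp add: power_mult_distrib)
  qed
  have t3: "\<omega>\<^sup>2 * e r0 x0 \<le> t * (g_div * (h + t))"
  proof -
    have "\<omega>\<^sup>2 * e r0 x0 \<le> \<omega>\<^sup>2 * (E.nrm r0 * E.nrm x0)"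
      using E.Cauchy_Schwarz[of r0 x0] in_H0 by (intro mult_left_mono) auto
    also have "\<dots> = (\<omega> * E.nrm r0) * (\<omega> * E.nrm x0)" by (simp add: power2_eq_square)
    also have "\<dots> \<le> t * (g_div * (h + t))"
    proof (rule mult_mono)
      have "E.nrm r0 \<le> E.nrm r" using projection_nrm_le[OF _ r0] rH by simp
      then have "\<omega> * E.nrm r0 \<le> \<omega> * E.nrm r" using omega_pos by simp
      then show "\<omega> * E.nrm r0 \<le> t" using E_le_T[OF rH] by (simp add: t_def)
      have "C.nrm x \<le> h + t"
      proof -
        have "x = r - \<eta> - \<xi>0" by (simp add: dec x_def)
        then have "C.nrm x \<le> C.nrm (r - \<eta>) + C.nrm \<xi>0"
          using C.nrm_triangle_diff[of "r - \<eta>" \<xi>0] rH \<eta>H in_H0 by simp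
        also have "C.nrm \<xi>0 = 0" using H0D(2)[OF \<xi>0(2)] by (simp add: C.nrm_def)
        finally show ?thesis
          using C.nrm_triangle_diff[OF rH \<eta>H] C_le_T[OF rH] C_le_T[OF \<eta>H] by (simp add: t_def h_def)
      qed
      then have "g_div * C.nrm x \<le> g_div * (h + t)" using g_div_nonneg by (rule mult_left_mono)
      then show "\<omega> * E.nrm x0 \<le> g_div * (h + t)" using projection_Xh_le[OF xX x0] by linarith
    qed (use nn omega_pos in_H0 in auto)
    finally show ?thesis .
  qed
  have "t\<^sup>2 \<le> t * h + 2 * (g_ap\<^sup>2 * t\<^sup>2) + 2 * (t * (g_div * (h + t)))"
    using key t1 t2 t3 by simp
  then have "t * t \<le> t * (h + 2 * g_ap\<^sup>2 * t + 2 * g_div * (h + t))"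
    by (simp add: power2_eq_square algebra_simps)
  then have main: "t \<le> h + 2 * g_ap\<^sup>2 * t + 2 * g_div * (h + t)"
    using nn g_div_nonneg by (cases "t = 0") auto
  have "(1 - 4 * g_div - 2 * g_ap\<^sup>2) * t \<le> h"
  proof (cases "h \<le> t")
    case True
    then have "2 * g_div * (h + t) \<le> 2 * g_div * (2 * t)"
      using g_div_nonneg by (intro mult_left_mono) auto
    with main show ?thesis by (simp add: algebra_simps)
  next
    case False
    have "(1 - 4 * g_div - 2 * g_ap\<^sup>2) * t \<le> 1 * t"
      using nn g_div_nonneg zero_le_power2[of g_ap] by (intro mult_right_mono) linarith+
    with False show ?thesis by linarith
  qed
  then show ?thesis by (simp add: t_def h_def r_def \<eta>_def)
qed

text \<open>Quasi-optimality for the exact solution 0 with zero data: \<open>- v\<close> is a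
  discrete solution, and 0 is a discrete competitor with no error.\<close>

lemma discrete_uniqueness:
  assumes small: "4 * g_div + 2 * g_ap\<^sup>2 < 1"
    and v: "v \<in> Vh" and orth: "\<And>wh. wh \<in> Vh \<Longrightarrow> b v wh = 0"
  shows "a v v = 0"
proof -
  have "(1 - 4 * g_div - 2 * g_ap\<^sup>2) * T.nrm (0 - (-1) *\<^sub>R v) \<le> T.nrm (0 - 0)"
    using orth subspace_0[OF Vh(1)] v by (intro quasi_optimality subspace_scale[OF Vh(1)]) auto
  then have "(1 - 4 * g_div - 2 * g_ap\<^sup>2) * T.nrm v \<le> 0" by simp
  then have "T.nrm v \<le> 0" using small by (simp add: mult_le_0_iff)
  then show ?thesis using T.nonneg[of v] v by (simp add: T.nrm_def)
qed

text \<open>Existence from uniqueness, on an \<open>a\<close>-orthonormal basis \<open>S\<close>. If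
  the functionals \<open>b v i\<close> were dependent, their coefficients would give a combination
  of \<open>S\<close> that is \<open>b\<close>-orthogonal to \<open>Vh\<close>, hence null by
  uniqueness, although its \<open>a\<close>-products with the basis are these same coefficients. So
  the values of \<open>l\<close> on \<open>S\<close> are attained by some discrete
  \<open>v\<close>.\<close>

lemma discrete_existence:
  assumes small: "4 * g_div + 2 * g_ap\<^sup>2 < 1" and l: "l \<in> dual_H"
  shows "\<exists>v\<in>Vh. \<forall>w\<in>Vh. b v w = l w"
proof -
  have "\<exists>S. finite S \<and> S \<subseteq> Vh \<and> (\<forall>x\<in>S. \<forall>y\<in>S. a x y = (if x = y then 1 else 0)) \<and>
    (\<forall>v\<in>Vh. \<exists>s\<in>span S. a (v - s) (v - s) = 0)"
    by (rule T.orthonormal_basis_exists[OF B N Vh]) (use null_N span_B in auto)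
  then obtain S where S: "finite S" "S \<subseteq> Vh" "\<forall>x\<in>S. \<forall>y\<in>S. a x y = (if x = y then 1 else 0)"
    "\<forall>v\<in>Vh. \<exists>s\<in>span S. a (v - s) (v - s) = 0" by blast
  have SH: "S \<subseteq> H" using S(2) by auto
  have l_add: "l (v + w) = l v + l w" if "v \<in> H" "w \<in> H" for v w
    using l that by (simp add: dual_H_def)
  have l_scale: "l (r *\<^sub>R v) = r * l v" if "v \<in> H" for v r
    using l that by (simp add: dual_H_def)
  obtain K where K: "\<And>w. w \<in> H \<Longrightarrow> \<bar>l w\<bar> \<le> K * T.nrm w"
    using l unfolding dual_H_def by blast
  have "(\<forall>y. \<exists>v\<in>Vh. \<forall>i\<in>S. b v i = y i) \<or>
    (\<exists>k. (\<exists>i\<in>S. k i \<noteq> 0) \<and> (\<forall>v\<in>Vh. (\<Sum>i\<in>S. k i * b v i) = 0))"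
    by (rule functionals_surj_or_dependent[OF S(1) Vh(1), of "\<lambda>i v. b v i"])
       (use SH in \<open>auto simp: b_add_left b_scale_left\<close>)
  then consider (surj) "\<forall>y. \<exists>v\<in>Vh. \<forall>i\<in>S. b v i = y i"
    | (dep) k where "\<exists>i\<in>S. k i \<noteq> 0" "\<forall>v\<in>Vh. (\<Sum>i\<in>S. k i * b v i) = 0" by blast
  then show ?thesis
  proof cases
    case dep
    have b_sum: "b v (\<Sum>i\<in>M. k i *\<^sub>R i) = (\<Sum>i\<in>M. k i * b v i)" if "finite M" "M \<subseteq> Vh" "v \<in> Vh" for M v
      using that
    proof (induction M rule: finite_induct)
      case empty
      then show ?case by (simp add: b_def)
    next
      case (insert x M)
      have "(\<Sum>x\<in>M. k x *\<^sub>R x) \<in> Vh"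
        using insert by (intro subspace_sum[OF Vh(1)] subspace_scale[OF Vh(1)]) auto
      with insert show ?case by (simp add: b_add_right b_scale_right)
    qed
    define z where "z = (\<Sum>i\<in>S. k i *\<^sub>R i)"
    have zV: "z \<in> Vh"
      unfolding z_def using S(2) by (intro subspace_sum[OF Vh(1)] subspace_scale[OF Vh(1)]) auto
    have "b z wh = 0" if wh: "wh \<in> Vh" for wh
      using dep(2) b_sum[OF S(1,2) wh] b_sym[of z wh] zV wh by (simp add: z_def)
    then have zz: "a z z = 0" by (rule discrete_uniqueness[OF small zV])
    obtain i where i: "i \<in> S" "k i \<noteq> 0" using dep(1) by blast
    have iH: "i \<in> H" using i SH by auto
    have "a z i = (\<Sum>x\<in>S. k x * a x i)" unfolding z_def by (rule T.sum_left[OF S(1) SH iH])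
    also have "\<dots> = (\<Sum>x\<in>S. if x = i then k x else 0)" using S(3) i by (intro sum.cong) auto
    also have "\<dots> = k i" using S(1) i by simp
    finally show ?thesis using T.null_left[of z i] zz zV iH i by simp
  next
    case surj
    then obtain v where v: "v \<in> Vh" "\<forall>i\<in>S. b v i = l i" by blast
    \<comment> \<open>Agreement on \<open>S\<close> extends to its span by linearity, and then to
      \<open>Vh\<close> because \<open>b v\<close> and \<open>l\<close> are bounded by multiples of
      \<open>T.nrm\<close> and so vanish on the null remainder \<open>w - s\<close>.\<close>
    define Z where "Z = {w \<in> H. b v w = l w}"
    have "subspace Z"
    proof (rule subspaceI)
      show "0 \<in> Z" using l_scale[of 0 0] v b_scale_right[of v 0 0] by (simp add: Z_def)
    qed (use v in \<open>auto simp: Z_def b_add_right b_scale_right l_add l_scale\<close>)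
    have "S \<subseteq> Z" using v SH by (auto simp: Z_def)
    have "b v w = l w" if w: "w \<in> Vh" for w
    proof -
      obtain s where s: "s \<in> span S" "a (w - s) (w - s) = 0" using S(4) w by blast
      have sZ: "s \<in> Z" using s(1) span_minimal[OF \<open>S \<subseteq> Z\<close> \<open>subspace Z\<close>] by blast
      then have sH: "s \<in> H" by (simp add: Z_def)
      have n0: "T.nrm (w - s) = 0" using s(2) by (simp add: T.nrm_def)
      have "w - s \<in> Z"
        using K[of "w - s"] b_bounded[of v "w - s"] n0 v w sH by (simp add: Z_def)
      then have "(w - s) + s \<in> Z" using subspace_add[OF \<open>subspace Z\<close>] sZ by blast
      then show ?thesis by (simp add: Z_def)
    qed
    then show ?thesis using v by blast
  qed
qed

end

section \<open>Weighted inner products on square-integrable fields\<close>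

instantiation "fun" :: (type, real_vector) real_vector
begin

definition scaleR_fun :: "real \<Rightarrow> ('a \<Rightarrow> 'b) \<Rightarrow> 'a \<Rightarrow> 'b" where
  "scaleR_fun r f = (\<lambda>x. r *\<^sub>R f x)"

instance
  by standard (auto simp: scaleR_fun_def fun_eq_iff algebra_simps)

end

lemma scaleR_fun_apply [simp]: "(r *\<^sub>R f) x = r *\<^sub>R f x"
  by (simp add: scaleR_fun_def)

section \<open>Eigenvalue bounds for symmetric matrices\<close>

lemma symmetric_matrix_inner:
  fixes A :: "real^'n^'n"
  assumes "transpose A = A"
  shows "(A *v x) \<bullet> y = x \<bullet> (A *v y)"
  by (metis assms dot_lmul_matrix transpose_matrix_vector)

text \<open>Rayleigh quotient: the minimiser \<open>z\<close> on the unit sphere is a null vector of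
  the positive semi-definite form of \<open>A\<close> minus \<open>lam\<close> times the identity;
  null vectors are orthogonal to everything, so \<open>z\<close> is an eigenvector. This is the
  bridge from \<open>admissible_coeff\<close>, which bounds eigenvalues, to the bounds on quadratic
  forms needed under the integral.\<close>

lemma symmetric_min_eigenvalue:
  fixes A :: "real^'n^'n"
  assumes "transpose A = A"
  shows "\<exists>lam \<xi>. \<xi> \<noteq> 0 \<and> A *v \<xi> = lam *\<^sub>R \<xi> \<and> (\<forall>x. lam * (x \<bullet> x) \<le> (A *v x) \<bullet> x)"
proof -
  have "\<exists>x\<in>sphere 0 1. \<forall>y\<in>sphere (0::real^'n) 1. (A *v x) \<bullet> x \<le> (A *v y) \<bullet> y"
    by (rule continuous_attains_inf) (auto intro!: continuous_intros matrix_vector_mult_linear_continuous_on)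
  then obtain z where z: "norm z = 1" and min: "\<And>y. norm y = 1 \<Longrightarrow> (A *v z) \<bullet> z \<le> (A *v y) \<bullet> y"
    by auto
  define lam where "lam = (A *v z) \<bullet> z"
  have le: "lam * (x \<bullet> x) \<le> (A *v x) \<bullet> x" for x
  proof (cases "x = 0")
    case False
    define y where "y = (1 / norm x) *\<^sub>R x"
    have "lam \<le> (A *v y) \<bullet> y" unfolding lam_def by (rule min) (use False in \<open>simp add: y_def\<close>)
    also have "\<dots> = ((A *v x) \<bullet> x) / (x \<bullet> x)"
      by (simp add: y_def matrix_vector_mult_scaleR power2_norm_eq_inner[symmetric] power2_eq_square)
    finally show ?thesis using False by (simp add: pos_le_divide_eq)
  qed simp
  interpret q: semi_inner UNIV "\<lambda>x y. (A *v x) \<bullet> y - lam * (x \<bullet> y)"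
  proof
    show "(A *v x) \<bullet> y - lam * (x \<bullet> y) = (A *v y) \<bullet> x - lam * (y \<bullet> x)" for x y
      using symmetric_matrix_inner[OF assms, of x y] by (simp add: inner_commute)
  qed (auto simp: matrix_vector_right_distrib matrix_vector_mult_scaleR inner_left_distrib algebra_simps le)
  have "(A *v z) \<bullet> y - lam * (z \<bullet> y) = 0" for y
    by (rule q.null_left) (use z in \<open>simp_all add: lam_def power2_norm_eq_inner[symmetric]\<close>)
  from this[of "A *v z - lam *\<^sub>R z"] have "(A *v z - lam *\<^sub>R z) \<bullet> (A *v z - lam *\<^sub>R z) = 0"
    by (simp add: inner_diff_left)
  then have "A *v z = lam *\<^sub>R z" by simp
  moreover have "z \<noteq> 0" using z by auto
  ultimately show ?thesis using le by blast
qed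

text \<open>The upper bound is the lower one for \<open>- A\<close>, whose least eigenvalue is minus
  an eigenvalue of \<open>A\<close>.\<close>

lemma symmetric_eigenvalue_bounds:
  fixes A :: "real^'n^'n"
  assumes A: "transpose A = A"
    and ev: "\<And>lam \<xi>. \<xi> \<noteq> 0 \<Longrightarrow> A *v \<xi> = lam *\<^sub>R \<xi> \<Longrightarrow> c \<le> lam \<and> lam \<le> C"
  shows "c * (x \<bullet> x) \<le> (A *v x) \<bullet> x" and "(A *v x) \<bullet> x \<le> C * (x \<bullet> x)"
proof -
  obtain lam \<xi> where 1: "\<xi> \<noteq> 0" "A *v \<xi> = lam *\<^sub>R \<xi>" "lam * (x \<bullet> x) \<le> (A *v x) \<bullet> x"
    using symmetric_min_eigenvalue[OF A] by blast
  have "c * (x \<bullet> x) \<le> lam * (x \<bullet> x)" using ev[OF 1(1,2)] by (intro mult_right_mono) auto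
  with 1(3) show "c * (x \<bullet> x) \<le> (A *v x) \<bullet> x" by linarith
  have neg: "(- A) *v y = - (A *v y)" for y
    by (metis diff_0 matrix_vector_mult_0 matrix_vector_mult_diff_rdistrib)
  have "transpose (- A) = - A" using A by (simp add: transpose_def vec_eq_iff)
  then obtain mu \<eta> where 2: "\<eta> \<noteq> 0" "(- A) *v \<eta> = mu *\<^sub>R \<eta>" "mu * (x \<bullet> x) \<le> ((- A) *v x) \<bullet> x"
    using symmetric_min_eigenvalue[of "- A"] by blast
  have "A *v \<eta> = (- mu) *\<^sub>R \<eta>" using 2(2) by (metis neg minus_minus scaleR_minus_left)
  then have "- mu * (x \<bullet> x) \<le> C * (x \<bullet> x)" using ev[OF 2(1)] by (intro mult_right_mono) auto
  with 2(3) show "(A *v x) \<bullet> x \<le> C * (x \<bullet> x)" by (simp add: neg)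
qed

lemma admissible_coeffD:
  assumes "admissible_coeff D \<epsilon>"
  shows "(\<lambda>x. \<epsilon> x $ i $ j) \<in> borel_measurable (lebesgue_on D)"
    and "x \<in> D \<Longrightarrow> transpose (\<epsilon> x) = \<epsilon> x"
    and "\<exists>c C. 0 < c \<and> (\<forall>x\<in>D. \<forall>\<xi>. c * (\<xi> \<bullet> \<xi>) \<le> (\<epsilon> x *v \<xi>) \<bullet> \<xi> \<and> (\<epsilon> x *v \<xi>) \<bullet> \<xi> \<le> C * (\<xi> \<bullet> \<xi>))"
proof -
  show "(\<lambda>x. \<epsilon> x $ i $ j) \<in> borel_measurable (lebesgue_on D)"
    and s: "x \<in> D \<Longrightarrow> transpose (\<epsilon> x) = \<epsilon> x" for x
    using assms by (auto simp: admissible_coeff_def)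
  obtain c C where cC: "0 < c" "\<And>x lam \<xi>. x \<in> D \<Longrightarrow> \<xi> \<noteq> 0 \<Longrightarrow> \<epsilon> x *v \<xi> = lam *\<^sub>R \<xi> \<Longrightarrow> c \<le> lam \<and> lam \<le> C"
    using assms unfolding admissible_coeff_def by blast
  show "\<exists>c C. 0 < c \<and> (\<forall>x\<in>D. \<forall>\<xi>. c * (\<xi> \<bullet> \<xi>) \<le> (\<epsilon> x *v \<xi>) \<bullet> \<xi> \<and> (\<epsilon> x *v \<xi>) \<bullet> \<xi> \<le> C * (\<xi> \<bullet> \<xi>))"
    by (intro exI[of _ c] exI[of _ C] conjI ballI allI cC(1)
        symmetric_eigenvalue_bounds[OF s]) (use cC(2) in auto)
qed

section \<open>Square-integrable fields\<close>

lemma lmeasurable_space [simp]: "D \<in> lmeasurable \<Longrightarrow> space (lebesgue_on D) = D"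
  by (simp add: space_restrict_space)

lemma L2_integrable_inner:
  assumes "L2 D v" "L2 D w"
  shows "integrable (lebesgue_on D) (\<lambda>x. v x \<bullet> w x)"
proof (rule Bochner_Integration.integrable_bound)
  show "integrable (lebesgue_on D) (\<lambda>x. (norm (v x))\<^sup>2 + (norm (w x))\<^sup>2)"
    using assms by (auto simp: L2_def)
  show "(\<lambda>x. v x \<bullet> w x) \<in> borel_measurable (lebesgue_on D)"
    using assms by (auto simp: L2_def)
  have "norm (v x \<bullet> w x) \<le> norm ((norm (v x))\<^sup>2 + (norm (w x))\<^sup>2)" for x
  proof -
    have "\<bar>v x \<bullet> w x\<bar> \<le> norm (v x) * norm (w x)" by (rule Cauchy_Schwarz_ineq2)
    also have "\<dots> \<le> (norm (v x))\<^sup>2 + (norm (w x))\<^sup>2"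
      using sum_squares_bound[of "norm (v x)" "norm (w x)"]
        mult_nonneg_nonneg[OF norm_ge_zero[of "v x"] norm_ge_zero[of "w x"]] by linarith
    finally show ?thesis by simp
  qed
  then show "AE x in lebesgue_on D. norm (v x \<bullet> w x) \<le> norm ((norm (v x))\<^sup>2 + (norm (w x))\<^sup>2)"
    by simp
qed

lemma L2_add:
  assumes "L2 D v" "L2 D w"
  shows "L2 D (v + w)"
proof -
  have "integrable (lebesgue_on D) (\<lambda>x. (norm (v x))\<^sup>2 + (norm (w x))\<^sup>2 + 2 * (v x \<bullet> w x))"
    using assms L2_integrable_inner[OF assms] by (auto simp: L2_def)
  then show ?thesis
    using assms by (auto simp: L2_def plus_fun_def power2_norm_eq_inner inner_add inner_commute algebra_simps)
qed

lemma L2_scale: "L2 D v \<Longrightarrow> L2 D (r *\<^sub>R v)"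
  by (auto simp: L2_def scaleR_fun_def power_mult_distrib)

lemma L2_zero: "L2 D (\<lambda>x. 0)"
  by (simp add: L2_def)

lemma subspace_L2: "subspace {v. L2 D v}"
  by (rule subspaceI) (auto simp: L2_add L2_scale L2_zero zero_fun_def)

lemma L2_continuous:
  assumes D: "bounded D" "D \<in> lmeasurable" and f: "continuous_on UNIV f"
  shows "L2 D f"
proof -
  have "compact (f ` closure D)"
    using D f by (intro compact_continuous_image) (auto intro: continuous_on_subset)
  then obtain K where K: "\<And>x. x \<in> D \<Longrightarrow> norm (f x) \<le> K"
    using closure_subset[of D] compact_imp_bounded[of "f ` closure D"] unfolding bounded_iff by blast
  have meas: "f \<in> borel_measurable (lebesgue_on D)"
    using f by (intro measurable_restrict_space1) (simp add: borel_measurable_continuous_onI measurable_completion)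
  interpret finite_measure "lebesgue_on D" by (rule finite_measure_lebesgue_on[OF D(2)])
  have "integrable (lebesgue_on D) (\<lambda>x. (norm (f x))\<^sup>2)"
  proof (rule integrable_const_bound[where B = "K\<^sup>2"])
    show "AE x in lebesgue_on D. norm ((norm (f x))\<^sup>2) \<le> K\<^sup>2"
      using K D(2) by (intro AE_I2) (auto intro!: power_mono)
  qed (use meas in simp)
  with meas show ?thesis by (simp add: L2_def)
qed

context
  fixes D :: "vec3 set" and \<epsilon> :: "vec3 \<Rightarrow> real^3^3"
  assumes D: "D \<in> lmeasurable" and eps: "admissible_coeff D \<epsilon>"
begin

lemma coeff_psd: "x \<in> D \<Longrightarrow> 0 \<le> (\<epsilon> x *v \<xi>) \<bullet> \<xi>"
  using admissible_coeffD(3)[OF eps] by (meson inner_ge_zero less_imp_le mult_nonneg_nonneg order_trans)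

lemma ip_integrable:
  assumes "L2 D v" "L2 D w"
  shows "integrable (lebesgue_on D) (\<lambda>x. (\<epsilon> x *v v x) \<bullet> w x)"
proof -
  obtain C where C: "\<And>x \<xi>. x \<in> D \<Longrightarrow> (\<epsilon> x *v \<xi>) \<bullet> \<xi> \<le> C * (\<xi> \<bullet> \<xi>)"
    using admissible_coeffD(3)[OF eps] by blast
  show ?thesis
  proof (rule Bochner_Integration.integrable_bound)
    show "integrable (lebesgue_on D) (\<lambda>x. C * (norm (v x))\<^sup>2 + C * (norm (w x))\<^sup>2)"
      using assms by (auto simp: L2_def)
    have comp: "(\<lambda>x. u x $ i) \<in> borel_measurable (lebesgue_on D)" if "L2 D u" for u :: "vec3 \<Rightarrow> vec3" and i
    proof -
      have "(\<lambda>x. u x \<bullet> axis i 1) \<in> borel_measurable (lebesgue_on D)"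
        using that by (intro borel_measurable_inner) (auto simp: L2_def)
      then show ?thesis by (simp add: inner_axis)
    qed
    have "(\<lambda>x. \<Sum>i\<in>UNIV. (\<Sum>j\<in>UNIV. \<epsilon> x $ i $ j * v x $ j) * w x $ i) \<in> borel_measurable (lebesgue_on D)"
      by (intro borel_measurable_sum borel_measurable_times admissible_coeffD(1)[OF eps] comp assms)
    then show "(\<lambda>x. (\<epsilon> x *v v x) \<bullet> w x) \<in> borel_measurable (lebesgue_on D)"
      by (simp add: inner_vec_def matrix_vector_mult_def)
    have "norm ((\<epsilon> x *v v x) \<bullet> w x) \<le> norm (C * (norm (v x))\<^sup>2 + C * (norm (w x))\<^sup>2)" if x: "x \<in> D" for x
    proof -
      note s = symmetric_matrix_inner[OF admissible_coeffD(2)[OF eps x], of "w x" "v x"]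
      \<comment> \<open>Positivity at the sum and at the difference bounds the mixed term by the
        diagonal ones, so no operator norm of the coefficient is needed.\<close>
      have "0 \<le> (\<epsilon> x *v (v x + w x)) \<bullet> (v x + w x)" "0 \<le> (\<epsilon> x *v (v x - w x)) \<bullet> (v x - w x)"
        by (rule coeff_psd[OF x])+
      then have "2 * \<bar>(\<epsilon> x *v v x) \<bullet> w x\<bar> \<le> (\<epsilon> x *v v x) \<bullet> v x + (\<epsilon> x *v w x) \<bullet> w x"
        using s by (auto simp: matrix_vector_right_distrib matrix_vector_mult_diff_distrib
            inner_add inner_diff inner_commute abs_if)
      also have "\<dots> \<le> C * (norm (v x))\<^sup>2 + C * (norm (w x))\<^sup>2"
        using C[OF x, of "v x"] C[OF x, of "w x"] by (simp add: power2_norm_eq_inner)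
      finally show ?thesis by simp
    qed
    then show "AE x in lebesgue_on D. norm ((\<epsilon> x *v v x) \<bullet> w x) \<le> norm (C * (norm (v x))\<^sup>2 + C * (norm (w x))\<^sup>2)"
      using D by (intro AE_I2) simp
  qed
qed

lemma ip_semi_inner: "semi_inner {v. L2 D v} (ip D \<epsilon>)"
proof
  show "subspace {v. L2 D v}" by (rule subspace_L2)
  show "ip D \<epsilon> x y = ip D \<epsilon> y x" if "x \<in> {v. L2 D v}" "y \<in> {v. L2 D v}" for x y
    unfolding ip_def
  proof (rule Bochner_Integration.integral_cong)
    fix t assume "t \<in> space (lebesgue_on D)"
    then have "t \<in> D" using D by simp
    then show "(\<epsilon> t *v x t) \<bullet> y t = (\<epsilon> t *v y t) \<bullet> x t"
      using symmetric_matrix_inner[OF admissible_coeffD(2)[OF eps]] by (metis inner_commute)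
  qed simp
  show "ip D \<epsilon> (x + y) z = ip D \<epsilon> x z + ip D \<epsilon> y z"
    if "x \<in> {v. L2 D v}" "y \<in> {v. L2 D v}" "z \<in> {v. L2 D v}" for x y z
    using Bochner_Integration.integral_add[OF ip_integrable[of x z] ip_integrable[of y z]] that
    by (simp add: ip_def matrix_vector_right_distrib inner_add)
  show "ip D \<epsilon> (r *\<^sub>R x) y = r * ip D \<epsilon> x y" for r x y
    by (simp add: ip_def matrix_vector_mult_scaleR)
  show "0 \<le> ip D \<epsilon> x x" for x
    unfolding ip_def using D by (intro integral_nonneg_AE AE_I2) (auto intro: coeff_psd)
qed

lemma ip_cong_AE:
  assumes "L2 D v" "L2 D v'" "L2 D w" "L2 D w'"
    and "AE x in lebesgue_on D. v x = v' x" "AE x in lebesgue_on D. w x = w' x"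
  shows "ip D \<epsilon> v w = ip D \<epsilon> v' w'"
  unfolding ip_def
proof (rule integral_cong_AE)
  show "AE x in lebesgue_on D. (\<epsilon> x *v v x) \<bullet> w x = (\<epsilon> x *v v' x) \<bullet> w' x"
    using assms(5,6) by eventually_elim simp
qed (use assms ip_integrable in auto)

text \<open>The positive lower eigenvalue bound makes a vanishing density force a vanishing field at
  each point. This translates abstract null vectors into equality almost everywhere.\<close>

lemma ip_eq_0_iff:
  assumes v: "L2 D v"
  shows "ip D \<epsilon> v v = 0 \<longleftrightarrow> (AE x in lebesgue_on D. v x = 0)"
proof -
  obtain c where c: "0 < c" "\<And>x \<xi>. x \<in> D \<Longrightarrow> c * (\<xi> \<bullet> \<xi>) \<le> (\<epsilon> x *v \<xi>) \<bullet> \<xi>"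
    using admissible_coeffD(3)[OF eps] by blast
  have "ip D \<epsilon> v v = 0 \<longleftrightarrow> (AE x in lebesgue_on D. (\<epsilon> x *v v x) \<bullet> v x = 0)"
    unfolding ip_def using D coeff_psd
    by (intro integral_nonneg_eq_0_iff_AE ip_integrable v AE_I2) auto
  also have "\<dots> \<longleftrightarrow> (AE x in lebesgue_on D. v x = 0)"
  proof (rule AE_cong)
    fix x assume "x \<in> space (lebesgue_on D)"
    then have x: "x \<in> D" using D by simp
    show "(\<epsilon> x *v v x) \<bullet> v x = 0 \<longleftrightarrow> v x = 0"
    proof
      assume "(\<epsilon> x *v v x) \<bullet> v x = 0"
      then have "c * (v x \<bullet> v x) \<le> 0" using c(2)[OF x, of "v x"] by simp
      then have "v x \<bullet> v x \<le> 0" using c(1) by (simp add: mult_le_0_iff)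
      then show "v x = 0" using inner_ge_zero[of "v x"] inner_eq_zero_iff[of "v x"] by linarith
    qed simp
  qed
  finally show ?thesis .
qed

end

section \<open>The fundamental lemma for test fields\<close>

text \<open>Continuity of the derivative is asked for one direction at a time, which is the form in
  which \<open>pd\<close> enters \<open>test_field\<close>.\<close>

definition C1_fun :: "('a::real_normed_vector \<Rightarrow> real) \<Rightarrow> bool" where
  "C1_fun f \<longleftrightarrow> (\<exists>f'. (\<forall>x. (f has_derivative f' x) (at x)) \<and> (\<forall>h. continuous_on UNIV (\<lambda>x. f' x h)))"

lemma C1_fun_continuous: "C1_fun f \<Longrightarrow> continuous_on UNIV f"
  unfolding C1_fun_def by (metis continuous_at_imp_continuous_on has_derivative_continuous)

lemma C1_fun_const: "C1_fun (\<lambda>x. k)"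
  unfolding C1_fun_def by (intro exI[of _ "\<lambda>x h. 0"]) auto

lemma C1_fun_nth: "C1_fun (\<lambda>x::real^'n. x $ i)"
  unfolding C1_fun_def
  by (intro exI[of _ "\<lambda>x h. h $ i"]) (auto intro: bounded_linear_imp_has_derivative bounded_linear_vec_nth)

lemma C1_fun_mult:
  assumes "C1_fun f" "C1_fun g"
  shows "C1_fun (\<lambda>x. f x * g x)"
proof -
  obtain f' g' where f: "\<And>x. (f has_derivative f' x) (at x)" "\<And>h. continuous_on UNIV (\<lambda>x. f' x h)"
    and g: "\<And>x. (g has_derivative g' x) (at x)" "\<And>h. continuous_on UNIV (\<lambda>x. g' x h)"
    using assms unfolding C1_fun_def by blast
  have "((\<lambda>x. f x * g x) has_derivative (\<lambda>h. f x * g' x h + f' x h * g x)) (at x)" for x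
    by (rule has_derivative_mult[OF f(1) g(1)])
  moreover have "continuous_on UNIV (\<lambda>x. f x * g' x h + f' x h * g x)" for h
    by (intro continuous_intros f(2) g(2) C1_fun_continuous assms)
  ultimately show ?thesis
    unfolding C1_fun_def by (intro exI[of _ "\<lambda>x h. f x * g' x h + f' x h * g x"]) auto
qed

lemma C1_fun_prod: "finite S \<Longrightarrow> (\<And>i. i \<in> S \<Longrightarrow> C1_fun (f i)) \<Longrightarrow> C1_fun (\<lambda>x. \<Prod>i\<in>S. f i x)"
  by (induction S rule: finite_induct) (auto simp: C1_fun_const C1_fun_mult)

lemma C1_fun_compose:
  assumes "C1_fun f" and g: "\<And>s. (g has_real_derivative g' s) (at s)" "continuous_on UNIV g'"
  shows "C1_fun (\<lambda>x. g (f x))"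
proof -
  obtain f' where f: "\<And>x. (f has_derivative f' x) (at x)" "\<And>h. continuous_on UNIV (\<lambda>x. f' x h)"
    using assms unfolding C1_fun_def by blast
  have "((\<lambda>x. g (f x)) has_derivative (\<lambda>h. f' x h * g' (f x))) (at x)" for x
    by (rule DERIV_compose_FDERIV[OF g(1) f(1)])
  moreover have "continuous_on UNIV (\<lambda>x. f' x h * g' (f x))" for h
    by (intro continuous_intros f(2) continuous_on_compose2[OF g(2)] C1_fun_continuous assms) auto
  ultimately show ?thesis
    unfolding C1_fun_def by (intro exI[of _ "\<lambda>x h. f' x h * g' (f x)"]) auto
qed

text \<open>Test fields are only required to be continuously differentiable, so the square of the
  positive part is smooth enough to build cutoffs from. At 0 the difference quotient is bounded by
  the absolute value of the increment.\<close>

lemma DERIV_pos_part_square: "((\<lambda>s::real. (max 0 s)\<^sup>2) has_real_derivative 2 * max 0 s) (at s)"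
proof -
  consider "s > 0" | "s < 0" | "s = 0" by linarith
  then show ?thesis
  proof cases
    case 1
    have "((\<lambda>s::real. s\<^sup>2) has_real_derivative 2 * max 0 s) (at s)"
      using 1 by (auto intro!: derivative_eq_intros)
    then show ?thesis
      by (rule has_field_derivative_transform_within_open[of _ _ _ "{0<..}"]) (use 1 in auto)
  next
    case 2
    have "((\<lambda>s::real. 0) has_real_derivative 2 * max 0 s) (at s)"
      using 2 by (auto intro!: derivative_eq_intros)
    then show ?thesis
      by (rule has_field_derivative_transform_within_open[of _ _ _ "{..<0}"]) (use 2 in auto)
  next
    case 3
    have "(\<lambda>h::real. (max 0 (0 + h))\<^sup>2 / h) \<midarrow>0\<rightarrow> 0"
    proof (rule Lim_null_comparison)
      show "\<forall>\<^sub>F h in at 0. norm ((max 0 (0 + h))\<^sup>2 / h) \<le> \<bar>h::real\<bar>"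
        by (intro always_eventually allI) (auto simp: max_def power2_eq_square)
      show "(\<lambda>h::real. \<bar>h\<bar>) \<midarrow>0\<rightarrow> 0" by (intro tendsto_rabs_zero tendsto_ident_at)
    qed
    then show ?thesis using 3 by (simp add: DERIV_def)
  qed
qed

lemma test_field_axis:
  assumes f: "C1_fun f" and supp: "\<And>x. f x \<noteq> 0 \<Longrightarrow> x \<in> cbox a b"
  shows "test_field (\<lambda>x. f x *\<^sub>R axis j 1)"
proof -
  let ?F = "\<lambda>x. f x *\<^sub>R (axis j 1 :: vec3)"
  obtain f' where f': "\<And>x. (f has_derivative f' x) (at x)" "\<And>h. continuous_on UNIV (\<lambda>x. f' x h)"
    using f unfolding C1_fun_def by blast
  have der: "(?F has_derivative (\<lambda>h. f' x h *\<^sub>R axis j 1)) (at x)" for x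
    by (rule has_derivative_scaleR_left[OF f'(1)])
  have "pd ?F i l x = f' x (axis i 1) * (axis j 1 :: vec3) $ l" for i l x
    unfolding pd_def frechet_derivative_at[OF der, symmetric] by simp
  then have "continuous_on UNIV (pd ?F i l)" for i l
    using f'(2)[of "axis i 1"] by (simp add: continuous_on_mult_right cong: continuous_on_cong)
  moreover have "?F differentiable (at x)" for x using der by (rule differentiableI)
  moreover have "compact (closure {x. ?F x \<noteq> 0})"
  proof -
    have "closure {x. ?F x \<noteq> 0} \<subseteq> cbox a b"
      by (rule closure_minimal) (use supp in auto)
    then show ?thesis
      using compact_cbox by (metis bounded_subset closed_closure compact_eq_bounded_closed)
  qed
  ultimately show ?thesis by (auto simp: test_field_def)
qed

text \<open>The product \<open>\<psi>\<close> of squared positive parts is nonzero exactly in the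
  open box. Then \<open>F n\<close> equals
  \<open>n * \<psi>\<^sup>2 / (1 + n * \<psi>\<^sup>2)\<close>: it lies between 0 and 1, vanishes
  with \<open>\<psi>\<close>, and tends to 1 elsewhere.\<close>

lemma box_indicator_C1_limit:
  fixes a b :: "real^'n"
  assumes ab: "box a b \<noteq> {}"
  shows "\<exists>F. (\<forall>n::nat. C1_fun (F n)) \<and> (\<forall>n x. F n x \<noteq> 0 \<longrightarrow> x \<in> cbox a b) \<and>
    (\<forall>n x. \<bar>F n x\<bar> \<le> 1) \<and> (\<forall>x. (\<lambda>n. F n x) \<longlonglongrightarrow> indicator (box a b) x)"
proof -
  define q where "q = (\<lambda>i (x::real^'n). (x $ i + (- a $ i)) * (b $ i + (- 1) * x $ i))"
  define \<psi> where "\<psi> = (\<lambda>x. \<Prod>i\<in>UNIV. (max 0 (q i x))\<^sup>2)"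
  define F where "F = (\<lambda>(n::nat) x. 1 - 1 / (1 + real n * (\<psi> x)\<^sup>2))"
  \<comment> \<open>This excludes that both factors of \<open>q i\<close> are negative, which would
    make \<open>q i\<close> positive between reversed endpoints.\<close>
  have less: "a $ i < b $ i" for i using ab by (simp add: interval_ne_empty_cart)
  have plus: "C1_fun (\<lambda>x. f x + k)" if "C1_fun f" for f :: "real^'n \<Rightarrow> real" and k
    by (rule C1_fun_compose[OF that, of "\<lambda>s. s + k" "\<lambda>s. 1"]) (auto intro!: derivative_eq_intros)
  have q: "C1_fun (q i)" for i
  proof -
    have "C1_fun (\<lambda>x. b $ i + (- 1) * x $ i)"
      using plus[OF C1_fun_mult[OF C1_fun_const[of "-1"] C1_fun_nth[of i]], of "b $ i"]
      by (simp add: add.commute)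
    then show ?thesis unfolding q_def by (intro C1_fun_mult plus C1_fun_nth)
  qed
  have psi: "C1_fun \<psi>"
    unfolding \<psi>_def
    by (intro C1_fun_prod C1_fun_compose[OF q DERIV_pos_part_square]) (auto intro!: continuous_intros)
  have C1: "C1_fun (F n)" for n
  proof -
    have pos: "1 + real n * s\<^sup>2 > 0" for s by (simp add: add_pos_nonneg)
    have "((\<lambda>s. 1 - 1 / (1 + real n * s\<^sup>2)) has_real_derivative
        (2 * real n * s) / (1 + real n * s\<^sup>2)\<^sup>2) (at s)" for s
      using pos[of s] by (auto intro!: derivative_eq_intros simp: power2_eq_square)
    moreover have "continuous_on UNIV (\<lambda>s. (2 * real n * s) / (1 + real n * s\<^sup>2)\<^sup>2)"
      using pos by (intro continuous_intros ballI) (metis less_irrefl power_not_zero)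
    ultimately show ?thesis unfolding F_def by (intro C1_fun_compose[OF psi])
  qed
  have psi_pos: "\<psi> x \<noteq> 0 \<longleftrightarrow> x \<in> box a b" for x
  proof -
    have "q i x > 0 \<longleftrightarrow> a $ i < x $ i \<and> x $ i < b $ i" for i
      using less[of i] by (auto simp: q_def zero_less_mult_iff)
    moreover have "\<psi> x \<noteq> 0 \<longleftrightarrow> (\<forall>i. q i x > 0)"
    proof -
      have "\<psi> x \<noteq> 0 \<longleftrightarrow> (\<forall>i. max 0 (q i x) \<noteq> 0)" by (simp add: \<psi>_def)
      moreover have "max 0 (q i x) \<noteq> 0 \<longleftrightarrow> q i x > 0" for i by linarith
      ultimately show ?thesis by simp
    qed
    ultimately show ?thesis by (auto simp: mem_box_cart)
  qed
  have supp: "x \<in> cbox a b" if "F n x \<noteq> 0" for n x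
  proof -
    have "\<psi> x \<noteq> 0" using that by (auto simp: F_def)
    then show ?thesis using psi_pos box_subset_cbox by blast
  qed
  have bound: "\<bar>F n x\<bar> \<le> 1" for n x
  proof -
    have "1 + real n * (\<psi> x)\<^sup>2 \<ge> 1" by simp
    then have "0 \<le> 1 / (1 + real n * (\<psi> x)\<^sup>2)" "1 / (1 + real n * (\<psi> x)\<^sup>2) \<le> 1" by (simp_all add: divide_le_eq)
    then show ?thesis unfolding F_def by linarith
  qed
  have "(\<lambda>n. F n x) \<longlonglongrightarrow> indicator (box a b) x" for x
  proof (cases "x \<in> box a b")
    case True
    then have "(\<psi> x)\<^sup>2 > 0" using psi_pos by simp
    then have "filterlim (\<lambda>n. 1 + (\<psi> x)\<^sup>2 * real n) at_top sequentially"
      by (intro filterlim_tendsto_add_at_top[OF tendsto_const]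
          filterlim_tendsto_pos_mult_at_top[OF tendsto_const] filterlim_real_sequentially)
    then have "(\<lambda>n. inverse (1 + (\<psi> x)\<^sup>2 * real n)) \<longlonglongrightarrow> 0"
      by (rule tendsto_inverse_0_at_top)
    then have "(\<lambda>n. 1 - inverse (1 + (\<psi> x)\<^sup>2 * real n)) \<longlonglongrightarrow> 1 - 0"
      by (intro tendsto_intros)
    then show ?thesis using True by (simp add: F_def divide_inverse mult.commute)
  next
    case False
    then have "\<psi> x = 0" using psi_pos by blast
    then show ?thesis using False by (simp add: F_def)
  qed
  then show ?thesis using C1 supp bound by (intro exI[of _ F]) blast
qed

text \<open>Dynkin's argument: boxes are stable under intersection and generate the Borel sets. It
  is run directly on integrals because \<open>g\<close> is signed. Complements need the total
  integral to vanish, which holds since the bounded \<open>D\<close> lies inside one box.\<close>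

lemma integral_borel_zero:
  fixes g :: "real^'n \<Rightarrow> real"
  assumes D: "D \<in> lmeasurable" "bounded D" and g: "integrable (lebesgue_on D) g"
    and box: "\<And>a b. integral\<^sup>L (lebesgue_on D) (\<lambda>x. indicator (box a b) x * g x) = 0"
    and A: "A \<in> sets borel"
  shows "integral\<^sup>L (lebesgue_on D) (\<lambda>x. indicator A x * g x) = 0"
proof -
  let ?M = "lebesgue_on D"
  have borelM: "indicator S \<in> borel_measurable ?M" if "S \<in> sets borel" for S :: "(real^'n) set"
    using that by (intro measurable_restrict_space1 borel_measurable_indicator) auto
  have int: "integrable ?M (\<lambda>x. indicator S x * g x)" if S: "S \<in> sets borel" for S
  proof (rule Bochner_Integration.integrable_bound[OF g])
    show "(\<lambda>x. indicator S x * g x) \<in> borel_measurable ?M"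
      using borelM[OF S] g by (intro borel_measurable_times) auto
  qed (auto simp: indicator_def)
  have total: "integral\<^sup>L ?M g = 0"
  proof -
    obtain c where c: "D \<subseteq> box (- c) c" using bounded_subset_box_symmetric[OF D(2)] by blast
    have "integral\<^sup>L ?M g = integral\<^sup>L ?M (\<lambda>x. indicator (box (- c) c) x * g x)"
      using c by (intro Bochner_Integration.integral_cong) (auto simp: indicator_def)
    then show ?thesis using box by simp
  qed
  have gen: "sets (borel :: (real^'n) measure) = sigma_sets UNIV (range (\<lambda>(a, b). box a b))"
    unfolding borel_eq_box by simp
  have stable: "Int_stable (range (\<lambda>(a, b). box a b :: (real^'n) set))"
  proof (rule Int_stableI)
    fix S T assume "S \<in> range (\<lambda>(a, b). box a b :: (real^'n) set)" "T \<in> range (\<lambda>(a, b). box a b :: (real^'n) set)"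
    then obtain a b c d where "S = box a b" "T = box c d" by auto
    then show "S \<inter> T \<in> range (\<lambda>(a, b). box a b)"
      by (auto simp: box_Int_box)
  qed
  have "A \<in> sigma_sets UNIV (range (\<lambda>(a, b). box a b))" using A gen by blast
  with stable subset_UNIV[of "range (\<lambda>(a, b). box a b :: (real^'n) set)", folded Pow_UNIV]
  show ?thesis
  proof (induction rule: sigma_sets_induct_disjoint)
    case (compl S)
    have S: "S \<in> sets borel" using compl(1) gen by blast
    have "(\<lambda>x. indicator (UNIV - S) x * g x) = (\<lambda>x. g x - indicator S x * g x)"
      by (auto simp: indicator_def fun_eq_iff)
    then show ?case using compl(2) total Bochner_Integration.integral_diff[OF g int[OF S]] by simp
  next
    case (union S)
    have S: "\<And>i. S i \<in> sets borel" using union(2) gen by blast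
    have eq: "(LINT x:R \<inter> D|?M. g x) = integral\<^sup>L ?M (\<lambda>x. indicator R x * g x)" for R
      unfolding set_lebesgue_integral_def
      by (intro Bochner_Integration.integral_cong) (auto simp: indicator_def)
    have SM: "R \<inter> D \<in> sets ?M" if "R \<in> sets borel" for R
      using that D(1) by (auto simp: sets_restrict_space)
    have "(LINT x:(\<Union>i. S i \<inter> D)|?M. g x) = (\<Sum>i. (LINT x:S i \<inter> D|?M. g x))"
    proof (rule lebesgue_integral_countable_add)
      show "set_integrable ?M (\<Union>i. S i \<inter> D) g"
        unfolding set_integrable_def by (intro integrable_mult_indicator g sets.countable_UN) (use SM S in auto)
      show "S i \<inter> D \<inter> (S j \<inter> D) = {}" if "i \<noteq> j" for i j
        using union(1) that unfolding disjoint_family_on_def by blast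
    qed (use SM S in auto)
    then show ?case using union(3) eq[of "\<Union>i. S i"] by (simp add: eq)
  qed (use box in auto)
qed

text \<open>A Lebesgue set is a Borel set up to a null set, so \<open>g\<close> and 0 have the same
  integral over every measurable set and are equal as densities.\<close>

lemma AE_zero_if_box_integrals_zero:
  fixes g :: "real^'n \<Rightarrow> real"
  assumes D: "D \<in> lmeasurable" "bounded D" and g: "integrable (lebesgue_on D) g"
    and box: "\<And>a b. integral\<^sup>L (lebesgue_on D) (\<lambda>x. indicator (box a b) x * g x) = 0"
  shows "AE x in lebesgue_on D. g x = 0"
proof (rule density_unique_real[OF g integrable_zero])
  fix A assume "A \<in> sets (lebesgue_on D)"
  then have A: "A \<in> sets lebesgue" using D(1) by (auto simp: sets_restrict_space)
  then obtain S N N' where S: "A = S \<union> N" "N \<subseteq> N'" "N' \<in> null_sets lborel" "S \<in> sets lborel"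
    by (rule sets_completionE)
  have "AE x in lborel. x \<notin> N'" using S(3) by (rule AE_not_in)
  then have "AE x in lebesgue. x \<notin> N'" by (rule AE_completion)
  then have "AE x in lebesgue_on D. x \<notin> N'"
    using D(1) by (subst AE_restrict_space_iff) auto
  then have ae: "AE x in lebesgue_on D. indicat_real A x *\<^sub>R g x = indicator S x * g x"
    by eventually_elim (use S in \<open>auto simp: indicator_def\<close>)
  have "(LINT x:A|lebesgue_on D. g x) = integral\<^sup>L (lebesgue_on D) (\<lambda>x. indicator S x * g x)"
    unfolding set_lebesgue_integral_def
  proof (rule integral_cong_AE[OF _ _ ae])
    show "(\<lambda>x. indicat_real A x *\<^sub>R g x) \<in> borel_measurable (lebesgue_on D)"
      using measurable_restrict_space1[OF borel_measurable_indicator[OF A], of D] g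
      by (intro borel_measurable_scaleR) auto
    show "(\<lambda>x. indicator S x * g x) \<in> borel_measurable (lebesgue_on D)"
      using measurable_restrict_space1[OF borel_measurable_indicator[of S lebesgue], of D] S(4) g
      by (intro borel_measurable_times) auto
  qed
  then show "(LINT x:A|lebesgue_on D. g x) = (LINT x:A|lebesgue_on D. 0)"
    using integral_borel_zero[OF D g box] S(4) by (simp add: set_lebesgue_integral_def)
qed

text \<open>A scalar cutoff times a unit vector isolates one component, and dominated convergence
  replaces the cutoff by the indicator of a box. Test fields live on the whole space, so boxes that
  stick out of \<open>D\<close> are allowed as well.\<close>

lemma fundamental_lemma_test_field:
  fixes g :: "vec3 \<Rightarrow> vec3"
  assumes D: "D \<in> lmeasurable" "bounded D" and g: "integrable (lebesgue_on D) g"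
    and test: "\<And>\<phi>. test_field \<phi> \<Longrightarrow> integral\<^sup>L (lebesgue_on D) (\<lambda>x. g x \<bullet> \<phi> x) = 0"
  shows "AE x in lebesgue_on D. g x = 0"
proof -
  let ?M = "lebesgue_on D"
  have gj: "integrable ?M (\<lambda>x. g x $ j)" for j
    using integrable_inner_left[of "axis j 1" ?M g] g by (simp add: inner_axis)
  have "AE x in ?M. g x $ j = 0" for j
  proof (rule AE_zero_if_box_integrals_zero[OF D gj])
    fix a b :: vec3
    show "integral\<^sup>L ?M (\<lambda>x. indicator (box a b) x * g x $ j) = 0"
    proof (cases "box a b = {}")
      case False
      obtain F where F: "\<And>n::nat. C1_fun (F n)" "\<And>n x. F n x \<noteq> 0 \<Longrightarrow> x \<in> cbox a b"
        "\<And>n x. \<bar>F n x\<bar> \<le> 1" "\<And>x. (\<lambda>n. F n x) \<longlonglongrightarrow> indicator (box a b) x"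
        using box_indicator_C1_limit[OF False] by blast
      have zero: "integral\<^sup>L ?M (\<lambda>x. F n x * g x $ j) = 0" for n
        using test[OF test_field_axis[where j = j, OF F(1,2)], of n] by (simp add: inner_axis mult.commute)
      have meas: "(\<lambda>x. F n x * g x $ j) \<in> borel_measurable ?M" for n
      proof (rule borel_measurable_times)
        show "F n \<in> borel_measurable ?M"
          using C1_fun_continuous[OF F(1)[of n]]
          by (intro measurable_restrict_space1 measurable_completion)
             (simp add: borel_measurable_continuous_onI)
      qed (use gj in auto)
      have "(\<lambda>n. integral\<^sup>L ?M (\<lambda>x. F n x * g x $ j)) \<longlonglongrightarrow> integral\<^sup>L ?M (\<lambda>x. indicator (box a b) x * g x $ j)"
      proof (rule integral_dominated_convergence[where w = "\<lambda>x. \<bar>g x $ j\<bar>"])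
        show "(\<lambda>x. indicator (box a b) x * g x $ j) \<in> borel_measurable ?M"
          using measurable_restrict_space1[OF borel_measurable_indicator[of "box a b" lebesgue], of D] gj[of j]
          by (intro borel_measurable_times) auto
        show "AE x in ?M. (\<lambda>n. F n x * g x $ j) \<longlonglongrightarrow> indicator (box a b) x * g x $ j"
          by (intro AE_I2 tendsto_intros F(4))
        show "AE x in ?M. norm (F n x * g x $ j) \<le> \<bar>g x $ j\<bar>" for n
          using F(3) by (intro AE_I2) (auto simp: abs_mult mult_left_le_one_le)
      qed (use gj meas in auto)
      then show ?thesis using zero LIMSEQ_unique[OF _ tendsto_const] by simp
    qed simp
  qed
  then have "AE x in ?M. \<forall>j\<in>UNIV. g x $ j = 0" by (intro AE_finite_allI) auto
  then show ?thesis by eventually_elim (simp add: vec_eq_iff)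
qed

section \<open>Weak curls\<close>

context
  fixes D :: "vec3 set"
  assumes D: "D \<in> lmeasurable" "bounded D"
begin

lemma L2_integrable:
  assumes "L2 D v"
  shows "integrable (lebesgue_on D) v"
proof (rule Bochner_Integration.integrable_bound)
  show "integrable (lebesgue_on D) (\<lambda>x. (norm (v x))\<^sup>2 + 1)"
    using assms finite_measure.integrable_const[OF finite_measure_lebesgue_on[OF D(1)], of 1]
    by (intro Bochner_Integration.integrable_add) (auto simp: L2_def)
  have "norm (v x) \<le> norm ((norm (v x))\<^sup>2 + 1)" for x
  proof -
    have "2 * norm (v x) \<le> (norm (v x))\<^sup>2 + 1" using sum_squares_bound[of "norm (v x)" 1] by simp
    then have "norm (v x) \<le> (norm (v x))\<^sup>2 + 1" using norm_ge_zero[of "v x"] by linarith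
    then show ?thesis by simp
  qed
  then show "AE x in lebesgue_on D. norm (v x) \<le> norm ((norm (v x))\<^sup>2 + 1)" by simp
qed (use assms in \<open>simp add: L2_def\<close>)

lemma L2_test_field:
  assumes "test_field \<phi>"
  shows "L2 D \<phi>" "L2 D (curl_cl \<phi>)"
proof -
  have "continuous_on UNIV \<phi>"
    using assms by (intro continuous_at_imp_continuous_on) (auto simp: test_field_def differentiable_imp_continuous_within)
  then show "L2 D \<phi>" by (rule L2_continuous[OF D(2,1)])
  have "continuous_on UNIV (\<lambda>x. curl_cl \<phi> x $ i)" for i
  proof -
    have pd: "continuous_on UNIV (pd \<phi> j l)" for j l using assms by (simp add: test_field_def)
    have "i = 1 \<or> i = 2 \<or> i = 3" by (rule exhaust_3)
    then show ?thesis by (auto simp: curl_cl_def intro!: continuous_on_diff pd)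
  qed
  then have "continuous_on UNIV (\<lambda>x. \<chi> i. curl_cl \<phi> x $ i)" by (rule continuous_on_vec_lambda)
  then show "L2 D (curl_cl \<phi>)" by (intro L2_continuous[OF D(2,1)]) simp
qed

lemma weak_curl0_add:
  assumes "weak_curl0 D v w" "weak_curl0 D v' w'"
  shows "weak_curl0 D (v + v') (w + w')"
  unfolding weak_curl0_def
proof (intro conjI allI impI)
  show "L2 D (v + v')" "L2 D (w + w')" using assms L2_add by (auto simp: weak_curl0_def)
  fix \<phi> assume \<phi>: "test_field \<phi>"
  note int = L2_integrable_inner[OF _ L2_test_field(1)[OF \<phi>]] L2_integrable_inner[OF _ L2_test_field(2)[OF \<phi>]]
  show "integral\<^sup>L (lebesgue_on D) (\<lambda>x. (v + v') x \<bullet> curl_cl \<phi> x) = integral\<^sup>L (lebesgue_on D) (\<lambda>x. (w + w') x \<bullet> \<phi> x)"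
    using assms \<phi> int by (auto simp: weak_curl0_def inner_add_left)
qed

lemma weak_curl0_scale:
  assumes "weak_curl0 D v w"
  shows "weak_curl0 D (r *\<^sub>R v) (r *\<^sub>R w)"
  using assms L2_scale by (auto simp: weak_curl0_def)

lemma weak_curl0_zero: "weak_curl0 D 0 0"
  by (simp add: weak_curl0_def L2_zero zero_fun_def)

text \<open>The difference of the two curls is annihilated by every test field. This makes the
  choice in \<open>curl\<close> immaterial up to null sets, and \<open>curl\<close> linear almost
  everywhere; allowing \<open>v\<close> and \<open>v'\<close> to differ on a null set also shows
  that null functions have null curl.\<close>

lemma weak_curl0_unique:
  assumes "weak_curl0 D v w" "weak_curl0 D v' w'" "AE x in lebesgue_on D. v x = v' x"
  shows "AE x in lebesgue_on D. w x = w' x"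
proof -
  have *: "weak_curl0 D (v + (-1) *\<^sub>R v') (w + (-1) *\<^sub>R w')"
    by (intro weak_curl0_add weak_curl0_scale assms)
  have "AE x in lebesgue_on D. (w + (-1) *\<^sub>R w') x = 0"
  proof (rule fundamental_lemma_test_field[OF D])
    show "integrable (lebesgue_on D) (w + (-1) *\<^sub>R w')"
      using * by (intro L2_integrable) (simp add: weak_curl0_def)
    fix \<phi> assume \<phi>: "test_field \<phi>"
    have "integral\<^sup>L (lebesgue_on D) (\<lambda>x. (w + (-1) *\<^sub>R w') x \<bullet> \<phi> x)
        = integral\<^sup>L (lebesgue_on D) (\<lambda>x. (v + (-1) *\<^sub>R v') x \<bullet> curl_cl \<phi> x)"
      using * \<phi> by (simp add: weak_curl0_def)
    also have "\<dots> = 0"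
    proof (rule integral_eq_zero_AE)
      show "AE x in lebesgue_on D. (v + (-1) *\<^sub>R v') x \<bullet> curl_cl \<phi> x = 0"
        using assms(3) by eventually_elim simp
    qed
    finally show "integral\<^sup>L (lebesgue_on D) (\<lambda>x. (w + (-1) *\<^sub>R w') x \<bullet> \<phi> x) = 0" .
  qed
  then show ?thesis by eventually_elim simp
qed

lemma subspace_H0curl: "subspace (H0curl D)"
proof (rule subspaceI)
  show "0 \<in> H0curl D" using weak_curl0_zero by (auto simp: H0curl_def)
  show "x + y \<in> H0curl D" if "x \<in> H0curl D" "y \<in> H0curl D" for x y
    using that weak_curl0_add by (fastforce simp: H0curl_def)
  show "r *\<^sub>R x \<in> H0curl D" if "x \<in> H0curl D" for r x
    using that weak_curl0_scale by (fastforce simp: H0curl_def)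
qed

lemma H0curl_L2: "v \<in> H0curl D \<Longrightarrow> L2 D v"
  by (auto simp: H0curl_def weak_curl0_def)

lemma weak_curl0_curl: "v \<in> H0curl D \<Longrightarrow> weak_curl0 D v (curl D v)"
  unfolding curl_def using someI_ex[of "weak_curl0 D v"] by (simp add: H0curl_def)

lemma curl_L2: "v \<in> H0curl D \<Longrightarrow> L2 D (curl D v)"
  using weak_curl0_curl by (auto simp: weak_curl0_def)

lemma curl_add_AE:
  assumes "v \<in> H0curl D" "w \<in> H0curl D"
  shows "AE x in lebesgue_on D. curl D (v + w) x = (curl D v + curl D w) x"
  by (rule weak_curl0_unique[OF weak_curl0_curl weak_curl0_add[OF weak_curl0_curl weak_curl0_curl]])
     (use assms subspace_add[OF subspace_H0curl] in auto)

lemma curl_scale_AE: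
  assumes "v \<in> H0curl D"
  shows "AE x in lebesgue_on D. curl D (r *\<^sub>R v) x = (r *\<^sub>R curl D v) x"
  by (rule weak_curl0_unique[OF weak_curl0_curl weak_curl0_scale[OF weak_curl0_curl]])
     (use assms subspace_scale[OF subspace_H0curl] in auto)

text \<open>Linearity of \<open>curl\<close> holds only almost everywhere, which suffices because
  \<open>ip\<close> does not see null sets.\<close>

lemma curl_semi_inner:
  assumes nu: "admissible_coeff D \<nu>"
  shows "semi_inner (H0curl D) (\<lambda>v w. ip D \<nu> (curl D v) (curl D w))"
proof -
  interpret ip: semi_inner "{v. L2 D v}" "ip D \<nu>" by (rule ip_semi_inner[OF D(1) nu])
  note cong = ip_cong_AE[OF D(1) nu]
  show ?thesis
  proof
    show "subspace (H0curl D)" by (rule subspace_H0curl)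
    show "ip D \<nu> (curl D x) (curl D y) = ip D \<nu> (curl D y) (curl D x)"
      if "x \<in> H0curl D" "y \<in> H0curl D" for x y
      using ip.sym[of "curl D x" "curl D y"] curl_L2 that by simp
    show "ip D \<nu> (curl D (x + y)) (curl D z) = ip D \<nu> (curl D x) (curl D z) + ip D \<nu> (curl D y) (curl D z)"
      if H: "x \<in> H0curl D" "y \<in> H0curl D" "z \<in> H0curl D" for x y z
    proof -
      have "ip D \<nu> (curl D (x + y)) (curl D z) = ip D \<nu> (curl D x + curl D y) (curl D z)"
        using H subspace_add[OF subspace_H0curl] curl_L2 L2_add curl_add_AE by (intro cong) auto
      then show ?thesis using ip.add_left[of "curl D x" "curl D y" "curl D z"] H curl_L2 by simp
    qed
    show "ip D \<nu> (curl D (r *\<^sub>R x)) (curl D y) = r * ip D \<nu> (curl D x) (curl D y)"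
      if H: "x \<in> H0curl D" "y \<in> H0curl D" for r x y
    proof -
      have "ip D \<nu> (curl D (r *\<^sub>R x)) (curl D y) = ip D \<nu> (r *\<^sub>R curl D x) (curl D y)"
        using H subspace_scale[OF subspace_H0curl] curl_L2 L2_scale curl_scale_AE by (intro cong) auto
      then show ?thesis using ip.scale_left[of "curl D x" "curl D y" r] H curl_L2 by simp
    qed
    show "0 \<le> ip D \<nu> (curl D x) (curl D x)" if "x \<in> H0curl D" for x
      using ip.nonneg[of "curl D x"] curl_L2 that by simp
  qed
qed

lemma weak_curl0_cong_AE:
  assumes w: "weak_curl0 D v w" and w': "L2 D w'" "AE x in lebesgue_on D. w x = w' x"
  shows "weak_curl0 D v w'"
  unfolding weak_curl0_def
proof (intro conjI allI impI)
  show "L2 D v" "L2 D w'" using assms by (auto simp: weak_curl0_def)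
  fix \<phi> assume \<phi>: "test_field \<phi>"
  have "integral\<^sup>L (lebesgue_on D) (\<lambda>x. w x \<bullet> \<phi> x) = integral\<^sup>L (lebesgue_on D) (\<lambda>x. w' x \<bullet> \<phi> x)"
  proof (rule integral_cong_AE)
    show "AE x in lebesgue_on D. w x \<bullet> \<phi> x = w' x \<bullet> \<phi> x" using w'(2) by eventually_elim simp
  qed (use w w' L2_test_field(1)[OF \<phi>] in \<open>auto simp: weak_curl0_def L2_def\<close>)
  then show "integral\<^sup>L (lebesgue_on D) (\<lambda>x. v x \<bullet> curl_cl \<phi> x) = integral\<^sup>L (lebesgue_on D) (\<lambda>x. w' x \<bullet> \<phi> x)"
    using w \<phi> by (simp add: weak_curl0_def)
qed

text \<open>Zero energy means that the chosen curl is null, and a null curl can be exchanged for 0.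
  This identifies \<open>H0curl0\<close> with the abstract \<open>H0\<close>, whatever the
  admissible weight.\<close>

lemma H0curl0_eq:
  assumes nu: "admissible_coeff D \<nu>"
  shows "H0curl0 D = {v \<in> H0curl D. ip D \<nu> (curl D v) (curl D v) = 0}"
proof -
  have "weak_curl0 D v (\<lambda>x. 0) \<longleftrightarrow> ip D \<nu> (curl D v) (curl D v) = 0" if v: "v \<in> H0curl D" for v
  proof -
    have "weak_curl0 D v (\<lambda>x. 0) \<longleftrightarrow> (AE x in lebesgue_on D. curl D v x = 0)"
    proof
      assume "weak_curl0 D v (\<lambda>x. 0)"
      from weak_curl0_unique[OF weak_curl0_curl[OF v] this]
      show "AE x in lebesgue_on D. curl D v x = 0" by simp
    next
      assume "AE x in lebesgue_on D. curl D v x = 0"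
      then show "weak_curl0 D v (\<lambda>x. 0)"
        using weak_curl0_cong_AE[OF weak_curl0_curl[OF v] L2_zero] by simp
    qed
    then show ?thesis using ip_eq_0_iff[OF D(1) nu curl_L2[OF v]] by simp
  qed
  then show ?thesis by (auto simp: H0curl0_def)
qed

end

section \<open>Finite dimensionality of the discrete space\<close>

lemma sum_fun_apply: "(\<Sum>i\<in>S. f i) x = (\<Sum>i\<in>S. f i x)" for f :: "'i \<Rightarrow> 'b \<Rightarrow> 'c::comm_monoid_add"
  by (induction S rule: infinite_finite_induct) auto

section \<open>Nedelec polynomials and piecewise fields\<close>

lemma poly_le_add: "poly_le k f \<Longrightarrow> poly_le k g \<Longrightarrow> poly_le k (\<lambda>x. f x + g x)"
proof -
  assume "poly_le k f" "poly_le k g"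
  then obtain c d where "\<And>x. f x = (\<Sum>m\<in>{m. mdeg m \<le> k}. c m * monom m x)"
    "\<And>x. g x = (\<Sum>m\<in>{m. mdeg m \<le> k}. d m * monom m x)" by (auto simp: poly_le_def)
  then show ?thesis
    unfolding poly_le_def by (intro exI[of _ "\<lambda>m. c m + d m"]) (simp add: sum.distrib algebra_simps)
qed

lemma poly_le_scale: "poly_le k f \<Longrightarrow> poly_le k (\<lambda>x. r * f x)"
proof -
  assume "poly_le k f"
  then obtain c where "\<And>x. f x = (\<Sum>m\<in>{m. mdeg m \<le> k}. c m * monom m x)" by (auto simp: poly_le_def)
  then show ?thesis
    unfolding poly_le_def by (intro exI[of _ "\<lambda>m. r * c m"]) (simp add: sum_distrib_left mult.assoc)
qed

lemma poly_hom_add: "poly_hom k f \<Longrightarrow> poly_hom k g \<Longrightarrow> poly_hom k (\<lambda>x. f x + g x)"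
proof -
  assume "poly_hom k f" "poly_hom k g"
  then obtain c d where "\<And>x. f x = (\<Sum>m\<in>{m. mdeg m = k}. c m * monom m x)"
    "\<And>x. g x = (\<Sum>m\<in>{m. mdeg m = k}. d m * monom m x)" by (auto simp: poly_hom_def)
  then show ?thesis
    unfolding poly_hom_def by (intro exI[of _ "\<lambda>m. c m + d m"]) (simp add: sum.distrib algebra_simps)
qed

lemma poly_hom_scale: "poly_hom k f \<Longrightarrow> poly_hom k (\<lambda>x. r * f x)"
proof -
  assume "poly_hom k f"
  then obtain c where "\<And>x. f x = (\<Sum>m\<in>{m. mdeg m = k}. c m * monom m x)" by (auto simp: poly_hom_def)
  then show ?thesis
    unfolding poly_hom_def by (intro exI[of _ "\<lambda>m. r * c m"]) (simp add: sum_distrib_left mult.assoc)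
qed

lemma nedelec_add:
  assumes "nedelec k f" "nedelec k g"
  shows "nedelec k (f + g)"
proof -
  obtain p q where f: "\<And>i. poly_le k (\<lambda>x. p x $ i)" "\<And>i. poly_hom k (\<lambda>x. q x $ i)" "\<And>x. f x = p x + cross3 x (q x)"
    using assms(1) by (auto simp: nedelec_def)
  obtain p' q' where g: "\<And>i. poly_le k (\<lambda>x. p' x $ i)" "\<And>i. poly_hom k (\<lambda>x. q' x $ i)" "\<And>x. g x = p' x + cross3 x (q' x)"
    using assms(2) by (auto simp: nedelec_def)
  show ?thesis
    unfolding nedelec_def
    by (intro exI[of _ "\<lambda>x. p x + p' x"] exI[of _ "\<lambda>x. q x + q' x"])
       (auto simp: f g cross_add_right poly_le_add poly_hom_add)
qed

lemma nedelec_scale: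
  assumes "nedelec k f"
  shows "nedelec k (r *\<^sub>R f)"
proof -
  obtain p q where f: "\<And>i. poly_le k (\<lambda>x. p x $ i)" "\<And>i. poly_hom k (\<lambda>x. q x $ i)" "\<And>x. f x = p x + cross3 x (q x)"
    using assms(1) by (auto simp: nedelec_def)
  show ?thesis
    unfolding nedelec_def
    by (intro exI[of _ "\<lambda>x. r *\<^sub>R p x"] exI[of _ "\<lambda>x. r *\<^sub>R q x"])
       (auto simp: f cross_mult_right poly_le_scale poly_hom_scale scaleR_right_distrib)
qed

lemma nedelec_zero: "nedelec k 0"
proof -
  have "poly_le k (\<lambda>x. 0)" "poly_hom k (\<lambda>x. 0)"
    unfolding poly_le_def poly_hom_def by (rule exI[of _ "\<lambda>m. 0"], simp)+
  then show ?thesis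
    unfolding nedelec_def by (intro exI[of _ "\<lambda>x. 0"]) auto
qed

lemma Vh0D:
  assumes "v \<in> Vh0 D T k" "K \<in> T"
  shows "\<exists>f. nedelec k f \<and> (AE x in lebesgue_on (interior (convex hull K)). v x = f x)"
  using assms by (simp add: Vh0_def)

lemma subspace_Vh0:
  assumes D: "D \<in> lmeasurable" "bounded D"
  shows "subspace (Vh0 D T k)"
proof (rule subspaceI)
  show "0 \<in> Vh0 D T k"
    unfolding Vh0_def using subspace_0[OF subspace_H0curl[OF D]] nedelec_zero
    by (intro CollectI conjI ballI exI[of _ 0]) auto
next
  fix u v assume u: "u \<in> Vh0 D T k" and v: "v \<in> Vh0 D T k"
  have "\<exists>f. nedelec k f \<and> (AE x in lebesgue_on (interior (convex hull K)). (u + v) x = f x)" if "K \<in> T" for K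
  proof -
    obtain f where f: "nedelec k f" "AE x in lebesgue_on (interior (convex hull K)). u x = f x"
      using Vh0D[OF u \<open>K \<in> T\<close>] by blast
    obtain g where g: "nedelec k g" "AE x in lebesgue_on (interior (convex hull K)). v x = g x"
      using Vh0D[OF v \<open>K \<in> T\<close>] by blast
    have "AE x in lebesgue_on (interior (convex hull K)). (u + v) x = (f + g) x"
      using f(2) g(2) by eventually_elim simp
    then show ?thesis using nedelec_add[OF f(1) g(1)] by blast
  qed
  then show "u + v \<in> Vh0 D T k"
    using u v subspace_add[OF subspace_H0curl[OF D]] by (simp add: Vh0_def)
next
  fix r v assume v: "v \<in> Vh0 D T k"
  have "\<exists>f. nedelec k f \<and> (AE x in lebesgue_on (interior (convex hull K)). (r *\<^sub>R v) x = f x)" if "K \<in> T" for K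
  proof -
    obtain f where f: "nedelec k f" "AE x in lebesgue_on (interior (convex hull K)). v x = f x"
      using Vh0D[OF v \<open>K \<in> T\<close>] by blast
    have "AE x in lebesgue_on (interior (convex hull K)). (r *\<^sub>R v) x = (r *\<^sub>R f) x"
      using f(2) by eventually_elim simp
    then show ?thesis using nedelec_scale[OF f(1)] by blast
  qed
  then show "r *\<^sub>R v \<in> Vh0 D T k"
    using v subspace_scale[OF subspace_H0curl[OF D]] by (simp add: Vh0_def)
qed

lemma finite_mdeg_le: "finite {m. mdeg m \<le> k}"
  by (rule finite_subset[of _ "{..k} \<times> {..k} \<times> {..k}"]) (auto simp: mdeg_def)

lemma finite_mdeg_eq: "finite {m. mdeg m = k}"
  by (rule finite_subset[OF _ finite_mdeg_le[of k]]) auto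

text \<open>Only a finite generating set is wanted, so the monomial fields \<open>b1\<close> and the
  cross products \<open>b2\<close> are taken without regard to linear dependence.\<close>

lemma nedelec_finite_span:
  "\<exists>B. finite B \<and> {f. nedelec k f} \<subseteq> span B"
proof -
  define b1 where "b1 = (\<lambda>(m, j::3) x. monom m x *\<^sub>R (axis j 1 :: vec3))"
  define b2 where "b2 = (\<lambda>(m, j::3) x. cross3 x (monom m x *\<^sub>R (axis j 1 :: vec3)))"
  let ?I = "{m. mdeg m \<le> k} \<times> UNIV" and ?J = "{m. mdeg m = k} \<times> UNIV"
  define B where "B = b1 ` ?I \<union> b2 ` ?J"
  have "finite B" unfolding B_def by (intro finite_UnI finite_imageI finite_cartesian_product finite_mdeg_le finite_mdeg_eq) auto
  moreover have "f \<in> span B" if nf: "nedelec k f" for f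
  proof -
    obtain p q where f: "\<And>i. poly_le k (\<lambda>x. p x $ i)" "\<And>i. poly_hom k (\<lambda>x. q x $ i)" "\<And>x. f x = p x + cross3 x (q x)"
      using nf by (auto simp: nedelec_def)
    obtain c where c: "\<And>i x. p x $ i = (\<Sum>m\<in>{m. mdeg m \<le> k}. c i m * monom m x)"
      using f(1) unfolding poly_le_def by metis
    obtain d where d: "\<And>i x. q x $ i = (\<Sum>m\<in>{m. mdeg m = k}. d i m * monom m x)"
      using f(2) unfolding poly_hom_def by metis
    have basis: "y = (\<Sum>j\<in>UNIV. (y $ j) *\<^sub>R axis j 1)" for y :: vec3
      by (simp add: vec_eq_iff axis_def if_distrib cong: if_cong)
    have p: "p x = (\<Sum>j\<in>UNIV. \<Sum>m\<in>{m. mdeg m \<le> k}. c j m *\<^sub>R b1 (m, j) x)" for x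
      by (subst basis) (simp add: c b1_def scaleR_sum_left)
    have lin: "linear (cross3 x)" for x
      by (rule linearI) (auto simp: cross_add_right cross_mult_right)
    have q: "cross3 x (q x) = (\<Sum>j\<in>UNIV. \<Sum>m\<in>{m. mdeg m = k}. d j m *\<^sub>R b2 (m, j) x)" for x
      by (subst basis[of "q x"])
         (simp add: d b2_def scaleR_sum_left linear_sum[OF lin] cross_mult_right)
    have "f = (\<Sum>j\<in>UNIV. \<Sum>m\<in>{m. mdeg m \<le> k}. c j m *\<^sub>R b1 (m, j)) + (\<Sum>j\<in>UNIV. \<Sum>m\<in>{m. mdeg m = k}. d j m *\<^sub>R b2 (m, j))"
      by (rule ext) (simp add: f(3) p q sum_fun_apply)
    also have "\<dots> \<in> span B"
      by (intro span_add span_sum span_scale span_base) (auto simp: B_def)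
    finally show ?thesis .
  qed
  ultimately show ?thesis by blast
qed

section \<open>Mesh cells up to null sets\<close>

lemma AE_lebesgue_on_iff: "S \<in> sets lebesgue \<Longrightarrow> (AE x in lebesgue_on S. P x) \<longleftrightarrow> (AE x in lebesgue. x \<in> S \<longrightarrow> P x)"
  by (subst AE_restrict_space_iff) auto

text \<open>The closed cells cover \<open>D\<close>, and the finitely many frontiers of convex sets
  are negligible.\<close>

lemma AE_mesh_interior:
  assumes D: "D \<in> lmeasurable" and mesh: "simplicial_mesh D T"
  shows "AE x in lebesgue_on D. \<exists>K\<in>T. x \<in> interior (convex hull K)"
proof -
  have T: "finite T" "(\<Union>K\<in>T. convex hull K) = closure D"
    using mesh by (auto simp: simplicial_mesh_def)
  have "AE x in lebesgue. \<forall>K\<in>T. x \<notin> frontier (convex hull K)"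
  proof (intro AE_finite_allI T(1))
    fix K
    have "negligible (frontier (convex hull K))" by (rule negligible_convex_frontier) simp
    then show "AE x in lebesgue. x \<notin> frontier (convex hull K)"
      by (simp add: negligible_iff_null_sets AE_not_in)
  qed
  then have "AE x in lebesgue. x \<in> D \<longrightarrow> (\<exists>K\<in>T. x \<in> interior (convex hull K))"
  proof eventually_elim
    case (elim x)
    show ?case
    proof
      assume "x \<in> D"
      then obtain K where K: "K \<in> T" "x \<in> convex hull K" using T(2) closure_subset by blast
      then show "\<exists>K\<in>T. x \<in> interior (convex hull K)"
        using elim closure_subset[of "convex hull K"] by (auto simp: frontier_def)
    qed
  qed
  then show ?thesis using D by (simp add: AE_lebesgue_on_iff)
qed

text \<open>The Nedelec generators are cut off cell by cell. The resulting fields satisfy no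
  continuity across faces and are in general not discrete fields, which is why the abstract theory
  lets \<open>B\<close> lie outside the spaces it generates.\<close>

lemma Vh0_finite_span:
  assumes D: "D \<in> lmeasurable" and mesh: "simplicial_mesh D T"
  shows "\<exists>B. finite B \<and> (\<forall>v\<in>Vh0 D T k. \<exists>s\<in>span B. AE x in lebesgue_on D. v x = s x)"
proof -
  have T: "finite T" using mesh by (simp add: simplicial_mesh_def)
  obtain B where B: "finite B" "{f. nedelec k f} \<subseteq> span B" using nedelec_finite_span by blast
  \<comment> \<open>Choosing a cell per point avoids proving that cell interiors are disjoint; the spanning
    fields then need not be measurable, which is harmless as only a.e. equality is claimed.\<close>
  define \<kappa> where "\<kappa> = (\<lambda>x. SOME K. K \<in> T \<and> x \<in> interior (convex hull K))"
  define R where "R = (\<lambda>K (f::vec3 \<Rightarrow> vec3) x. if \<kappa> x = K then f x else 0)"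
  have linR: "linear (R K)" for K by (rule linearI) (auto simp: R_def fun_eq_iff)
  define B' where "B' = (\<Union>K\<in>T. R K ` B)"
  have "finite B'" unfolding B'_def using T B(1) by auto
  moreover have "\<exists>s\<in>span B'. AE x in lebesgue_on D. v x = s x" if v: "v \<in> Vh0 D T k" for v
  proof -
    have "\<forall>K\<in>T. \<exists>f. nedelec k f \<and> (AE x in lebesgue_on (interior (convex hull K)). v x = f x)"
      using v by (simp add: Vh0_def)
    then obtain f where f: "\<And>K. K \<in> T \<Longrightarrow> nedelec k (f K)"
      "\<And>K. K \<in> T \<Longrightarrow> AE x in lebesgue_on (interior (convex hull K)). v x = f K x"
      by metis
    define s where "s = (\<Sum>K\<in>T. R K (f K))"
    have "R K (f K) \<in> span B'" if K: "K \<in> T" for K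
    proof -
      have "f K \<in> span B" using f(1)[OF K] B(2) by blast
      then have "R K (f K) \<in> span (R K ` B)" using linear_span_image[OF linR] by blast
      then show ?thesis using span_mono[of "R K ` B" B'] K by (auto simp: B'_def)
    qed
    then have "s \<in> span B'" unfolding s_def by (intro span_sum)
    moreover have "AE x in lebesgue_on D. v x = s x"
    proof -
      have "AE x in lebesgue. \<forall>K\<in>T. x \<in> interior (convex hull K) \<longrightarrow> v x = f K x"
        using f(2) by (intro AE_finite_allI T) (simp add: AE_lebesgue_on_iff)
      then have "AE x in lebesgue_on D. \<forall>K\<in>T. x \<in> interior (convex hull K) \<longrightarrow> v x = f K x"
        using D by (simp add: AE_lebesgue_on_iff eventually_mono)
      with AE_mesh_interior[OF D mesh] show ?thesis
      proof eventually_elim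
        case (elim x)
        have k: "\<kappa> x \<in> T" "x \<in> interior (convex hull (\<kappa> x))"
          using someI_ex[of "\<lambda>K. K \<in> T \<and> x \<in> interior (convex hull K)"] elim(1) by (auto simp: \<kappa>_def)
        have "s x = (\<Sum>K\<in>T. if K = \<kappa> x then f K x else 0)"
          unfolding s_def sum_fun_apply by (intro sum.cong) (auto simp: R_def)
        also have "\<dots> = f (\<kappa> x) x" using T k(1) by simp
        finally show ?case using elim(2) k by simp
      qed
    qed
    ultimately show ?thesis by blast
  qed
  ultimately show ?thesis by blast
qed

section \<open>Quasi-optimality\<close>

theorem theorem4p5:
  fixes D :: "vec3 set" and \<epsilon> \<nu> :: "vec3 \<Rightarrow> real^3^3" and \<omega> :: real
    and T :: "vec3 set set" and k :: nat
  assumes dom: "lipschitz_domain D"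
    and eps: "admissible_coeff D \<epsilon>" and nu: "admissible_coeff D \<nu>"
    and om: "0 < \<omega>"
    and wellposed: "\<forall>L\<in>dual D \<epsilon> \<nu> \<omega>. \<exists>v\<in>H0curl D.
        (\<forall>w\<in>H0curl D. bform D \<epsilon> \<nu> \<omega> v w = L w) \<and>
        (\<forall>v'\<in>H0curl D. (\<forall>w\<in>H0curl D. bform D \<epsilon> \<nu> \<omega> v' w = L w) \<longrightarrow>
            (AE x in lebesgue_on D. v' x = v x))"
    and mesh: "simplicial_mesh D T"
    and gdiv: "gamma_div D \<epsilon> \<nu> \<omega> T k \<le> 1"
  shows "(\<forall>J\<in>dual D \<epsilon> \<nu> \<omega>. \<forall>E Eh.
            E \<in> H0curl D \<longrightarrow> (\<forall>w\<in>H0curl D. bform D \<epsilon> \<nu> \<omega> E w = J w) \<longrightarrow>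
            Eh \<in> Vh0 D T k \<longrightarrow> (\<forall>wh\<in>Vh0 D T k. bform D \<epsilon> \<nu> \<omega> Eh wh = J wh) \<longrightarrow>
            (1 - 15 * gamma_div D \<epsilon> \<nu> \<omega> T k - 4 * (gamma_ap D \<epsilon> \<nu> \<omega> T k)^2)
               * tnorm D \<epsilon> \<nu> \<omega> (\<lambda>x. E x - Eh x)
            \<le> Inf {tnorm D \<epsilon> \<nu> \<omega> (\<lambda>x. E x - vh x) | vh. vh \<in> Vh0 D T k})
       \<and> (15 * gamma_div D \<epsilon> \<nu> \<omega> T k + 4 * (gamma_ap D \<epsilon> \<nu> \<omega> T k)^2 < 1 \<longrightarrow>
          (\<forall>J\<in>dual D \<epsilon> \<nu> \<omega>. \<exists>Eh\<in>Vh0 D T k.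
              (\<forall>wh\<in>Vh0 D T k. bform D \<epsilon> \<nu> \<omega> Eh wh = J wh) \<and>
              (\<forall>Eh'\<in>Vh0 D T k. (\<forall>wh\<in>Vh0 D T k. bform D \<epsilon> \<nu> \<omega> Eh' wh = J wh) \<longrightarrow>
                  (AE x in lebesgue_on D. Eh' x = Eh x))))"
proof -
  have "open D" and bdd: "bounded D" using dom by (auto simp: lipschitz_domain_def)
  then have D: "D \<in> lmeasurable" by (simp add: bounded_set_imp_lmeasurable lmeasurable_open)
  let ?H = "H0curl D" and ?Vh = "Vh0 D T k"
  interpret cf: curl_forms "{v. L2 D v}" "ip D \<epsilon>" ?H "\<lambda>v w. ip D \<nu> (curl D v) (curl D w)" \<omega>
    unfolding curl_forms_def curl_forms_axioms_def
    using ip_semi_inner[OF D eps] curl_semi_inner[OF D bdd nu] H0curl_L2[OF D bdd] om by auto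
  have b_eq: "cf.b = bform D \<epsilon> \<nu> \<omega>" by (simp add: fun_eq_iff cf.b_def bform_def)
  have wn_eps: "wnorm D \<epsilon> = cf.E.nrm" by (simp add: fun_eq_iff wnorm_def cf.E.nrm_def)
  have wn_nu: "wnorm D \<nu> (curl D v) = cf.C.nrm v" for v by (simp add: wnorm_def cf.C.nrm_def)
  have tn: "tnorm D \<epsilon> \<nu> \<omega> w = cf.T.nrm w" if "w \<in> ?H" for w
    by (simp add: tnorm_def wn_eps wn_nu cf.T_nrm_eq[OF that] power_mult_distrib)
  have H0_eq: "cf.H0 = H0curl0 D" by (simp add: cf.H0_def H0curl0_eq[OF D bdd nu])
  have dual_eq: "cf.dual_H = dual D \<epsilon> \<nu> \<omega>"
    unfolding cf.dual_H_def dual_def plus_fun_def scaleR_fun_def by (simp add: tn)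
  have subN: "subspace {v :: vec3 \<Rightarrow> vec3. AE x in lebesgue_on D. v x = 0}"
    by (rule subspaceI) auto
  obtain B where B: "finite B" "\<forall>v\<in>?Vh. \<exists>s\<in>span B. AE x in lebesgue_on D. v x = s x"
    using Vh0_finite_span[OF D mesh, of k] by auto
  have VhH: "?Vh \<subseteq> ?H" by (auto simp: Vh0_def)
  \<comment> \<open>The forward direction reads off the weighted norm alone. The converse needs
    uniqueness of the weak curl, since \<open>curl\<close> of a null function is merely some null
    function.\<close>
  have null: "cf.a v v = 0 \<longleftrightarrow> (AE x in lebesgue_on D. v x = 0)" if v: "v \<in> ?H" for v
  proof
    assume a0: "cf.a v v = 0"
    have "0 \<le> ip D \<epsilon> v v" "0 \<le> ip D \<nu> (curl D v) (curl D v)"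
      using cf.E.nonneg[of v] cf.C.nonneg[OF v] H0curl_L2[OF D bdd v] by auto
    moreover from this have "0 \<le> \<omega>\<^sup>2 * ip D \<epsilon> v v" by simp
    ultimately have "\<omega>\<^sup>2 * ip D \<epsilon> v v = 0" using a0 unfolding cf.a_def by linarith
    then have "ip D \<epsilon> v v = 0" using om by simp
    then show "AE x in lebesgue_on D. v x = 0"
      using ip_eq_0_iff[OF D eps H0curl_L2[OF D bdd v]] by simp
  next
    assume ae: "AE x in lebesgue_on D. v x = 0"
    have "AE x in lebesgue_on D. curl D v x = 0 x"
      by (rule weak_curl0_unique[OF D bdd weak_curl0_curl[OF D bdd v] weak_curl0_zero[OF D bdd]])
         (use ae in simp)
    then have "ip D \<nu> (curl D v) (curl D v) = 0"
      using ip_eq_0_iff[OF D nu curl_L2[OF D bdd v]] by simp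
    moreover have "ip D \<epsilon> v v = 0" using ip_eq_0_iff[OF D eps H0curl_L2[OF D bdd v]] ae by simp
    ultimately show "cf.a v v = 0" by (simp add: cf.a_def)
  qed
  interpret gal: galerkin "{v. L2 D v}" "ip D \<epsilon>" ?H "\<lambda>v w. ip D \<nu> (curl D v) (curl D w)" \<omega>
    ?Vh "{v. AE x in lebesgue_on D. v x = 0}" B
  proof
    show "\<exists>v\<in>?H. \<forall>w\<in>?H. cf.b v w = l w" if "l \<in> cf.dual_H" for l
      using wellposed that unfolding b_eq dual_eq by blast
    show "\<exists>s\<in>span B. v - s \<in> {v. AE x in lebesgue_on D. v x = 0}" if "v \<in> ?Vh" for v
      using bspec[OF B(2) that] by simp
  qed (use subspace_Vh0[OF D bdd] VhH subN B(1) null in auto)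
  have HD: "v \<in> ?H \<Longrightarrow> w \<in> ?Vh \<Longrightarrow> v - w \<in> ?H" for v w
    using VhH by (intro cf.C.mem(2)) auto
  have tn_diff: "tnorm D \<epsilon> \<nu> \<omega> (\<lambda>x. v x - w x) = cf.T.nrm (v - w)" if "v \<in> ?H" "w \<in> ?Vh" for v w
    using tn[OF HD[OF that]] by (simp add: fun_diff_def)
  have Xh_eq: "Xh0 D \<epsilon> T k = gal.Xh"
    using VhH H0curl_L2[OF D bdd] unfolding Xh0_def gal.Xh_def orth_def Vh0_curl0_def H0_eq by blast
  have inL: "v - p \<in> {v. L2 D v}" if "v \<in> gal.Xh" "p \<in> H0curl0 D" for v p
    using that VhH gal.XhD unfolding H0_eq[symmetric]
    by (intro cf.E.mem(2)) (auto simp: cf.H0_def H0curl_L2[OF D bdd])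
  have orth_iff: "(\<lambda>x. v x - p x) \<in> orth D \<epsilon> (H0curl0 D) \<longleftrightarrow> (\<forall>s\<in>H0curl0 D. ip D \<epsilon> (v - p) s = 0)"
    if "v \<in> gal.Xh" "p \<in> H0curl0 D" for v p
    using inL[OF that] by (simp add: orth_def fun_diff_def)
  have div_eq: "gamma_div D \<epsilon> \<nu> \<omega> T k = gal.g_div"
  proof -
    have "gal.div_set = {\<omega> * wnorm D \<epsilon> p | vh p. vh \<in> Xh0 D \<epsilon> T k \<and> wnorm D \<nu> (curl D vh) = 1 \<and>
        p \<in> H0curl0 D \<and> (\<lambda>x. vh x - p x) \<in> orth D \<epsilon> (H0curl0 D)}"
      unfolding gal.div_set_def Xh_eq wn_eps wn_nu H0_eq
      by (intro Collect_cong ex_cong1) (auto simp: orth_iff)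
    then show ?thesis unfolding gamma_div_def gal.g_div_def by simp
  qed
  have ap_eq: "gamma_ap D \<epsilon> \<nu> \<omega> T k = gal.g_ap"
  proof -
    have "{\<omega> * cf.T.nrm (\<zeta> - vh) | vh. vh \<in> ?Vh} = {\<omega> * tnorm D \<epsilon> \<nu> \<omega> (\<lambda>x. \<zeta> x - vh x) | vh. vh \<in> ?Vh}"
      if "\<zeta> \<in> ?H" for \<zeta>
      by (intro Collect_cong ex_cong1) (auto simp: tn_diff[OF that])
    then have "gal.ap_set = {Inf {\<omega> * tnorm D \<epsilon> \<nu> \<omega> (\<lambda>x. \<zeta> x - vh x) | vh. vh \<in> ?Vh} | \<theta> \<zeta>.
        \<theta> \<in> orth D \<epsilon> (H0curl0 D) \<and> wnorm D \<epsilon> \<theta> = 1 \<and> \<zeta> \<in> ?H \<and>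
        (\<forall>w\<in>?H. bform D \<epsilon> \<nu> \<omega> w \<zeta> = ip D \<epsilon> w \<theta>)}"
      unfolding gal.ap_set_def b_eq wn_eps H0_eq orth_def
      by (intro Collect_cong ex_cong1) auto
    then show ?thesis unfolding gamma_ap_def gal.g_ap_def by simp
  qed
  let ?gd = "gamma_div D \<epsilon> \<nu> \<omega> T k" and ?ga = "gamma_ap D \<epsilon> \<nu> \<omega> T k"
  \<comment> \<open>\<open>gal.g_div\<close> and \<open>gal.g_ap\<^sup>2\<close> are nonnegative, so
    the constants 4 and 2 of the abstract estimate imply the stated 15 and 4.\<close>
  have coeff: "1 - 15 * ?gd - 4 * ?ga\<^sup>2 \<le> 1 - 4 * gal.g_div - 2 * gal.g_ap\<^sup>2"
    using gal.g_div_nonneg zero_le_power2[of gal.g_ap] unfolding div_eq ap_eq by linarith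
  show ?thesis
  proof (intro conjI ballI allI impI)
    fix J E Eh
    assume E: "E \<in> ?H" "\<forall>w\<in>?H. bform D \<epsilon> \<nu> \<omega> E w = J w"
      and Eh: "Eh \<in> ?Vh" "\<forall>wh\<in>?Vh. bform D \<epsilon> \<nu> \<omega> Eh wh = J wh"
    have orth: "cf.b (E - Eh) wh = 0" if "wh \<in> ?Vh" for wh
      using cf.b_diff_left[of E Eh wh] E Eh that VhH by (auto simp: b_eq)
    show "(1 - 15 * ?gd - 4 * ?ga\<^sup>2) * tnorm D \<epsilon> \<nu> \<omega> (\<lambda>x. E x - Eh x)
        \<le> Inf {tnorm D \<epsilon> \<nu> \<omega> (\<lambda>x. E x - vh x) | vh. vh \<in> ?Vh}"
    proof (rule cInf_greatest)
      show "{tnorm D \<epsilon> \<nu> \<omega> (\<lambda>x. E x - vh x) | vh. vh \<in> ?Vh} \<noteq> {}" using Eh(1) by blast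
      fix y assume "y \<in> {tnorm D \<epsilon> \<nu> \<omega> (\<lambda>x. E x - vh x) | vh. vh \<in> ?Vh}"
      then obtain vh where vh: "vh \<in> ?Vh" "y = tnorm D \<epsilon> \<nu> \<omega> (\<lambda>x. E x - vh x)" by blast
      have "(1 - 15 * ?gd - 4 * ?ga\<^sup>2) * cf.T.nrm (E - Eh)
          \<le> (1 - 4 * gal.g_div - 2 * gal.g_ap\<^sup>2) * cf.T.nrm (E - Eh)"
        by (rule mult_right_mono[OF coeff]) (use HD[OF E(1) Eh(1)] in simp)
      also have "\<dots> \<le> cf.T.nrm (E - vh)"
        by (rule gal.quasi_optimality[OF E(1) Eh(1) orth vh(1)])
      finally show "(1 - 15 * ?gd - 4 * ?ga\<^sup>2) * tnorm D \<epsilon> \<nu> \<omega> (\<lambda>x. E x - Eh x) \<le> y"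
        using tn_diff[OF E(1) Eh(1)] tn_diff[OF E(1) vh(1)] vh(2) by simp
    qed
  next
    fix J
    assume small: "15 * ?gd + 4 * ?ga\<^sup>2 < 1" and J: "J \<in> dual D \<epsilon> \<nu> \<omega>"
    have small': "4 * gal.g_div + 2 * gal.g_ap\<^sup>2 < 1" using small coeff by linarith
    obtain Eh where Eh: "Eh \<in> ?Vh" "\<forall>w\<in>?Vh. cf.b Eh w = J w"
      using gal.discrete_existence[OF small'] J unfolding dual_eq by blast
    show "\<exists>Eh\<in>?Vh. (\<forall>wh\<in>?Vh. bform D \<epsilon> \<nu> \<omega> Eh wh = J wh) \<and>
        (\<forall>Eh'\<in>?Vh. (\<forall>wh\<in>?Vh. bform D \<epsilon> \<nu> \<omega> Eh' wh = J wh) \<longrightarrow> (AE x in lebesgue_on D. Eh' x = Eh x))"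
    proof (intro bexI[of _ Eh] conjI ballI impI)
      fix Eh' assume Eh': "Eh' \<in> ?Vh" "\<forall>wh\<in>?Vh. bform D \<epsilon> \<nu> \<omega> Eh' wh = J wh"
      have "cf.b (Eh' - Eh) wh = 0" if "wh \<in> ?Vh" for wh
        using cf.b_diff_left[of Eh' Eh wh] Eh Eh' that VhH by (auto simp: b_eq)
      then have "cf.a (Eh' - Eh) (Eh' - Eh) = 0"
        using subspace_diff[OF subspace_Vh0[OF D bdd] Eh'(1) Eh(1)]
        by (intro gal.discrete_uniqueness[OF small']) auto
      then show "AE x in lebesgue_on D. Eh' x = Eh x"
        using null[of "Eh' - Eh"] HD[of Eh' Eh] Eh'(1) Eh(1) VhH by auto
    qed (use Eh in \<open>auto simp: b_eq\<close>)
  qed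
qed

end
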